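(* In the setting, and under the standing assumptions, described in the context, the random measure $\boldsymbol\mu$ on $(0,+\infty)\times H$ defined by $$\boldsymbol\mu((0,t]\times B)=\int_0^t\int_B\boldsymbol\lambda^m(s,\mathbf X_{s^-})\,\mathbf Q^m(s,\mathbf X_{s^-};dh)\,ds+\int_0^t\int_B\mathbf R^m(s,\mathbf X_{s^-};dh)\,dp^m_s,\quad t>0,\ B\in\mathcal B(H),$$ where $$\mathbf Q^m(t,h;B)=\int_E\mathbf 1_B(J_H(h,t,e))\,Q^m(t,S(h);de),\quad \mathbf R^m(t,h;B)=\int_E\mathbf 1_B(J_H(h,t,e))\,R^m(t,S(h);de),\quad \boldsymbol\lambda^m(t,h)=\lambda^m(t,S(h)),$$ is the $\mathbb F$-dual predictable projection of the random counting measure $\mathbf m$ associated with the history process $\mathbf X$, $$\mathbf m((0,t]\times B)=\sum_{n\ge1}\mathbf 1_{T_n\le t}\,\mathbf 1_{\xi_n\in B}.$$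
   Context: Spaces. $(E,d_E)$ is a complete separable metric space with Borel $\sigma$-algebra $\mathcal B(E)$, $(Z,\mathcal Z)$ a Lusin space, $(\Omega,\mathcal F,\mathbb P)$ a probability space with a complete right-continuous filtration $\mathbb F=(\mathcal F_t)_{t\ge0}$. $\mathcal D_E$ is the set of $E$-valued càdlàg functions on $[0,+\infty)$ (Skorokhod topology, Borel $\sigma$-algebra); $\widetilde{\mathcal D}_E\subset\mathcal D_E$ is the subset of piecewise constant paths whose discontinuity times do not accumulate in finite time. $\mathcal P(\cdot)$ denotes the set of probability measures; $\int_a^b=\int_{(a,b]}$. For a càdlàg process $\eta$, $\eta_{t\wedge\cdot}$ is the stopped path $s\mapsto\eta_{t\wedge s}$, and $\eta_{t^-\wedge\cdot}$ is the path equal to $\eta_s$ for $s<t$ and to $\eta_{t^-}$ for $s\ge t$. Signal. $(T_k)_{k\ge1}$ are $\mathbb F$-stopping times in $(0,+\infty]$ with $T_k\le T_{k+1}$ and $T_k<T_{k+1}$ on $\{T_k<+\infty\}$; $\zeta_k$ ($k\ge0$) are $E$-valued and $\mathcal F_{T_k}$-measurable ($T_0:=0$). $X_t=\zeta_0\mathbf 1_{[0,T_1)}(t)+\sum_{k\ge1}\zeta_k\mathbf 1_{[T_k,T_{k+1})}(t)$, with counting measure $m((0,t]\times A)=\sum_{k\ge1}\mathbf 1_{T_k\le t}\mathbf 1_{X_{T_k}\in A}$ and $\mathbb F$-dual predictable projection $\mu$. Observation. $W$ is a real $\mathbb F$-Brownian motion, $n$ an $\mathbb F$-adapted random counting measure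 on $(0,+\infty)\times Z$ with $\mathbb F$-dual predictable projection $\nu$. Measurable functions $b\colon[0,+\infty)\times\mathcal D_E\times\mathbb R\to\mathbb R$, $\sigma\colon[0,+\infty)\times\mathbb R\to(0,+\infty)$, $K^i,K^p\colon[0,+\infty)\times\mathcal D_E\times\mathbb R\times E\to\mathbb R$, $G^i,G^p\colon[0,+\infty)\times\mathcal D_E\times\mathbb R\times Z\to\mathbb R$ are given. Let $D^m=\{(\omega,t):m(\omega;\{t\}\times E)=1\}$, $J^m=\{(\omega,t):\mu(\omega;\{t\}\times E)>0\}$, $D^n=\{(\omega,t):n(\omega;\{t\}\times Z)=1\}$, $J^n=\{(\omega,t):\nu(\omega;\{t\}\times Z)>0\}$, and let $m^i,m^p$ (resp. $n^i,n^p$) be the restrictions of $m$ (resp. $n$) to times in $D^m\setminus J^m$, $J^m$ (resp. $D^n\setminus J^n$, $J^n$). Let $\mathbb Y$ be the completed, right-continuous natural filtration of $Y$. Standing assumptions. (i) $Y$ is the unique solution of $$dY_t=b(t,X_{t\wedge\cdot},Y_t)dt+\sigma(t,Y_t)dW_t+\sum_{a\in\{i,p\}}\Big(\int_E K^a(t,X_{t^-\wedge\cdot},Y_{t^-},e)\,m^a(dt\,de)+\int_Z G^a(t,X_{t^-\wedge\cdot},Y_{t^-},z)\,n^a(dt\,dz)\Big),\quad Y_0=y_0\in\mathbb R.$$ (ii) $m$ and $n$ have no common jump times. (iii) $$\mu((0,t]\times A)=\int_0^t\!\int_A Q^m(s,X_{s^-\wedge\cdot};de)\lambda^m(s,X_{s^-\wedge\cdot})ds+\int_0^t\!\int_A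 R^m(s,X_{s^-\wedge\cdot};de)dp^m_s,$$ $$\nu((0,t]\times B)=\int_0^t\!\int_B Q^n(s,X_{s^-\wedge\cdot},Y_{s^-};dz)\lambda^n(s,X_{s^-\wedge\cdot},Y_{s^-})ds+\int_0^t\!\int_B R^n(s,X_{s^-\wedge\cdot},Y_{s^-};dz)dp^n_s,$$ with probability transition kernels $Q^m,R^m$ from $(0,+\infty)\times\mathcal D_E$ to $E$ and $Q^n,R^n$ from $(0,+\infty)\times\mathcal D_E\times\mathbb R$ to $Z$, bounded nonnegative measurable functions $\lambda^m$ on $(0,+\infty)\times\mathcal D_E$ and $\lambda^n$ on $(0,+\infty)\times\mathcal D_E\times\mathbb R$, and $\mathbb Y$-predictable counting processes $p^m,p^n$ with $\mathbb E[p^m_t]<\infty$, $\mathbb E[p^n_t]<\infty$ for all $t\ge0$. History process. Fix $\delta\notin E$. $H$ is the set of sequences $h=(e_0,t_1,e_1,t_2,e_2,\dots)$ with $e_0\in E$, $e_n\in E\cup\{\delta\}$, $t_n\in(0,+\infty]$ ($n\ge1$), such that $t_n\le t_{n+1}$; $t_n<+\infty\Rightarrow t_n<t_{n+1}$; $t_n=+\infty\Leftrightarrow e_n=\delta$; $\lim_n t_n=+\infty$. $N(h)=\sup\{n\ge1:t_n<+\infty\}$ and $N(h,t)=\sup\{n\ge1:t_n<t\}$ ($0$ if the set is empty). $H$ has the Borel $\sigma$-algebra of the metric $d(h,h')=\sum_{n=0}^{N}2^{-(n+2)}[\rho(|t_n-t_n'|)+\rho(d_E(e_n,e_n'))]$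 if $N(h)=N(h')=N$ ($N$ possibly infinite, $t_0=t_0'=0$, $\rho(x)=x/(1+x)$), $d(h,h')=1$ otherwise. The map $S\colon H\to\widetilde{\mathcal D}_E$ sends $h$ to the path equal to $e_k$ on $[t_k,t_{k+1})$ ($t_0=0$), for all $k\le N(h)$. $J_H(h',t,e)\in H$, for $(h',t,e)\in H\times(0,+\infty)\times E$, is the sequence obtained from $h'=(e_0',t_1',e_1',\dots)$ by replacing the pair $(t'_k,e'_k)$ with $(t,e)$ for $k=N(h',t)+1$ and leaving all other entries unchanged. With $\xi_0=(X_0,+\infty,\delta,+\infty,\delta,\dots)$ and $\xi_n=(X_0,T_1,X_{T_1},\dots,T_n,X_{T_n},+\infty,\delta,\dots)$, the history process is $\mathbf X_t=\xi_0$ on $[0,T_1)$, $\mathbf X_t=\xi_n$ on $[T_n,T_{n+1})$. *)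

theory Defs
  imports "HOL-Probability.Probability"
begin

section \<open>Filtrations, processes, stopping times\<close>

text \<open>Filtrations and processes are indexed by real times, of which only those in \<open>[0, \<infinity>)\<close> matter.
  Random times take values in \<open>[0, \<infinity>]\<close>, hence \<open>ereal\<close>; the library's \<open>stopping_time\<close> and
  \<open>pre_sigma\<close> require the random time to have the index type of the filtration.\<close>

definition usual_filtration :: "'w measure \<Rightarrow> (real \<Rightarrow> 'w measure) \<Rightarrow> bool" where
  "usual_filtration M F \<longleftrightarrow>
     (\<forall>t\<ge>0. subalgebra M (F t)) \<and>
     (\<forall>s t. 0 \<le> s \<and> s \<le> t \<longrightarrow> sets (F s) \<subseteq> sets (F t)) \<and>
     (\<forall>t\<ge>0. sets (F t) = (\<Inter>u\<in>{t<..}. sets (F u))) \<and>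
     (\<forall>N\<in>null_sets M. \<forall>A\<subseteq>N. A \<in> sets (F 0))"

definition completed_natural_filtration ::
    "'w measure \<Rightarrow> (real \<Rightarrow> 'w \<Rightarrow> real) \<Rightarrow> real \<Rightarrow> 'w measure" where
  "completed_natural_filtration M Y t =
     sigma (space M) (\<Inter>u\<in>{t<..}. sigma_sets (space M)
       ({Y s -` B \<inter> space M | s B. 0 \<le> s \<and> s \<le> u \<and> B \<in> sets borel} \<union>
        {A. \<exists>N\<in>null_sets M. A \<subseteq> N}))"

definition adapted :: "(real \<Rightarrow> 'w measure) \<Rightarrow> (real \<Rightarrow> 'w \<Rightarrow> real) \<Rightarrow> bool" where
  "adapted F V \<longleftrightarrow> (\<forall>t\<ge>0. V t \<in> borel_measurable (F t))"

definition ext_stopping_time ::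
    "'w measure \<Rightarrow> (real \<Rightarrow> 'w measure) \<Rightarrow> ('w \<Rightarrow> ereal) \<Rightarrow> bool" where
  "ext_stopping_time M F \<tau> \<longleftrightarrow> (\<forall>t\<ge>0. {\<omega> \<in> space M. \<tau> \<omega> \<le> ereal t} \<in> sets (F t))"

definition stopped_algebra ::
    "'w measure \<Rightarrow> (real \<Rightarrow> 'w measure) \<Rightarrow> ('w \<Rightarrow> ereal) \<Rightarrow> 'w measure" where
  "stopped_algebra M F \<tau> =
     sigma (space M) {A \<in> sets M. \<forall>t\<ge>0. A \<inter> {\<omega> \<in> space M. \<tau> \<omega> \<le> ereal t} \<in> sets (F t)}"

definition cadlag :: "(real \<Rightarrow> 'a::topological_space) \<Rightarrow> bool" where
  "cadlag x \<longleftrightarrow> (\<forall>t\<ge>0. (x \<longlongrightarrow> x t) (at_right t)) \<and> (\<forall>t>0. \<exists>l. (x \<longlongrightarrow> l) (at_left t))"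

definition left_lim :: "(real \<Rightarrow> 'w \<Rightarrow> 'a::t2_space) \<Rightarrow> real \<Rightarrow> 'w \<Rightarrow> 'a" where
  "left_lim V t \<omega> = Lim (at_left t) (\<lambda>s. V s \<omega>)"

definition stopped_path :: "(real \<Rightarrow> 'w \<Rightarrow> 'a) \<Rightarrow> real \<Rightarrow> 'w \<Rightarrow> real \<Rightarrow> 'a" where
  "stopped_path V t \<omega> = (\<lambda>s\<in>{0..}. V (min t s) \<omega>)"

definition left_stopped_path :: "(real \<Rightarrow> 'w \<Rightarrow> 'a::t2_space) \<Rightarrow> real \<Rightarrow> 'w \<Rightarrow> real \<Rightarrow> 'a" where
  "left_stopped_path V t \<omega> = (\<lambda>s\<in>{0..}. if s < t then V s \<omega> else left_lim V t \<omega>)"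


section \<open>Path space and Lusin spaces\<close>

text \<open>A path on \<open>[0, \<infinity>)\<close> is a function extensional outside \<open>{0..}\<close>. The Skorokhod topology is
  metrizable, hence determined by its convergent sequences; the time changes are the increasing
  bijections of \<open>[0, \<infinity>)\<close>.\<close>

definition skorokhod_paths :: "(real \<Rightarrow> 'e::metric_space) set" where
  "skorokhod_paths = {x \<in> extensional {0..}. cadlag x}"

definition skorokhod_converges ::
    "(nat \<Rightarrow> real \<Rightarrow> 'e::metric_space) \<Rightarrow> (real \<Rightarrow> 'e) \<Rightarrow> bool" where
  "skorokhod_converges \<alpha> x \<longleftrightarrow>
     (\<exists>\<Lambda> :: nat \<Rightarrow> real \<Rightarrow> real.
        (\<forall>n. strict_mono_on {0..} (\<Lambda> n) \<and> bij_betw (\<Lambda> n) {0..} {0..}) \<and>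
        uniform_limit {0..} \<Lambda> (\<lambda>s. s) sequentially \<and>
        (\<forall>K. uniform_limit {0..K} (\<lambda>n s. \<alpha> n (\<Lambda> n s)) x sequentially))"

definition skorokhod_open :: "(real \<Rightarrow> 'e::metric_space) set \<Rightarrow> bool" where
  "skorokhod_open U \<longleftrightarrow> U \<subseteq> skorokhod_paths \<and>
     (\<forall>\<alpha> x. (\<forall>n. \<alpha> n \<in> skorokhod_paths) \<and> x \<in> U \<and> skorokhod_converges \<alpha> x
        \<longrightarrow> (\<forall>\<^sub>F n in sequentially. \<alpha> n \<in> U))"

definition skorokhod_borel :: "(real \<Rightarrow> 'e::metric_space) measure" where
  "skorokhod_borel = sigma skorokhod_paths (Collect skorokhod_open)"

text \<open>A Lusin measurable space is one isomorphic to a Borel subset of a compact metrizable space;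
  every compact metrizable space embeds in the Hilbert cube.\<close>

definition lusin_space :: "'z measure \<Rightarrow> bool" where
  "lusin_space Z \<longleftrightarrow>
     (\<exists>B :: (nat \<Rightarrow> real) set. \<exists>f g. B \<in> sets borel \<and> B \<subseteq> {x. \<forall>i. 0 \<le> x i \<and> x i \<le> 1} \<and>
        f \<in> Z \<rightarrow>\<^sub>M restrict_space borel B \<and> g \<in> restrict_space borel B \<rightarrow>\<^sub>M Z \<and>
        (\<forall>z\<in>space Z. g (f z) = z) \<and> (\<forall>y\<in>B. f (g y) = y))"


section \<open>Random measures and dual predictable projections\<close>

abbreviation pos_time :: "real measure" where
  "pos_time \<equiv> restrict_space borel {0<..}"

abbreviation nonneg_time :: "real measure" where
  "nonneg_time \<equiv> restrict_space borel {0..}"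

definition predictable :: "'w measure \<Rightarrow> (real \<Rightarrow> 'w measure) \<Rightarrow> ('w \<times> real) measure" where
  "predictable M F =
     sigma (space M \<times> {0<..}) {A \<times> {s<..t} | A s t. 0 \<le> s \<and> s < t \<and> A \<in> sets (F s)}"

definition random_measure :: "'w measure \<Rightarrow> 's measure \<Rightarrow> ('w \<Rightarrow> (real \<times> 's) measure) \<Rightarrow> bool" where
  "random_measure M S \<mu> \<longleftrightarrow> (\<forall>\<omega>\<in>space M. sets (\<mu> \<omega>) = sets (pos_time \<Otimes>\<^sub>M S))"

definition predictable_random_measure ::
    "'w measure \<Rightarrow> (real \<Rightarrow> 'w measure) \<Rightarrow> 's measure \<Rightarrow> ('w \<Rightarrow> (real \<times> 's) measure) \<Rightarrow> bool" where
  "predictable_random_measure M F S \<mu> \<longleftrightarrow> random_measure M S \<mu> \<and>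
     (\<forall>C :: ('w \<times> real) \<times> 's \<Rightarrow> ennreal. C \<in> borel_measurable (predictable M F \<Otimes>\<^sub>M S) \<longrightarrow>
        (\<lambda>(\<omega>, t). \<integral>\<^sup>+(s, x)\<in>{0<..t} \<times> space S. C ((\<omega>, s), x) \<partial>\<mu> \<omega>)
          \<in> borel_measurable (predictable M F))"

definition dual_predictable_projection ::
    "'w measure \<Rightarrow> (real \<Rightarrow> 'w measure) \<Rightarrow> 's measure
      \<Rightarrow> ('w \<Rightarrow> (real \<times> 's) measure) \<Rightarrow> ('w \<Rightarrow> (real \<times> 's) measure) \<Rightarrow> bool" where
  "dual_predictable_projection M F S \<mu> m \<longleftrightarrow> predictable_random_measure M F S \<mu> \<and>
     (\<forall>C :: ('w \<times> real) \<times> 's \<Rightarrow> ennreal. C \<in> borel_measurable (predictable M F \<Otimes>\<^sub>M S) \<longrightarrow>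
        (\<integral>\<^sup>+\<omega>. (\<integral>\<^sup>+(s, x). C ((\<omega>, s), x) \<partial>\<mu> \<omega>) \<partial>M) = (\<integral>\<^sup>+\<omega>. (\<integral>\<^sup>+(s, x). C ((\<omega>, s), x) \<partial>m \<omega>) \<partial>M))"

definition adapted_random_counting_measure ::
    "'w measure \<Rightarrow> (real \<Rightarrow> 'w measure) \<Rightarrow> 's measure \<Rightarrow> ('w \<Rightarrow> (real \<times> 's) measure) \<Rightarrow> bool" where
  "adapted_random_counting_measure M F S n \<longleftrightarrow> random_measure M S n \<and>
     (\<forall>\<omega>\<in>space M. \<forall>A\<in>sets (pos_time \<Otimes>\<^sub>M S). emeasure (n \<omega>) A \<in> insert \<infinity> (range of_nat)) \<and>
     (\<forall>\<omega>\<in>space M. \<forall>t>0. emeasure (n \<omega>) ({t} \<times> space S) \<le> 1) \<and>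
     (\<forall>t>0. \<forall>B\<in>sets S. (\<lambda>\<omega>. emeasure (n \<omega>) ({0<..t} \<times> B)) \<in> borel_measurable (F t))"

text \<open>The sum of the Dirac masses at \<open>(\<tau> k \<omega>, x k \<omega>)\<close>, over \<open>k \<ge> 1\<close> with \<open>\<tau> k \<omega> < \<infinity>\<close>.\<close>

definition marked_counting_measure ::
    "'s measure \<Rightarrow> (nat \<Rightarrow> 'w \<Rightarrow> ereal) \<Rightarrow> (nat \<Rightarrow> 'w \<Rightarrow> 's) \<Rightarrow> 'w \<Rightarrow> (real \<times> 's) measure" where
  "marked_counting_measure S \<tau> x \<omega> =
     distr (count_space {k. 1 \<le> k \<and> \<tau> k \<omega> < \<infinity>}) (pos_time \<Otimes>\<^sub>M S)
       (\<lambda>k. (real_of_ereal (\<tau> k \<omega>), x k \<omega>))"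

lemma emeasure_marked_counting_measure:
  assumes pos: "\<And>k. 1 \<le> k \<Longrightarrow> 0 < \<tau> k \<omega>"
    and mark: "\<And>k. 1 \<le> k \<Longrightarrow> \<tau> k \<omega> < \<infinity> \<Longrightarrow> x k \<omega> \<in> space S"
    and A: "A \<in> sets S" and "0 < t"
  shows "emeasure (marked_counting_measure S \<tau> x \<omega>) ({0<..t} \<times> A) =
    (\<Sum>k. indicator {k. 1 \<le> k \<and> \<tau> k \<omega> \<le> ereal t} k * indicator A (x k \<omega>))"
proof -
  let ?I = "{k. 1 \<le> k \<and> \<tau> k \<omega> < \<infinity>}"
  let ?f = "\<lambda>k. (real_of_ereal (\<tau> k \<omega>), x k \<omega>)"
  have fin: "\<exists>r>0. \<tau> k \<omega> = ereal r" if "k \<in> ?I" for k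
    using that pos[of k] by (cases "\<tau> k \<omega>") auto
  have "{0<..t} \<in> sets pos_time"
    by (auto simp: sets_restrict_space_iff)
  then have R: "{0<..t} \<times> A \<in> sets (pos_time \<Otimes>\<^sub>M S)"
    using A by auto
  have f: "?f \<in> count_space ?I \<rightarrow>\<^sub>M pos_time \<Otimes>\<^sub>M S"
    using fin mark by (auto simp: space_pair_measure space_restrict_space) fastforce
  have pre: "?f -` ({0<..t} \<times> A) \<inter> ?I = {k. 1 \<le> k \<and> \<tau> k \<omega> \<le> ereal t \<and> x k \<omega> \<in> A}" (is "_ = ?K")
  proof (intro set_eqI iffI)
    fix k assume "k \<in> ?f -` ({0<..t} \<times> A) \<inter> ?I"
    then show "k \<in> ?K" using fin[of k] by auto
  next
    fix k assume k: "k \<in> ?K"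
    then have "k \<in> ?I" using order.strict_trans1[of "\<tau> k \<omega>" "ereal t" \<infinity>] by auto
    then show "k \<in> ?f -` ({0<..t} \<times> A) \<inter> ?I" using fin[of k] k by auto
  qed
  have "emeasure (marked_counting_measure S \<tau> x \<omega>) ({0<..t} \<times> A) = emeasure (count_space ?I) ?K"
    unfolding marked_counting_measure_def using emeasure_distr[OF f R] pre by simp
  also have "\<dots> = emeasure (count_space UNIV) ?K"
  proof -
    have "?K \<subseteq> ?I" using pre by blast
    then show ?thesis by (cases "finite ?K") (simp_all add: emeasure_count_space)
  qed
  also have "\<dots> = (\<integral>\<^sup>+k. indicator ?K k \<partial>count_space UNIV)"
    by simp
  also have "\<dots> = (\<Sum>k. indicator ?K k)"
    by (rule nn_integral_count_space_nat)
  also have "\<dots> = (\<Sum>k. indicator {k. 1 \<le> k \<and> \<tau> k \<omega> \<le> ereal t} k * indicator A (x k \<omega>))"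
    by (intro arg_cong[where f=suminf] ext) (auto simp: indicator_def)
  finally show ?thesis .
qed

definition jump_times :: "'s measure \<Rightarrow> ('w \<Rightarrow> (real \<times> 's) measure) \<Rightarrow> ('w \<times> real) set" where
  "jump_times S m = {(\<omega>, t). 0 < t \<and> emeasure (m \<omega>) ({t} \<times> space S) = 1}"

definition atom_times :: "'s measure \<Rightarrow> ('w \<Rightarrow> (real \<times> 's) measure) \<Rightarrow> ('w \<times> real) set" where
  "atom_times S \<mu> = {(\<omega>, t). 0 < t \<and> 0 < emeasure (\<mu> \<omega>) ({t} \<times> space S)}"

definition restrict_times ::
    "('w \<times> real) set \<Rightarrow> ('w \<Rightarrow> (real \<times> 's) measure) \<Rightarrow> 'w \<Rightarrow> (real \<times> 's) measure" where
  "restrict_times A m \<omega> = density (m \<omega>) (\<lambda>(t, x). indicator A (\<omega>, t))"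

definition counting_process :: "'w measure \<Rightarrow> (real \<Rightarrow> 'w \<Rightarrow> real) \<Rightarrow> bool" where
  "counting_process M p \<longleftrightarrow> (\<forall>\<omega>\<in>space M.
     p 0 \<omega> = 0 \<and> (\<forall>t\<ge>0. p t \<omega> \<in> \<nat>) \<and> mono_on {0..} (\<lambda>t. p t \<omega>) \<and> cadlag (\<lambda>t. p t \<omega>) \<and>
     (\<forall>t>0. p t \<omega> - left_lim p t \<omega> \<in> {0, 1}))"

definition predictable_counting_process ::
    "'w measure \<Rightarrow> (real \<Rightarrow> 'w measure) \<Rightarrow> (real \<Rightarrow> 'w \<Rightarrow> real) \<Rightarrow> bool" where
  "predictable_counting_process M F p \<longleftrightarrow>
     counting_process M p \<and> (\<lambda>(\<omega>, t). p t \<omega>) \<in> borel_measurable (predictable M F)"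

text \<open>The Stieltjes measure \<open>dp\<close>; a counting process vanishes at time \<open>0\<close>, so its extension by \<open>0\<close>
  to negative times does not add an atom.\<close>

definition stieltjes :: "(real \<Rightarrow> 'w \<Rightarrow> real) \<Rightarrow> 'w \<Rightarrow> real measure" where
  "stieltjes p \<omega> = interval_measure (\<lambda>s. p (max 0 s) \<omega>)"


section \<open>Brownian motion and stochastic integral\<close>

definition brownian_motion ::
    "'w measure \<Rightarrow> (real \<Rightarrow> 'w measure) \<Rightarrow> (real \<Rightarrow> 'w \<Rightarrow> real) \<Rightarrow> bool" where
  "brownian_motion M F W \<longleftrightarrow> adapted F W \<and>
     (AE \<omega> in M. W 0 \<omega> = 0 \<and> continuous_on {0..} (\<lambda>t. W t \<omega>)) \<and>
     (\<forall>s t. 0 \<le> s \<and> s < t \<longrightarrow>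
        distributed M lborel (\<lambda>\<omega>. W t \<omega> - W s \<omega>) (normal_density 0 (sqrt (t - s))) \<and>
        prob_space.indep_set M (sets (F s))
          (sets (vimage_algebra (space M) (\<lambda>\<omega>. W t \<omega> - W s \<omega>) borel)))"

definition simple_integrand ::
    "'w measure \<Rightarrow> (real \<Rightarrow> 'w measure) \<Rightarrow> nat \<Rightarrow> (nat \<Rightarrow> real) \<Rightarrow> (nat \<Rightarrow> 'w \<Rightarrow> real) \<Rightarrow> bool" where
  "simple_integrand M F N \<tau> \<xi> \<longleftrightarrow> 0 \<le> \<tau> 0 \<and>
     (\<forall>i<N. \<tau> i < \<tau> (Suc i) \<and> \<xi> i \<in> borel_measurable (F (\<tau> i)) \<and>
        (\<exists>c. \<forall>\<omega>\<in>space M. \<bar>\<xi> i \<omega>\<bar> \<le> c))"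

definition simple_process ::
    "nat \<Rightarrow> (nat \<Rightarrow> real) \<Rightarrow> (nat \<Rightarrow> 'w \<Rightarrow> real) \<Rightarrow> real \<Rightarrow> 'w \<Rightarrow> real" where
  "simple_process N \<tau> \<xi> s \<omega> = (\<Sum>i<N. \<xi> i \<omega> * indicator {\<tau> i<..\<tau> (Suc i)} s)"

definition simple_integral ::
    "(real \<Rightarrow> 'w \<Rightarrow> real) \<Rightarrow> nat \<Rightarrow> (nat \<Rightarrow> real) \<Rightarrow> (nat \<Rightarrow> 'w \<Rightarrow> real) \<Rightarrow> real \<Rightarrow> 'w \<Rightarrow> real" where
  "simple_integral W N \<tau> \<xi> t \<omega> =
     (\<Sum>i<N. \<xi> i \<omega> * (W (min t (\<tau> (Suc i))) \<omega> - W (min t (\<tau> i)) \<omega>))"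

text \<open>\<open>ito_integral M F W V I\<close>: the process \<open>I\<close> is (a version of) the Ito integral of the
  progressively measurable process \<open>V\<close> against \<open>W\<close>, that is, the limit, uniformly on compacts in
  probability, of the integrals of simple processes that approximate \<open>V\<close> in \<open>L\<^sup>2([0, t])\<close>
  in probability, for all \<open>t\<close>.\<close>

definition ito_integral ::
    "'w measure \<Rightarrow> (real \<Rightarrow> 'w measure) \<Rightarrow> (real \<Rightarrow> 'w \<Rightarrow> real)
      \<Rightarrow> (real \<Rightarrow> 'w \<Rightarrow> real) \<Rightarrow> (real \<Rightarrow> 'w \<Rightarrow> real) \<Rightarrow> bool" where
  "ito_integral M F W V I \<longleftrightarrow>
     (\<forall>t\<ge>0. (\<lambda>(s, \<omega>). V s \<omega>) \<in> borel_measurable (restrict_space borel {0..t} \<Otimes>\<^sub>M F t)) \<and>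
     (AE \<omega> in M. \<forall>t\<ge>0. (\<integral>\<^sup>+s\<in>{0..t}. ennreal ((V s \<omega>)\<^sup>2) \<partial>lborel) < \<infinity>) \<and>
     adapted F I \<and> (AE \<omega> in M. continuous_on {0..} (\<lambda>t. I t \<omega>)) \<and>
     (\<exists>N \<tau> \<xi>. (\<forall>n. simple_integrand M F (N n) (\<tau> n) (\<xi> n)) \<and>
        (\<forall>t\<ge>0. \<forall>\<epsilon>>0.
          (\<lambda>n. measure M {\<omega> \<in> space M.
             ennreal \<epsilon> < (\<integral>\<^sup>+s\<in>{0..t}. ennreal ((simple_process (N n) (\<tau> n) (\<xi> n) s \<omega> - V s \<omega>)\<^sup>2) \<partial>lborel)})
            \<longlonglongrightarrow> 0 \<and>
          (\<lambda>n. measure M {\<omega> \<in> space M.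
             \<exists>s\<in>{0..t}. \<epsilon> < \<bar>simple_integral W (N n) (\<tau> n) (\<xi> n) s \<omega> - I s \<omega>\<bar>})
            \<longlonglongrightarrow> 0))"


section \<open>Signal and observation\<close>

text \<open>\<open>T 0 = 0\<close>. For \<open>t\<close> beyond \<open>lim T\<^sub>k\<close>, the intervals \<open>[T\<^sub>k, T\<^sub>k\<^sub>+\<^sub>1)\<close> leave the signal
  undefined and it is given the value \<open>\<zeta>\<^sub>0\<close>. No assumption \<open>lim T\<^sub>k = \<infinity>\<close> is made: under
  the form of the compensator assumed below, it holds almost surely.\<close>

definition signal :: "(nat \<Rightarrow> 'w \<Rightarrow> ereal) \<Rightarrow> (nat \<Rightarrow> 'w \<Rightarrow> 'e) \<Rightarrow> real \<Rightarrow> 'w \<Rightarrow> 'e" where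
  "signal T \<zeta> t \<omega> =
     (if \<exists>k. T k \<omega> \<le> ereal t \<and> ereal t < T (Suc k) \<omega>
      then \<zeta> (THE k. T k \<omega> \<le> ereal t \<and> ereal t < T (Suc k) \<omega>) \<omega> else \<zeta> 0 \<omega>)"

definition signal_jump_measure ::
    "(nat \<Rightarrow> 'w \<Rightarrow> ereal) \<Rightarrow> (real \<Rightarrow> 'w \<Rightarrow> 'e::polish_space) \<Rightarrow> 'w \<Rightarrow> (real \<times> 'e) measure" where
  "signal_jump_measure T X =
     marked_counting_measure borel T (\<lambda>k \<omega>. X (real_of_ereal (T k \<omega>)) \<omega>)"

definition bounded_rate :: "'a measure \<Rightarrow> ('a \<Rightarrow> real) \<Rightarrow> bool" where
  "bounded_rate A r \<longleftrightarrow> r \<in> borel_measurable A \<and> (\<exists>c. \<forall>a\<in>space A. 0 \<le> r a \<and> r a \<le> c)"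

text \<open>Local characteristics are functions of tuples \<open>(t, x)\<close>, \<open>(t, x, y)\<close> or \<open>(t, x, y, e)\<close>, with
  \<open>x\<close> a path.\<close>

definition observation_solution ::
    "'w measure \<Rightarrow> (real \<Rightarrow> 'w measure) \<Rightarrow> 'z measure \<Rightarrow> real
      \<Rightarrow> (real \<times> (real \<Rightarrow> 'e::polish_space) \<times> real \<Rightarrow> real) \<Rightarrow> (real \<times> real \<Rightarrow> real)
      \<Rightarrow> (real \<times> (real \<Rightarrow> 'e) \<times> real \<times> 'e \<Rightarrow> real) \<Rightarrow> (real \<times> (real \<Rightarrow> 'e) \<times> real \<times> 'e \<Rightarrow> real)
      \<Rightarrow> (real \<times> (real \<Rightarrow> 'e) \<times> real \<times> 'z \<Rightarrow> real) \<Rightarrow> (real \<times> (real \<Rightarrow> 'e) \<times> real \<times> 'z \<Rightarrow> real)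
      \<Rightarrow> (real \<Rightarrow> 'w \<Rightarrow> 'e) \<Rightarrow> (real \<Rightarrow> 'w \<Rightarrow> real)
      \<Rightarrow> ('w \<Rightarrow> (real \<times> 'e) measure) \<Rightarrow> ('w \<Rightarrow> (real \<times> 'e) measure)
      \<Rightarrow> ('w \<Rightarrow> (real \<times> 'z) measure) \<Rightarrow> ('w \<Rightarrow> (real \<times> 'z) measure)
      \<Rightarrow> (real \<Rightarrow> 'w \<Rightarrow> real) \<Rightarrow> bool" where
  "observation_solution M F Z y0 b \<sigma> Ki Kp Gi Gp X W mi mp ni np Y \<longleftrightarrow>
     adapted F Y \<and> (\<forall>\<omega>\<in>space M. cadlag (\<lambda>t. Y t \<omega>)) \<and>
     (\<exists>I. ito_integral M F W (\<lambda>t \<omega>. \<sigma> (t, Y t \<omega>)) I \<and>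
       (AE \<omega> in M. \<forall>t\<ge>0.
          let drift = (\<lambda>s. b (s, stopped_path X s \<omega>, Y s \<omega>));
              jump_m = (\<lambda>K (s, e). K (s, left_stopped_path X s \<omega>, left_lim Y s \<omega>, e));
              jump_n = (\<lambda>G (s, z). G (s, left_stopped_path X s \<omega>, left_lim Y s \<omega>, z))
          in
          set_integrable lborel {0..t} drift \<and>
          set_integrable (mi \<omega>) ({0<..t} \<times> UNIV) (jump_m Ki) \<and>
          set_integrable (mp \<omega>) ({0<..t} \<times> UNIV) (jump_m Kp) \<and>
          set_integrable (ni \<omega>) ({0<..t} \<times> space Z) (jump_n Gi) \<and>
          set_integrable (np \<omega>) ({0<..t} \<times> space Z) (jump_n Gp) \<and>
          Y t \<omega> = y0 + set_lebesgue_integral lborel {0..t} drift + I t \<omega>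
            + set_lebesgue_integral (mi \<omega>) ({0<..t} \<times> UNIV) (jump_m Ki)
            + set_lebesgue_integral (ni \<omega>) ({0<..t} \<times> space Z) (jump_n Gi)
            + set_lebesgue_integral (mp \<omega>) ({0<..t} \<times> UNIV) (jump_m Kp)
            + set_lebesgue_integral (np \<omega>) ({0<..t} \<times> space Z) (jump_n Gp)))"


section \<open>History process\<close>

text \<open>A history \<open>(e\<^sub>0, t\<^sub>1, e\<^sub>1, \<dots>)\<close> is the function \<open>n \<mapsto> (t\<^sub>n, e\<^sub>n)\<close> with the convention
  \<open>t\<^sub>0 = 0\<close>; the cemetery point \<open>\<delta>\<close> is \<open>None\<close>.\<close>

type_synonym 'e history = "nat \<Rightarrow> ereal \<times> 'e option"

definition history_set :: "'e history set" where
  "history_set = {h. fst (h 0) = 0 \<and> snd (h 0) \<noteq> None \<and>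
     (\<forall>n\<ge>1. 0 < fst (h n) \<and> fst (h n) \<le> fst (h (Suc n)) \<and>
        (fst (h n) < \<infinity> \<longrightarrow> fst (h n) < fst (h (Suc n))) \<and>
        (fst (h n) = \<infinity> \<longleftrightarrow> snd (h n) = None)) \<and>
     (\<lambda>n. fst (h n)) \<longlonglongrightarrow> \<infinity>}"

text \<open>\<open>N(h, t)\<close>; and \<open>N(h)\<close> is \<open>N(h, \<infinity>)\<close>. The supremum of the empty set in \<open>enat\<close> is \<open>0\<close>.\<close>

definition jumps_before :: "'e history \<Rightarrow> ereal \<Rightarrow> enat" where
  "jumps_before h t = Sup (enat ` {n. 1 \<le> n \<and> fst (h n) < t})"

definition history_dist :: "'e::metric_space history \<Rightarrow> 'e history \<Rightarrow> real" where
  "history_dist h h' =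
     (let \<rho> = (\<lambda>x :: real. x / (1 + x)) in
      if jumps_before h \<infinity> = jumps_before h' \<infinity>
      then (\<Sum>n. if enat n \<le> jumps_before h \<infinity>
                 then (1/2) ^ (n + 2) *
                   (\<rho> \<bar>real_of_ereal (fst (h n)) - real_of_ereal (fst (h' n))\<bar> +
                    \<rho> (dist (the (snd (h n))) (the (snd (h' n)))))
                 else 0)
      else 1)"

abbreviation history_topology :: "'e::metric_space history topology" where
  "history_topology \<equiv> Metric_space.mtopology history_set history_dist"

definition history_borel :: "'e::metric_space history measure" where
  "history_borel = sigma history_set {U. openin history_topology U}"

definition path_of_history :: "'e history \<Rightarrow> real \<Rightarrow> 'e" where
  "path_of_history h =
     (\<lambda>s\<in>{0..}. the (snd (h (THE k. fst (h k) \<le> ereal s \<and> ereal s < fst (h (Suc k))))))"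

definition update_history :: "'e history \<Rightarrow> real \<Rightarrow> 'e \<Rightarrow> 'e history" where
  "update_history h t e = h(Suc (the_enat (jumps_before h (ereal t))) := (ereal t, Some e))"

definition partial_history ::
    "(nat \<Rightarrow> 'w \<Rightarrow> ereal) \<Rightarrow> (real \<Rightarrow> 'w \<Rightarrow> 'e) \<Rightarrow> nat \<Rightarrow> 'w \<Rightarrow> 'e history" where
  "partial_history T X n \<omega> =
     (\<lambda>k. if k \<le> n then (T k \<omega>, Some (X (real_of_ereal (T k \<omega>)) \<omega>)) else (\<infinity>, None))"

text \<open>As for the signal, the value beyond \<open>lim T\<^sub>k\<close> is an irrelevant convention.\<close>

definition history_process ::
    "(nat \<Rightarrow> 'w \<Rightarrow> ereal) \<Rightarrow> (real \<Rightarrow> 'w \<Rightarrow> 'e) \<Rightarrow> real \<Rightarrow> 'w \<Rightarrow> 'e history" where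
  "history_process T X t \<omega> =
     (if \<exists>n. T n \<omega> \<le> ereal t \<and> ereal t < T (Suc n) \<omega>
      then partial_history T X (THE n. T n \<omega> \<le> ereal t \<and> ereal t < T (Suc n) \<omega>) \<omega>
      else partial_history T X 0 \<omega>)"

definition history_left_lim ::
    "(real \<Rightarrow> 'w \<Rightarrow> 'e::metric_space history) \<Rightarrow> real \<Rightarrow> 'w \<Rightarrow> 'e history" where
  "history_left_lim H t \<omega> = (THE h. limitin history_topology (\<lambda>s. H s \<omega>) h (at_left t))"

definition history_jump_measure ::
    "(nat \<Rightarrow> 'w \<Rightarrow> ereal) \<Rightarrow> (real \<Rightarrow> 'w \<Rightarrow> 'e::polish_space)
      \<Rightarrow> 'w \<Rightarrow> (real \<times> 'e history) measure" where
  "history_jump_measure T X = marked_counting_measure history_borel T (partial_history T X)"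

definition history_kernel ::
    "(real \<times> (real \<Rightarrow> 'e) \<Rightarrow> 'e measure) \<Rightarrow> real \<Rightarrow> 'e history \<Rightarrow> 'e history set \<Rightarrow> ennreal" where
  "history_kernel Q t h B = (\<integral>\<^sup>+e. indicator B (update_history h t e) \<partial>Q (t, path_of_history h))"

definition history_rate :: "(real \<times> (real \<Rightarrow> 'e) \<Rightarrow> real) \<Rightarrow> real \<Rightarrow> 'e history \<Rightarrow> real" where
  "history_rate r t h = r (t, path_of_history h)"

text \<open>On the null set of trajectories whose jump times accumulate, the left limit of the history
  process need not exist, so the right-hand side need not define a measure there.\<close>

definition history_compensator ::
    "'w measure \<Rightarrow> (real \<times> (real \<Rightarrow> 'e::polish_space) \<Rightarrow> 'e measure)
      \<Rightarrow> (real \<times> (real \<Rightarrow> 'e) \<Rightarrow> real) \<Rightarrow> (real \<times> (real \<Rightarrow> 'e) \<Rightarrow> 'e measure)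
      \<Rightarrow> (real \<Rightarrow> 'w \<Rightarrow> real) \<Rightarrow> (real \<Rightarrow> 'w \<Rightarrow> 'e history)
      \<Rightarrow> ('w \<Rightarrow> (real \<times> 'e history) measure) \<Rightarrow> bool" where
  "history_compensator M Q r R p H \<mu> \<longleftrightarrow> random_measure M history_borel \<mu> \<and>
     (AE \<omega> in M. \<forall>t>0. \<forall>B\<in>sets history_borel.
        emeasure (\<mu> \<omega>) ({0<..t} \<times> B) =
          (\<integral>\<^sup>+s\<in>{0<..t}. ennreal (history_rate r s (history_left_lim H s \<omega>)) *
             history_kernel Q s (history_left_lim H s \<omega>) B \<partial>lborel) +
          (\<integral>\<^sup>+s\<in>{0<..t}. history_kernel R s (history_left_lim H s \<omega>) B \<partial>stieltjes p \<omega>))"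

end

theory Submission
  imports Defs
begin

text \<open>The jump measure of the history process is an image of the jump measure of the signal. Just
  before a time \<open>s\<close> with \<open>T\<^sub>n < s \<le> T\<^sub>n\<^sub>+\<^sub>1\<close> the history is \<open>\<xi>\<^sub>n\<close>, and a jump of the signal to \<open>e\<close> at
  time \<open>s\<close> turns it into \<open>\<Psi>(\<omega>, s, e)\<close>, the history \<open>\<xi>\<^sub>n\<close> extended by \<open>(s, e)\<close> (\<open>next_history\<close> below). At \<open>s = T\<^sub>n\<^sub>+\<^sub>1\<close> and
  \<open>e = X\<^sub>s\<close> this is \<open>\<xi>\<^sub>n\<^sub>+\<^sub>1\<close>, so that integrating \<open>C(\<omega>, s, h)\<close> against the jump measure of the history
  is the same as integrating \<open>C(\<omega>, s, \<Psi>(\<omega>, s, e))\<close> against that of the signal. The function \<open>\<Psi>\<close> is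
  measurable for the product of the predictable \<open>\<sigma>\<close>-algebra and the Borel sets of the mark space
  (lemma \<open>measurable_next_history\<close>): it only involves \<open>s\<close>, \<open>e\<close> and the past of \<open>T\<^sub>n\<close> strictly after
  \<open>T\<^sub>n\<close>, where that past is predictable. Hence \<open>C \<circ> \<Psi>\<close> is an admissible integrand for the signal, and
  the image of the compensator of the signal under \<open>(s, e) \<mapsto> (s, \<Psi>(\<omega>, s, e))\<close> is the dual predictable
  projection of the jump measure of the history.

  That image is given by the asserted formula (lemma \<open>emeasure_history_measure\<close>), since the path
  coded by the history just before \<open>s\<close> is the signal stopped just before \<open>s\<close>. Here the formula for
  the compensator of the signal, known on rectangles, is needed on the sets \<open>{(s, e). \<Psi>(\<omega>, s, e) \<in> B}\<close>
  (lemma \<open>disintegration_of_rectangles\<close>). This is done for trajectories whose jump times tend to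
  infinity, where the signal stopped just before any time belongs to the path space on which the
  rate and the kernels are measurable. The jump times tend to infinity almost surely (lemma
  \<open>AE_no_explosion\<close>): the compensator has a finite expectation up to \<open>t \<and> T\<^sub>n\<close> that is bounded in
  \<open>n\<close>, hence so has the number of jumps.

  The formula determines a random measure only up to a null set. A random measure that satisfies it
  is still predictable, because the filtration is complete and the indefinite integrals of
  nonnegative functions increase with time (lemma \<open>predictable_monotone_on_null_set\<close>).\<close>


section \<open>The metric space of histories\<close>

abbreviation shrink :: "real \<Rightarrow> real" where
  "shrink x \<equiv> x / (1 + x)"

lemma shrink_nonneg: "0 \<le> x \<Longrightarrow> 0 \<le> shrink x"
  by simp

lemma shrink_le_1: "0 \<le> x \<Longrightarrow> shrink x \<le> 1"
  by simp

lemma shrink_mono: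
  assumes "0 \<le> x" "x \<le> y"
  shows "shrink x \<le> shrink y"
  using assms by (simp add: frac_le_eq divide_nonpos_pos field_simps)

lemma shrink_triangle:
  assumes "0 \<le> x" "0 \<le> y" "z \<le> x + y" "0 \<le> z"
  shows "shrink z \<le> shrink x + shrink y"
proof -
  have "shrink z \<le> shrink (x + y)"
    using assms by (intro shrink_mono) auto
  also have "\<dots> = x / (1 + x + y) + y / (1 + x + y)"
    by (simp add: add_divide_distrib add.assoc)
  also have "\<dots> \<le> shrink x + shrink y"
    using assms by (intro add_mono) (auto intro!: divide_left_mono)
  finally show ?thesis .
qed

definition mark_dist :: "ereal \<times> 'e::metric_space option \<Rightarrow> ereal \<times> 'e option \<Rightarrow> real" where
  "mark_dist a b = shrink \<bar>real_of_ereal (fst a) - real_of_ereal (fst b)\<bar> +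
     shrink (dist (the (snd a)) (the (snd b)))"

definition jump_number :: "'e history \<Rightarrow> enat" where
  "jump_number h = jumps_before h \<infinity>"

text \<open>The distance of two histories is a sum of these terms when their numbers of jumps agree. The
  weights and the bound \<open>2\<close> on \<open>mark_dist\<close> keep that sum at or below \<open>1\<close>, the distance of histories with different numbers of jumps; the triangle inequality depends on it.\<close>

definition history_dist_term :: "'e::metric_space history \<Rightarrow> 'e history \<Rightarrow> nat \<Rightarrow> real" where
  "history_dist_term h h' n =
     (if enat n \<le> jump_number h then (1/2) ^ (n + 2) * mark_dist (h n) (h' n) else 0)"

lemma history_dist_eq:
  "history_dist h h' =
     (if jump_number h = jump_number h' then (\<Sum>n. history_dist_term h h' n) else 1)"
  unfolding history_dist_def Let_def jump_number_def history_dist_term_def mark_dist_def ..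

lemma mark_dist_nonneg: "0 \<le> mark_dist a b"
  unfolding mark_dist_def by (intro add_nonneg_nonneg shrink_nonneg) auto

lemma mark_dist_le_2: "mark_dist a b \<le> 2"
proof -
  have "mark_dist a b \<le> 1 + 1"
    unfolding mark_dist_def by (intro add_mono shrink_le_1) auto
  then show ?thesis by simp
qed

lemma mark_dist_commute: "mark_dist a b = mark_dist b a"
  unfolding mark_dist_def by (simp add: dist_commute abs_minus_commute)

lemma mark_dist_triangle: "mark_dist a c \<le> mark_dist a b + mark_dist b c"
proof -
  have "shrink \<bar>real_of_ereal (fst a) - real_of_ereal (fst c)\<bar>
      \<le> shrink \<bar>real_of_ereal (fst a) - real_of_ereal (fst b)\<bar>
        + shrink \<bar>real_of_ereal (fst b) - real_of_ereal (fst c)\<bar>"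
    by (rule shrink_triangle) auto
  moreover have "shrink (dist (the (snd a)) (the (snd c)))
      \<le> shrink (dist (the (snd a)) (the (snd b))) + shrink (dist (the (snd b)) (the (snd c)))"
    by (rule shrink_triangle) (auto simp: dist_triangle)
  ultimately show ?thesis
    unfolding mark_dist_def by linarith
qed

lemma history_dist_term_nonneg: "0 \<le> history_dist_term h h' n"
  by (simp add: history_dist_term_def mark_dist_nonneg)

lemma history_dist_term_le: "history_dist_term h h' n \<le> (1/2) ^ (n + 1)"
proof -
  have "(1/2) ^ (n + 2) * mark_dist (h n) (h' n) \<le> (1/2) ^ (n + 2) * 2"
    by (intro mult_left_mono mark_dist_le_2) simp
  then show ?thesis
    by (simp add: history_dist_term_def)
qed

lemma half_powers_sums_1: "(\<lambda>n. (1/2 :: real) ^ (n + 1)) sums 1"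
  using power_half_series by simp

lemma summable_history_dist_term: "summable (history_dist_term h h')"
  by (rule summable_comparison_test'[OF sums_summable[OF half_powers_sums_1], where N=0])
     (use history_dist_term_le[of h h'] history_dist_term_nonneg[of h h'] in \<open>simp\<close>)

lemma suminf_history_dist_term_le_1: "(\<Sum>n. history_dist_term h h' n) \<le> 1"
  using suminf_le[OF history_dist_term_le summable_history_dist_term
      sums_summable[OF half_powers_sums_1]] sums_unique[OF half_powers_sums_1] by simp

lemma history_dist_nonneg: "0 \<le> history_dist h h'"
  by (simp add: history_dist_eq suminf_nonneg summable_history_dist_term history_dist_term_nonneg)

lemma history_dist_commute: "history_dist h h' = history_dist h' h"
  by (auto simp: history_dist_eq history_dist_term_def mark_dist_commute intro!: arg_cong[where f=suminf])

text \<open>Up to rank \<open>jump_number h\<close> all jump times are finite, beyond it they are all infinite: the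
  number of jumps together with the coordinates that the distance compares determine a history.\<close>

lemma history_set_mono:
  assumes h: "h \<in> history_set" and "i \<le> j"
  shows "fst (h i) \<le> fst (h j)"
  using \<open>i \<le> j\<close>
proof (rule lift_Suc_mono_le[rotated])
  fix n show "fst (h n) \<le> fst (h (Suc n))"
    using h by (cases n) (auto simp: history_set_def intro: less_imp_le)
qed

lemma jump_number_ge_iff:
  assumes h: "h \<in> history_set"
  shows "enat n \<le> jump_number h \<longleftrightarrow> fst (h n) < \<infinity>"
proof
  assume fin: "fst (h n) < \<infinity>"
  then show "enat n \<le> jump_number h"
    by (cases "n = 0")
       (auto simp: jump_number_def jumps_before_def zero_enat_def[symmetric] intro!: Sup_upper)
next
  assume le: "enat n \<le> jump_number h"
  show "fst (h n) < \<infinity>"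
  proof (cases "n = 0")
    case True
    then show ?thesis using h by (auto simp: history_set_def)
  next
    case False
    show ?thesis
    proof (rule ccontr)
      assume inf: "\<not> fst (h n) < \<infinity>"
      have "jump_number h \<le> enat (n - 1)"
        unfolding jump_number_def jumps_before_def
      proof (rule Sup_least, safe)
        fix k assume "1 \<le> k" "fst (h k) < \<infinity>"
        then have "\<not> n \<le> k"
          using inf history_set_mono[OF h, of n k] by auto
        then show "enat k \<le> enat (n - 1)" by simp
      qed
      with le False show False
        by (metis One_nat_def diff_less enat_ord_simps(1) leD le_trans not_gr_zero order.trans zero_less_one)
    qed
  qed
qed

lemma history_eqI:
  assumes h: "h \<in> history_set" "h' \<in> history_set"
    and n: "jump_number h = jump_number h'"
    and eq: "\<And>n. fst (h n) < \<infinity> \<Longrightarrow> mark_dist (h n) (h' n) = 0"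
  shows "h = h'"
proof
  fix n
  have fin: "fst (h n) < \<infinity> \<longleftrightarrow> fst (h' n) < \<infinity>"
    using jump_number_ge_iff[of h n] jump_number_ge_iff[of h' n] h n by simp
  have pos: "0 \<le> fst (h n)" "0 \<le> fst (h' n)"
    using history_set_mono[OF h(1), of 0 n] history_set_mono[OF h(2), of 0 n] h
    by (auto simp: history_set_def)
  have some: "fst (k n) < \<infinity> \<longleftrightarrow> snd (k n) \<noteq> None" if "k \<in> history_set" for k :: "'a history"
    using that by (cases n) (auto simp: history_set_def)
  show "h n = h' n"
  proof (cases "fst (h n) < \<infinity>")
    case True
    have "mark_dist (h n) (h' n) = 0"
      using eq True by simp
    then have z: "shrink \<bar>real_of_ereal (fst (h n)) - real_of_ereal (fst (h' n))\<bar> = 0"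
      "shrink (dist (the (snd (h n))) (the (snd (h' n)))) = 0"
      unfolding mark_dist_def by (auto simp: add_nonneg_eq_0_iff)
    have "real_of_ereal (fst (h n)) = real_of_ereal (fst (h' n))"
      using z(1) by (auto simp: divide_eq_0_iff)
    then have "fst (h n) = fst (h' n)"
      using True fin pos by (metis ereal_less_PInfty ereal_real' ereal_infty_less_eq(1) abs_ereal_ge0 less_irrefl)
    moreover have "the (snd (h n)) = the (snd (h' n))"
      using z(2) by (smt (verit) divide_eq_0_iff zero_le_dist dist_eq_0_iff)
    then have "snd (h n) = snd (h' n)"
      using some[OF h(1)] some[OF h(2)] True fin by (auto simp: option.expand)
    ultimately show ?thesis by (rule prod_eqI)
  next
    case False
    then show ?thesis
      using fin some[OF h(1)] some[OF h(2)] by (auto intro!: prod_eqI)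
  qed
qed

lemma Metric_space_history:
  "Metric_space (history_set :: 'e::metric_space history set) history_dist"
proof
  fix h h' h'' :: "'e history"
  show "0 \<le> history_dist h h'" by (rule history_dist_nonneg)
  show "history_dist h h' = history_dist h' h" by (rule history_dist_commute)
  assume h: "h \<in> history_set" and h': "h' \<in> history_set"
  show "history_dist h h' = 0 \<longleftrightarrow> h = h'"
  proof
    assume "history_dist h h' = 0"
    then have n: "jump_number h = jump_number h'" and "(\<Sum>n. history_dist_term h h' n) = 0"
      by (auto simp: history_dist_eq split: if_splits)
    then have z: "history_dist_term h h' k = 0" for k
      using suminf_eq_zero_iff[OF summable_history_dist_term history_dist_term_nonneg] by metis
    have "mark_dist (h k) (h' k) = 0" if "fst (h k) < \<infinity>" for k
      using z[of k] that jump_number_ge_iff[OF h, of k] by (simp add: history_dist_term_def)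
    then show "h = h'"
      using h h' n by (intro history_eqI)
  qed (simp add: history_dist_eq history_dist_term_def[abs_def] mark_dist_def cong: if_cong)
  assume h'': "h'' \<in> history_set"
  have le1: "history_dist g g' \<le> 1" for g g' :: "'e history"
    using suminf_history_dist_term_le_1[of g g'] by (simp add: history_dist_eq)
  show "history_dist h h'' \<le> history_dist h h' + history_dist h' h''"
  proof (cases "jump_number h = jump_number h' \<and> jump_number h' = jump_number h''")
    case True
    have "(\<Sum>n. history_dist_term h h'' n)
        \<le> (\<Sum>n. history_dist_term h h' n + history_dist_term h' h'' n)"
      using True
      by (intro suminf_le summable_add summable_history_dist_term)
         (auto simp: history_dist_term_def mark_dist_triangle distrib_left[symmetric] intro!: mult_left_mono)
    with True show ?thesis
      by (simp add: history_dist_eq suminf_add summable_history_dist_term)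
  next
    case False
    then have "history_dist h h' = 1 \<or> history_dist h' h'' = 1"
      by (auto simp: history_dist_eq)
    then show ?thesis
      using le1[of h h''] history_dist_nonneg[of h h'] history_dist_nonneg[of h' h''] by linarith
  qed
qed

lemma space_history_borel [simp]: "space history_borel = (history_set :: 'e::metric_space history set)"
proof -
  interpret Metric_space "history_set :: 'e history set" history_dist
    by (rule Metric_space_history)
  show ?thesis
    unfolding history_borel_def by (auto intro!: space_measure_of simp: openin_mtopology)
qed

text \<open>Left limits of histories are only ever taken of paths that are constant to the left of the
  given time. The metric enters through the uniqueness of limits.\<close>

lemma history_left_lim_eventually_const:
  fixes h :: "'e::metric_space history"
  assumes h: "h \<in> history_set" and ev: "\<forall>\<^sub>F s in at_left t. H s \<omega> = h"
  shows "history_left_lim H t \<omega> = h"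
proof -
  interpret Metric_space "history_set :: 'e history set" history_dist
    by (rule Metric_space_history)
  have lim: "limitin mtopology (\<lambda>s. H s \<omega>) h (at_left t)"
    unfolding limitin_metric using h ev by (auto elim!: eventually_mono)
  show ?thesis
    unfolding history_left_lim_def
    by (rule the_equality[where P="\<lambda>h. limitin mtopology (\<lambda>s. H s \<omega>) h (at_left t)", OF lim])
       (rule limitin_metric_unique[OF _ lim], auto)
qed


section \<open>Histories with finitely many jumps\<close>

definition finite_history :: "nat \<Rightarrow> (nat \<Rightarrow> real \<times> 'e) \<Rightarrow> 'e history" where
  "finite_history n x = (\<lambda>k. if k \<le> n then (ereal (fst (x k)), Some (snd (x k))) else (\<infinity>, None))"

definition increasing_times :: "nat \<Rightarrow> (nat \<Rightarrow> real \<times> 'e) set" where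
  "increasing_times n = {x. fst (x 0) = 0 \<and> (\<forall>k<n. fst (x k) < fst (x (Suc k)))}"

lemma increasing_times_mono:
  assumes x: "x \<in> increasing_times n" and "i < j" "j \<le> n"
  shows "fst (x i) < fst (x j)"
  using \<open>i < j\<close> \<open>j \<le> n\<close>
proof (induction j)
  case (Suc j)
  have "fst (x j) < fst (x (Suc j))"
    using x Suc.prems by (auto simp: increasing_times_def)
  with Suc show ?case by (cases "i = j") auto
qed simp

lemma finite_history_in_history_set:
  assumes x: "x \<in> increasing_times n"
  shows "finite_history n x \<in> history_set"
proof -
  have "(\<lambda>k. fst (finite_history n x k)) \<longlonglongrightarrow> \<infinity>"
    by (rule tendsto_eventually) (auto simp: finite_history_def eventually_sequentially intro!: exI[of _ "Suc n"])
  moreover have "0 < fst (x k)" if "1 \<le> k" "k \<le> n" for k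
    using increasing_times_mono[OF x, of 0 k] that x by (auto simp: increasing_times_def)
  ultimately show ?thesis
    using x increasing_times_mono[OF x]
    by (auto simp: history_set_def finite_history_def increasing_times_def intro: less_imp_le)
qed

lemma jump_number_finite_history:
  assumes x: "x \<in> increasing_times n"
  shows "jump_number (finite_history n x) = enat n"
proof -
  have *: "enat k \<le> jump_number (finite_history n x) \<longleftrightarrow> k \<le> n" for k
    using jump_number_ge_iff[OF finite_history_in_history_set[OF x], of k]
    by (simp add: finite_history_def)
  have "\<not> enat (Suc n) \<le> jump_number (finite_history n x)"
    using * by simp
  then have "jump_number (finite_history n x) \<le> enat n"
    by (metis Suc_ile_eq linorder_not_le)
  with *[of n] show ?thesis by (intro antisym) auto
qed

lemma history_dist_finite_history:
  assumes "x \<in> increasing_times n" "y \<in> increasing_times n"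
  shows "history_dist (finite_history n x) (finite_history n y) =
    (\<Sum>k\<le>n. (1/2) ^ (k + 2) * (shrink \<bar>fst (x k) - fst (y k)\<bar> + shrink (dist (snd (x k)) (snd (y k)))))"
proof -
  have "(\<Sum>k. history_dist_term (finite_history n x) (finite_history n y) k) =
      (\<Sum>k\<le>n. history_dist_term (finite_history n x) (finite_history n y) k)"
    using assms by (intro suminf_finite) (auto simp: history_dist_term_def jump_number_finite_history)
  also have "\<dots> = (\<Sum>k\<le>n. (1/2) ^ (k + 2) *
      (shrink \<bar>fst (x k) - fst (y k)\<bar> + shrink (dist (snd (x k)) (snd (y k)))))"
    by (rule sum.cong)
       (simp_all add: history_dist_term_def jump_number_finite_history[OF assms(1)],
        simp add: mark_dist_def finite_history_def)
  finally show ?thesis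
    by (simp only: history_dist_eq jump_number_finite_history[OF assms(1)]
        jump_number_finite_history[OF assms(2)] if_True simp_thms)
qed

text \<open>On sequences with \<open>n\<close> jumps the distance to a fixed history is a finite sum of continuous
  functions of the coordinates. So an open set of histories pulls back to a relatively open set of
  coordinate sequences, and the product of countably many second-countable spaces has the product
  of the Borel structures.\<close>

lemma measurable_finite_history:
  fixes f :: "'a \<Rightarrow> nat \<Rightarrow> real \<times> 'e::polish_space"
  assumes f: "\<And>k. (\<lambda>a. f a k) \<in> borel_measurable A"
    and inc: "\<And>a. a \<in> space A \<Longrightarrow> f a \<in> increasing_times n"
  shows "(\<lambda>a. finite_history n (f a)) \<in> A \<rightarrow>\<^sub>M history_borel"
proof -
  interpret Metric_space "history_set :: 'e history set" history_dist
    by (rule Metric_space_history)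
  have fm: "f \<in> borel_measurable A"
    using f by (rule measurable_coordinatewise_then_product)
  let ?D = "increasing_times n :: (nat \<Rightarrow> real \<times> 'e) set"
  show ?thesis
    unfolding history_borel_def
  proof (rule measurable_sigma_sets)
    show "sets (sigma history_set {U. openin mtopology U}) = sigma_sets history_set {U. openin mtopology U}"
      by (rule sets_measure_of) (auto simp: openin_mtopology)
    show "{U. openin mtopology U} \<subseteq> Pow history_set"
      by (auto simp: openin_mtopology)
    show "(\<lambda>a. finite_history n (f a)) \<in> space A \<rightarrow> history_set"
      using inc finite_history_in_history_set by blast
    fix U :: "'e history set" assume "U \<in> {U. openin mtopology U}"
    then have U: "openin mtopology U" by simp
    let ?V = "{x \<in> ?D. finite_history n x \<in> U}"
    have "openin (top_of_set ?D) ?V"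
    proof (subst openin_subopen, intro ballI)
      fix x assume x: "x \<in> ?V"
      then obtain r where r: "0 < r" "mball (finite_history n x) r \<subseteq> U"
        using U unfolding openin_mtopology by blast
      let ?d = "\<lambda>y. history_dist (finite_history n x) (finite_history n y)"
      have "continuous_on ?D (\<lambda>y. \<Sum>k\<le>n. (1/2) ^ (k + 2) *
          (shrink \<bar>fst (x k) - fst (y k)\<bar> + shrink (dist (snd (x k)) (snd (y k)))) :: real)"
        by (intro continuous_intros continuous_on_product_coordinates
              continuous_on_compose2[OF continuous_on_fst] continuous_on_compose2[OF continuous_on_snd])
           (auto simp: add_nonneg_eq_0_iff intro: continuous_on_subset[OF continuous_on_product_coordinates])
      then have "continuous_on ?D ?d"
        by (rule continuous_on_eq) (use x in \<open>simp add: history_dist_finite_history\<close>)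
      then have "openin (top_of_set ?D) (?D \<inter> ?d -` {..<r})"
        by (rule continuous_openin_preimage_gen) simp
      moreover have "x \<in> ?D \<inter> ?d -` {..<r}"
        using x r finite_history_in_history_set[of x n] by simp
      moreover have "?D \<inter> ?d -` {..<r} \<subseteq> ?V"
        using r x by (auto simp: mball_def finite_history_in_history_set)
      ultimately show "\<exists>W. openin (top_of_set ?D) W \<and> x \<in> W \<and> W \<subseteq> ?V" by blast
    qed
    then obtain O' where O': "open O'" "?V = ?D \<inter> O'"
      by (auto simp: openin_open)
    have "(\<lambda>a. finite_history n (f a)) -` U \<inter> space A = f -` O' \<inter> space A"
      using O'(2) inc by (auto simp: set_eq_iff)
    also have "\<dots> \<in> sets A"
      using measurable_sets[OF fm] O'(1) by simp
    finally show "(\<lambda>a. finite_history n (f a)) -` U \<inter> space A \<in> sets A" .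
  qed
qed


section \<open>Predictable sets and processes\<close>

lemma usual_filtrationD:
  assumes "usual_filtration M F"
  shows "0 \<le> t \<Longrightarrow> space (F t) = space M" "0 \<le> t \<Longrightarrow> sets (F t) \<subseteq> sets M"
    and "0 \<le> s \<Longrightarrow> s \<le> t \<Longrightarrow> sets (F s) \<subseteq> sets (F t)"
    and "N \<in> null_sets M \<Longrightarrow> A \<subseteq> N \<Longrightarrow> A \<in> sets (F 0)"
proof -
  note u = assms[unfolded usual_filtration_def subalgebra_def]
  show "0 \<le> t \<Longrightarrow> space (F t) = space M" "0 \<le> t \<Longrightarrow> sets (F t) \<subseteq> sets M"
    using conjunct1[OF u] by simp_all
  show "0 \<le> s \<Longrightarrow> s \<le> t \<Longrightarrow> sets (F s) \<subseteq> sets (F t)"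
    using conjunct1[OF conjunct2[OF u]] by simp
  show "N \<in> null_sets M \<Longrightarrow> A \<subseteq> N \<Longrightarrow> A \<in> sets (F 0)"
    using conjunct2[OF conjunct2[OF conjunct2[OF u]]] by simp
qed

lemma predictable_generator_subset:
  assumes "usual_filtration M F"
  shows "{A \<times> {s<..t} | A s t. 0 \<le> s \<and> s < t \<and> A \<in> sets (F s)} \<subseteq> Pow (space M \<times> {0<..})"
proof (clarify, intro conjI)
  fix A s t \<omega> u assume A: "0 \<le> s" "A \<in> sets (F s)" "\<omega> \<in> A" and "u \<in> {s<..t}"
  then show "\<omega> \<in> space M" "u \<in> {0<..}"
    using sets.sets_into_space[OF A(2)] usual_filtrationD(1)[OF assms A(1)] by auto
qed

lemma space_predictable [simp]:
  assumes "usual_filtration M F"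
  shows "space (predictable M F) = space M \<times> {0<..}"
  unfolding predictable_def
  by (rule space_measure_of[OF predictable_generator_subset[OF assms]])

lemma sets_predictable:
  assumes "usual_filtration M F"
  shows "sets (predictable M F) =
    sigma_sets (space M \<times> {0<..}) {A \<times> {s<..t} | A s t. 0 \<le> s \<and> s < t \<and> A \<in> sets (F s)}"
  unfolding predictable_def
  by (rule sets_measure_of[OF predictable_generator_subset[OF assms]])

lemma predictable_rectangle:
  assumes "usual_filtration M F" "0 \<le> s" "s < t" "A \<in> sets (F s)"
  shows "A \<times> {s<..t} \<in> sets (predictable M F)"
  using assms(2-) unfolding sets_predictable[OF assms(1)] by blast

lemma predictable_after:
  assumes u: "usual_filtration M F" and "0 \<le> s" "A \<in> sets (F s)"
  shows "A \<times> {s<..} \<in> sets (predictable M F)"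
proof -
  have "A \<times> {s<..} = (\<Union>n::nat. A \<times> {s<..s + real (Suc n)})"
  proof (intro set_eqI iffI)
    fix x assume "x \<in> A \<times> {s<..}"
    moreover obtain n where "snd x - s \<le> real n"
      using real_arch_simple by blast
    ultimately show "x \<in> (\<Union>n::nat. A \<times> {s<..s + real (Suc n)})"
      by (auto intro!: exI[of _ n])
  qed auto
  also have "\<dots> \<in> sets (predictable M F)"
    using assms by (intro sets.countable_UN) (auto intro!: predictable_rectangle)
  finally show ?thesis .
qed

lemma measurable_predictable_time:
  assumes u: "usual_filtration M F"
  shows "snd \<in> predictable M F \<rightarrow>\<^sub>M pos_time"
proof -
  have "(\<lambda>x. - snd x) \<in> borel_measurable (predictable M F)"
  proof (rule borel_measurableI_less)
    fix a :: real
    have "{x \<in> space (predictable M F). - snd x < a} = space M \<times> {max 0 (- a)<..}"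
      using u by auto
    also have "\<dots> \<in> sets (predictable M F)"
      by (intro predictable_after[OF u]) (simp_all flip: usual_filtrationD(1)[OF u, of "max 0 (- a)"])
    finally show "{x \<in> space (predictable M F). - snd x < a} \<in> sets (predictable M F)" .
  qed
  then have "(\<lambda>x. - (- snd x)) \<in> borel_measurable (predictable M F)"
    by (rule borel_measurable_uminus)
  then show ?thesis
    using u by (auto simp: measurable_restrict_space2_iff)
qed

lemma measurable_predictable_initial:
  assumes u: "usual_filtration M F" and g: "g \<in> F 0 \<rightarrow>\<^sub>M N"
  shows "(\<lambda>x. g (fst x)) \<in> predictable M F \<rightarrow>\<^sub>M N"
proof (rule measurableI)
  fix A assume A: "A \<in> sets N"
  have "(\<lambda>x. g (fst x)) -` A \<inter> space (predictable M F) = (g -` A \<inter> space (F 0)) \<times> {0<..}"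
    using u usual_filtrationD(1)[OF u, of 0] by auto
  also have "\<dots> \<in> sets (predictable M F)"
    using measurable_sets[OF g A] by (intro predictable_after[OF u]) auto
  finally show "(\<lambda>x. g (fst x)) -` A \<inter> space (predictable M F) \<in> sets (predictable M F)" .
qed (use u usual_filtrationD(1)[OF u, of 0] measurable_space[OF g] in auto)

lemma measurable_predictableI:
  assumes u: "usual_filtration M F"
    and f: "\<And>a. a \<in> space A \<Longrightarrow> f a \<in> space M \<times> {0<..}"
    and pre: "\<And>B s t. 0 \<le> s \<Longrightarrow> s < t \<Longrightarrow> B \<in> sets (F s) \<Longrightarrow> f -` (B \<times> {s<..t}) \<inter> space A \<in> sets A"
  shows "f \<in> A \<rightarrow>\<^sub>M predictable M F"
proof (rule measurable_sigma_sets[OF sets_predictable[OF u]])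
  show "{B \<times> {s<..t} | B s t. 0 \<le> s \<and> s < t \<and> B \<in> sets (F s)} \<subseteq> Pow (space M \<times> {0<..})"
    by (rule predictable_generator_subset[OF u])
  show "f \<in> space A \<rightarrow> space M \<times> {0<..}"
    using f by blast
qed (use pre in blast)

lemma measurable_predictable_section_time:
  assumes u: "usual_filtration M F" and \<omega>: "\<omega> \<in> space M"
  shows "(\<lambda>s. (\<omega>, s)) \<in> pos_time \<rightarrow>\<^sub>M predictable M F"
proof (rule measurable_predictableI[OF u])
  fix B :: "'a set" and s t :: real assume "0 \<le> s"
  then have "(\<lambda>s. (\<omega>, s)) -` (B \<times> {s<..t}) \<inter> space pos_time = (if \<omega> \<in> B then {s<..t} else {})"
    by (auto simp: space_restrict_space)
  also have "\<dots> \<in> sets pos_time"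
    using \<open>0 \<le> s\<close> by (auto simp: sets_restrict_space_iff)
  finally show "(\<lambda>s. (\<omega>, s)) -` (B \<times> {s<..t}) \<inter> space pos_time \<in> sets pos_time" .
qed (use \<omega> in \<open>auto simp: space_restrict_space\<close>)

lemma measurable_predictable_section_state:
  assumes u: "usual_filtration M F" and "0 < t"
  shows "(\<lambda>\<omega>. (\<omega>, t)) \<in> M \<rightarrow>\<^sub>M predictable M F"
proof (rule measurable_predictableI[OF u])
  fix B :: "'a set" and s v :: real assume s: "0 \<le> s" "B \<in> sets (F s)"
  then have B: "B \<in> sets M"
    using usual_filtrationD(2)[OF u] by blast
  have "(\<lambda>\<omega>. (\<omega>, t)) -` (B \<times> {s<..v}) \<inter> space M = (if t \<in> {s<..v} then B else {})"
    using sets.sets_into_space[OF B] by auto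
  then show "(\<lambda>\<omega>. (\<omega>, t)) -` (B \<times> {s<..v}) \<inter> space M \<in> sets M"
    using B by simp
qed (use \<open>0 < t\<close> in auto)


section \<open>Stopping times and predictability\<close>

text \<open>The events prior to a stopping time already form a \<open>\<sigma>\<close>-algebra, so the one they generate has no
  further members.\<close>

lemma sets_stopped_algebraD:
  assumes u: "usual_filtration M F" and \<tau>: "ext_stopping_time M F \<tau>"
    and A: "A \<in> sets (stopped_algebra M F \<tau>)"
  shows "A \<in> sets M" and "0 \<le> t \<Longrightarrow> A \<inter> {\<omega> \<in> space M. \<tau> \<omega> \<le> ereal t} \<in> sets (F t)"
proof -
  let ?L = "\<lambda>t. {\<omega> \<in> space M. \<tau> \<omega> \<le> ereal t}"
  let ?G = "{A \<in> sets M. \<forall>t\<ge>0. A \<inter> ?L t \<in> sets (F t)}"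
  have "sets (stopped_algebra M F \<tau>) = sigma_sets (space M) ?G"
    unfolding stopped_algebra_def using sets.sets_into_space by (intro sets_measure_of) blast
  with A have "A \<in> sigma_sets (space M) ?G"
    by simp
  then have "A \<in> ?G"
  proof induction
    case (Compl a)
    have "(space M - a) \<inter> ?L t = ?L t - (a \<inter> ?L t)" for t
      by auto
    moreover have "?L t - (a \<inter> ?L t) \<in> sets (F t)" if "0 \<le> t" for t
      using that Compl.IH \<tau>[unfolded ext_stopping_time_def] by (intro sets.Diff) blast+
    moreover have "space M - a \<in> sets M"
      using Compl.IH by blast
    ultimately show ?case
      by simp
  next
    case (Union a)
    have "(\<Union>i. a i) \<inter> ?L t = (\<Union>i. a i \<inter> ?L t)" for t
      by auto
    moreover have "(\<Union>i. a i \<inter> ?L t) \<in> sets (F t)" if "0 \<le> t" for t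
      using that Union.IH by (intro sets.countable_UN) blast
    moreover have "(\<Union>i. a i) \<in> sets M"
      using Union.IH by (intro sets.countable_UN) blast
    ultimately show ?case
      by simp
  qed auto
  then show "A \<in> sets M" "0 \<le> t \<Longrightarrow> A \<inter> ?L t \<in> sets (F t)"
    by auto
qed

lemma space_stopped_algebra [simp]: "space (stopped_algebra M F \<tau>) = space M"
  unfolding stopped_algebra_def using sets.sets_into_space by (intro space_measure_of) blast

lemma sets_stopped_algebraI:
  assumes "A \<in> sets M" "\<And>t. 0 \<le> t \<Longrightarrow> A \<inter> {\<omega> \<in> space M. \<tau> \<omega> \<le> ereal t} \<in> sets (F t)"
  shows "A \<in> sets (stopped_algebra M F \<tau>)"
proof -
  let ?G = "{A \<in> sets M. \<forall>t\<ge>0. A \<inter> {\<omega> \<in> space M. \<tau> \<omega> \<le> ereal t} \<in> sets (F t)}"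
  have "sets (stopped_algebra M F \<tau>) = sigma_sets (space M) ?G"
    unfolding stopped_algebra_def using sets.sets_into_space by (intro sets_measure_of) blast
  then show ?thesis
    using assms by auto
qed

lemma ext_stopping_time_measurable:
  assumes u: "usual_filtration M F" and \<tau>: "ext_stopping_time M F \<tau>"
    and nonneg: "\<And>\<omega>. \<omega> \<in> space M \<Longrightarrow> 0 \<le> \<tau> \<omega>"
  shows "\<tau> \<in> borel_measurable (stopped_algebra M F \<tau>)"
  unfolding borel_measurable_iff_Iic_ereal
proof
  let ?L = "\<lambda>a. {\<omega> \<in> space M. \<tau> \<omega> \<le> ereal a}"
  have L: "?L r \<in> sets (F t)" if "0 \<le> t" "r \<le> t" for r t
  proof (cases "0 \<le> r")
    case True
    have "?L r \<in> sets (F r)"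
      using True \<tau> by (simp add: ext_stopping_time_def)
    with usual_filtrationD(3)[OF u True \<open>r \<le> t\<close>] show ?thesis
      by (rule subsetD)
  next
    case False
    have "?L r = {}"
    proof (intro equals0I)
      fix \<omega> assume "\<omega> \<in> ?L r"
      then have "0 \<le> ereal r"
        using nonneg[of \<omega>] order.trans by blast
      with False show False by simp
    qed
    then show ?thesis by (simp only: sets.empty_sets)
  qed
  have LM: "?L r \<in> sets M" for r
    using subsetD[OF usual_filtrationD(2)[OF u max.cobounded1] L[OF max.cobounded1 max.cobounded2]] .
  fix a :: ereal
  show "\<tau> -` {..a} \<inter> space (stopped_algebra M F \<tau>) \<in> sets (stopped_algebra M F \<tau>)"
  proof (cases a)
    case (real r)
    have e: "\<tau> -` {..a} \<inter> space (stopped_algebra M F \<tau>) = ?L r"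
      using real by auto
    show ?thesis
      unfolding e
    proof (rule sets_stopped_algebraI[OF LM])
      fix t :: real assume "0 \<le> t"
      then have "?L (min r t) \<in> sets (F t)"
        by (rule L) simp
      moreover have "\<tau> \<omega> \<le> ereal (min r t) \<longleftrightarrow> \<tau> \<omega> \<le> ereal r \<and> \<tau> \<omega> \<le> ereal t" for \<omega>
        by (cases "\<tau> \<omega>") auto
      then have "?L (min r t) = ?L r \<inter> ?L t"
        by blast
      ultimately show "?L r \<inter> ?L t \<in> sets (F t)"
        by (simp only:)
    qed
  next
    case PInf
    have "\<tau> -` {..a} \<inter> space (stopped_algebra M F \<tau>) = space (stopped_algebra M F \<tau>)"
      using PInf by auto
    then show ?thesis by (simp only: sets.top)
  next
    case MInf
    have "\<tau> -` {..a} \<inter> space (stopped_algebra M F \<tau>) = {}"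
    proof (intro equals0I)
      fix \<omega> assume "\<omega> \<in> \<tau> -` {..a} \<inter> space (stopped_algebra M F \<tau>)"
      then show False
        using nonneg[of \<omega>] MInf by simp
    qed
    then show ?thesis by (simp only: sets.empty_sets)
  qed
qed

text \<open>If \<open>\<tau> < s\<close>, some rational lies in between, and by that time an event of the past of \<open>\<tau>\<close> is
  known: strictly after \<open>\<tau>\<close> the past of \<open>\<tau>\<close> is predictable.\<close>

lemma predictable_after_stopping:
  assumes u: "usual_filtration M F" and \<tau>: "ext_stopping_time M F \<tau>"
    and A: "A \<in> sets (stopped_algebra M F \<tau>)"
  shows "{x \<in> A \<times> {0<..}. \<tau> (fst x) < ereal (snd x)} \<in> sets (predictable M F)"
proof -
  have AM: "A \<subseteq> space M"
    using sets_stopped_algebraD(1)[OF u \<tau> A] sets.sets_into_space by blast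
  let ?B = "\<lambda>q::rat. (A \<inter> {\<omega> \<in> space M. \<tau> \<omega> \<le> ereal (real_of_rat q)}) \<times> {real_of_rat q<..}"
  have "{x \<in> A \<times> {0<..}. \<tau> (fst x) < ereal (snd x)} = (\<Union>q\<in>{0..}. ?B q)"
  proof (intro set_eqI iffI)
    fix x assume "x \<in> {x \<in> A \<times> {0<..}. \<tau> (fst x) < ereal (snd x)}"
    then obtain \<omega> s where x: "x = (\<omega>, s)" "\<omega> \<in> A" "0 < s" "\<tau> \<omega> < ereal s"
      by (cases x) auto
    then have "max 0 (\<tau> \<omega>) < ereal s"
      by simp
    then obtain r where r: "max 0 (\<tau> \<omega>) < ereal r" "r < s"
      by (metis ereal_dense2 ereal_less_eq(3) not_le)
    then obtain q where q: "r < real_of_rat q" "real_of_rat q < s"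
      using of_rat_dense by blast
    have "0 < r"
      using r(1) by (simp add: zero_ereal_def)
    then have "0 < real_of_rat q"
      using q(1) by (rule less_trans)
    then have "q \<in> {0..}"
      by simp
    moreover have "\<tau> \<omega> \<le> ereal r" "ereal r \<le> ereal (real_of_rat q)"
      using r q by auto
    then have "\<tau> \<omega> \<le> ereal (real_of_rat q)"
      by (rule order.trans)
    then have "x \<in> ?B q"
      using x q AM by auto
    ultimately
    show "x \<in> (\<Union>q\<in>{0..}. ?B q)" by blast
  next
    fix x assume "x \<in> (\<Union>q\<in>{0..}. ?B q)"
    then obtain q :: rat where q: "0 \<le> q" "fst x \<in> A" "\<tau> (fst x) \<le> ereal (real_of_rat q)"
      "real_of_rat q < snd x"
      by auto
    have "0 \<le> real_of_rat q"
      using q(1) by simp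
    then have "0 < snd x"
      using q(4) by (rule le_less_trans)
    moreover have "\<tau> (fst x) < ereal (snd x)"
      using q(3,4) by (metis less_ereal.simps(1) order.strict_trans1)
    ultimately show "x \<in> {x \<in> A \<times> {0<..}. \<tau> (fst x) < ereal (snd x)}"
      using q(2) by (simp add: mem_Times_iff)
  qed
  also have "\<dots> \<in> sets (predictable M F)"
  proof (rule sets.countable_UN''[OF countableI_type])
    fix q :: rat assume "q \<in> {0..}"
    then have "0 \<le> real_of_rat q"
      by simp
    then show "?B q \<in> sets (predictable M F)"
      by (intro predictable_after[OF u] sets_stopped_algebraD(2)[OF u \<tau> A])
  qed
  finally show ?thesis .
qed

lemma measurable_after_stopping:
  assumes u: "usual_filtration M F" and \<tau>: "ext_stopping_time M F \<tau>"
    and g: "g \<in> stopped_algebra M F \<tau> \<rightarrow>\<^sub>M N"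
    and \<Omega>: "\<Omega> \<subseteq> {x. \<tau> (fst x) < ereal (snd x)}"
  shows "(\<lambda>x. g (fst x)) \<in> restrict_space (predictable M F) \<Omega> \<rightarrow>\<^sub>M N"
proof (rule measurableI)
  fix A assume A: "A \<in> sets N"
  let ?A = "g -` A \<inter> space M"
  have "(\<lambda>x. g (fst x)) -` A \<inter> space (restrict_space (predictable M F) \<Omega>) =
      \<Omega> \<inter> {x \<in> ?A \<times> {0<..}. \<tau> (fst x) < ereal (snd x)}"
    using \<Omega> by (auto simp: space_restrict_space space_predictable[OF u])
  moreover have "?A \<in> sets (stopped_algebra M F \<tau>)"
    using measurable_sets[OF g A] by simp
  then have "\<Omega> \<inter> {x \<in> ?A \<times> {0<..}. \<tau> (fst x) < ereal (snd x)} \<in> sets (restrict_space (predictable M F) \<Omega>)"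
    unfolding sets_restrict_space by (intro imageI predictable_after_stopping[OF u \<tau>])
  ultimately show "(\<lambda>x. g (fst x)) -` A \<inter> space (restrict_space (predictable M F) \<Omega>)
      \<in> sets (restrict_space (predictable M F) \<Omega>)"
    by (simp only:)
next
  fix x assume "x \<in> space (restrict_space (predictable M F) \<Omega>)"
  then show "g (fst x) \<in> space N"
    using measurable_space[OF g, of "fst x"] by (auto simp: space_restrict_space space_predictable[OF u])
qed

text \<open>On a null set every function of the trajectory alone is measurable at time \<open>0\<close>, because the
  filtration is complete. An increasing function of time exceeds \<open>c\<close> on a half-line, described by
  its end point and by whether the end point belongs to it; both depend on the trajectory only.\<close>

lemma predictable_monotone_on_null_set:
  fixes g :: "'w \<Rightarrow> real \<Rightarrow> 'b::{second_countable_topology, linorder_topology}"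
  assumes u: "usual_filtration M F" and N: "N \<in> null_sets M"
    and mono: "\<And>\<omega> s t. \<omega> \<in> N \<Longrightarrow> 0 < s \<Longrightarrow> s \<le> t \<Longrightarrow> g \<omega> s \<le> g \<omega> t"
  shows "(\<lambda>x. g (fst x) (snd x)) \<in> borel_measurable (restrict_space (predictable M F) (N \<times> UNIV))"
proof (rule borel_measurableI_greater)
  fix c :: 'b
  let ?P = "predictable M F"
  let ?U = "\<lambda>\<omega>. {t. 0 < t \<and> c < g \<omega> t}"
  define N' where "N' = {\<omega> \<in> N. ?U \<omega> \<noteq> {}}"
  define a where "a \<omega> = (if \<omega> \<in> N' then Inf (?U \<omega>) else 0)" for \<omega>
  have F0: "A \<in> sets (F 0)" if "A \<subseteq> N" for A
    using usual_filtrationD(4)[OF u N that] .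
  have N'_space: "N' \<subseteq> space (F 0)"
    using sets.sets_into_space[OF F0[OF subset_refl]] by (auto simp: N'_def)
  have a_0: "a \<omega> = 0" if "\<omega> \<notin> N'" for \<omega>
    using that by (simp add: a_def)
  have "a \<in> borel_measurable (F 0)"
  proof (rule measurableI)
    fix A :: "real set"
    have "a -` A \<inter> space (F 0) = (if 0 \<in> A then space (F 0) - {\<omega> \<in> N'. a \<omega> \<notin> A} else {\<omega> \<in> N'. a \<omega> \<in> A})"
    proof (rule set_eqI)
      fix \<omega>
      show "\<omega> \<in> a -` A \<inter> space (F 0) \<longleftrightarrow>
          \<omega> \<in> (if 0 \<in> A then space (F 0) - {\<omega> \<in> N'. a \<omega> \<notin> A} else {\<omega> \<in> N'. a \<omega> \<in> A})"
        using N'_space a_0[of \<omega>] by (cases "\<omega> \<in> N'") auto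
    qed
    moreover have "{\<omega> \<in> N'. a \<omega> \<notin> A} \<in> sets (F 0)" and "{\<omega> \<in> N'. a \<omega> \<in> A} \<in> sets (F 0)"
      by (intro F0; force simp: N'_def)+
    then have "(if 0 \<in> A then space (F 0) - {\<omega> \<in> N'. a \<omega> \<notin> A} else {\<omega> \<in> N'. a \<omega> \<in> A}) \<in> sets (F 0)"
      using sets.compl_sets by (cases "0 \<in> A") (simp_all only: if_True if_False simp_thms)
    ultimately show "a -` A \<inter> space (F 0) \<in> sets (F 0)"
      by (simp only:)
  qed simp
  then have [measurable]: "(\<lambda>x. a (fst x)) \<in> borel_measurable ?P"
    by (rule measurable_predictable_initial[OF u])
  have [measurable]: "snd \<in> borel_measurable ?P"
    using measurable_predictable_time[OF u] by (simp add: measurable_restrict_space2_iff)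
  have NN[measurable]: "A \<times> {0<..} \<in> sets ?P" if "A \<subseteq> N" for A
    by (intro predictable_after[OF u] F0 that) simp
  have U: "t \<in> ?U \<omega> \<longleftrightarrow> \<omega> \<in> N' \<and> 0 < t \<and> (a \<omega> < t \<or> (a \<omega> = t \<and> a \<omega> \<in> ?U \<omega>))" if "\<omega> \<in> N" "0 < t" for \<omega> t
  proof -
    have bdd: "bdd_below (?U \<omega>)"
      by (rule bdd_belowI[of _ 0]) auto
    show ?thesis
    proof
      assume t: "t \<in> ?U \<omega>"
      then have "\<omega> \<in> N'"
        using that by (auto simp: N'_def)
      moreover have "Inf (?U \<omega>) \<le> t"
        using t bdd by (rule cInf_lower)
      ultimately show "\<omega> \<in> N' \<and> 0 < t \<and> (a \<omega> < t \<or> (a \<omega> = t \<and> a \<omega> \<in> ?U \<omega>))"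
        using t by (auto simp: a_def)
    next
      assume r: "\<omega> \<in> N' \<and> 0 < t \<and> (a \<omega> < t \<or> (a \<omega> = t \<and> a \<omega> \<in> ?U \<omega>))"
      show "t \<in> ?U \<omega>"
      proof (cases "a \<omega> < t")
        case True
        then obtain s where "s \<in> ?U \<omega>" "s < t"
          using r cInf_lessD[of "?U \<omega>" t] by (auto simp: a_def N'_def)
        then show ?thesis
          using mono[OF that(1), of s t] that(2) by (auto intro: order.strict_trans2)
      qed (use r in auto)
    qed
  qed
  have "{x \<in> space (restrict_space ?P (N \<times> UNIV)). c < g (fst x) (snd x)} =
     N' \<times> {0<..} \<inter> ({x \<in> space ?P. a (fst x) < snd x} \<union>
       ({x \<in> space ?P. a (fst x) = snd x} \<inter> {\<omega> \<in> N'. a \<omega> \<in> ?U \<omega>} \<times> {0<..}))" (is "?L = ?R")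
  proof (intro set_eqI iffI)
    fix x assume "x \<in> ?L"
    then show "x \<in> ?R"
      using U[of "fst x" "snd x"] by (auto simp: space_restrict_space space_predictable[OF u])
  next
    fix x assume "x \<in> ?R"
    then show "x \<in> ?L"
      using U[of "fst x" "snd x"] by (auto simp: space_restrict_space space_predictable[OF u] N'_def)
  qed
  moreover have "?R \<in> sets ?P"
    by (intro sets.Int sets.Un NN) (auto simp: N'_def)
  then have "(\<inter>) (N \<times> UNIV) ?R \<in> sets (restrict_space ?P (N \<times> UNIV))"
    unfolding sets_restrict_space by (rule imageI)
  moreover have "N \<times> UNIV \<inter> ?R = ?R"
    by (auto simp: N'_def)
  ultimately show "{x \<in> space (restrict_space ?P (N \<times> UNIV)). c < g (fst x) (snd x)}
      \<in> sets (restrict_space ?P (N \<times> UNIV))"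
    by (simp only:)
qed


section \<open>Paths of histories\<close>

lemma interval_unique:
  fixes \<tau> :: "nat \<Rightarrow> 'a::linorder"
  assumes "mono \<tau>" "\<tau> i \<le> s" "s < \<tau> (Suc i)" "\<tau> j \<le> s" "s < \<tau> (Suc j)"
  shows "i = j"
proof (rule ccontr)
  assume "i \<noteq> j"
  then have "\<tau> (Suc i) \<le> \<tau> j \<or> \<tau> (Suc j) \<le> \<tau> i"
    using monoD[OF \<open>mono \<tau>\<close>] by (cases "i < j") auto
  with assms(2-) show False
    by (meson leD order.trans)
qed

lemma left_open_interval_unique:
  fixes \<tau> :: "nat \<Rightarrow> 'a::linorder"
  assumes "mono \<tau>" "\<tau> i < s" "s \<le> \<tau> (Suc i)" "\<tau> j < s" "s \<le> \<tau> (Suc j)"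
  shows "i = j"
proof (rule ccontr)
  assume "i \<noteq> j"
  then have "\<tau> (Suc i) \<le> \<tau> j \<or> \<tau> (Suc j) \<le> \<tau> i"
    using monoD[OF \<open>mono \<tau>\<close>] by (cases "i < j") auto
  with assms(2-) show False
    by (meson leD order.trans)
qed

lemma interval_exists:
  fixes \<tau> :: "nat \<Rightarrow> 'a::linorder"
  assumes "\<tau> 0 \<le> s" "s < \<tau> n"
  obtains k where "k < n" "\<tau> k \<le> s" "s < \<tau> (Suc k)"
proof -
  have "(LEAST n. s < \<tau> n) \<le> n" "s < \<tau> (LEAST n. s < \<tau> n)"
    using assms(2) by (auto intro: Least_le LeastI)
  moreover obtain k where k: "(LEAST n. s < \<tau> n) = Suc k"
    using assms calculation(2) by (cases "LEAST n. s < \<tau> n") auto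
  moreover have "\<not> s < \<tau> k"
    using k by (intro not_less_Least) simp
  ultimately show thesis
    using that[of k] by auto
qed

lemma left_open_interval_exists:
  fixes \<tau> :: "nat \<Rightarrow> 'a::linorder"
  assumes "\<tau> 0 < s" "s \<le> \<tau> n"
  obtains k where "k < n" "\<tau> k < s" "s \<le> \<tau> (Suc k)"
proof -
  have "(LEAST n. s \<le> \<tau> n) \<le> n" "s \<le> \<tau> (LEAST n. s \<le> \<tau> n)"
    using assms(2) by (auto intro: Least_le LeastI)
  moreover obtain k where k: "(LEAST n. s \<le> \<tau> n) = Suc k"
    using assms calculation(2) by (cases "LEAST n. s \<le> \<tau> n") auto
  moreover have "\<not> s \<le> \<tau> k"
    using k by (intro not_less_Least) simp
  ultimately show thesis
    using that[of k] by auto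
qed

lemma eventually_at_right_ereal_less:
  assumes "ereal t < c"
  shows "\<forall>\<^sub>F r in at_right t. t < r \<and> ereal r < c"
proof -
  have "((\<lambda>r. ereal r) \<longlongrightarrow> ereal t) (at_right t)"
    by (intro tendsto_intros)
  from order_tendstoD(2)[OF this assms] eventually_at_right_less[of t]
  show ?thesis by eventually_elim simp
qed

lemma eventually_at_left_ereal_greater:
  assumes "c < ereal t"
  shows "\<forall>\<^sub>F r in at_left t. r < t \<and> c < ereal r"
proof -
  have "((\<lambda>r. ereal r) \<longlongrightarrow> ereal t) (at_left t)"
    by (intro tendsto_intros)
  from order_tendstoD(1)[OF this assms] eventually_at_left_real[of "t - 1" t]
  show ?thesis by (auto elim: eventually_elim2)
qed

lemma history_set_mono_times: "h \<in> history_set \<Longrightarrow> mono (\<lambda>n. fst (h n))"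
  by (intro monoI history_set_mono)

lemma path_of_history_eq:
  assumes h: "h \<in> history_set" and "0 \<le> s"
    and k: "fst (h k) \<le> ereal s" "ereal s < fst (h (Suc k))"
  shows "path_of_history h s = the (snd (h k))"
proof -
  have "(THE k. fst (h k) \<le> ereal s \<and> ereal s < fst (h (Suc k))) = k"
    using k interval_unique[OF history_set_mono_times[OF h]] by (intro the_equality) auto
  then show ?thesis
    using \<open>0 \<le> s\<close> by (simp add: path_of_history_def)
qed

lemma history_set_unbounded:
  assumes h: "h \<in> history_set"
  obtains n where "ereal s < fst (h n)"
proof -
  have "\<forall>\<^sub>F n in sequentially. ereal s < fst (h n)"
    using h by (intro order_tendstoD(1)) (auto simp: history_set_def)
  then show thesis
    using that by (auto simp: eventually_sequentially)
qed

text \<open>Since its jump times tend to infinity, a history assigns a value to every time, and near a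
  given time its path takes one value on the right and one value on the left.\<close>

lemma path_of_history_in_skorokhod_paths:
  fixes h :: "'e::metric_space history"
  assumes h: "h \<in> history_set"
  shows "path_of_history h \<in> skorokhod_paths"
proof -
  have h0: "fst (h 0) = 0"
    using h by (simp add: history_set_def)
  have k_nonneg: "0 \<le> fst (h k)" for k
    using history_set_mono[OF h, of 0 k] h0 by simp
  have right: "(path_of_history h \<longlongrightarrow> path_of_history h t) (at_right t)" if t: "0 \<le> t" for t
  proof -
    obtain n where "ereal t < fst (h n)"
      by (rule history_set_unbounded[OF h])
    then obtain k where k: "fst (h k) \<le> ereal t" "ereal t < fst (h (Suc k))"
      using interval_exists[of "\<lambda>k. fst (h k)" "ereal t" n] h0 t by auto
    have "\<forall>\<^sub>F r in at_right t. path_of_history h r = path_of_history h t"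
      using eventually_at_right_ereal_less[OF k(2)]
    proof eventually_elim
      case (elim r)
      moreover have "fst (h k) \<le> ereal r"
        using k(1) elim by (auto intro: order.trans)
      ultimately show ?case
        using path_of_history_eq[OF h t k] path_of_history_eq[OF h, of r k] t by simp
    qed
    then show ?thesis
      by (rule tendsto_eventually)
  qed
  have left: "\<exists>l. (path_of_history h \<longlongrightarrow> l) (at_left t)" if t: "0 < t" for t
  proof -
    obtain n where "ereal t < fst (h n)"
      by (rule history_set_unbounded[OF h])
    then obtain k where k: "fst (h k) < ereal t" "ereal t \<le> fst (h (Suc k))"
      using left_open_interval_exists[of "\<lambda>k. fst (h k)" "ereal t" n] h0 t by (auto intro: less_imp_le)
    have "\<forall>\<^sub>F r in at_left t. path_of_history h r = the (snd (h k))"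
      using eventually_at_left_ereal_greater[OF k(1)]
    proof eventually_elim
      case (elim r)
      then have "0 \<le> ereal r"
        using order.strict_trans1[OF k_nonneg[of k], of "ereal r"] by (auto intro: less_imp_le)
      moreover have "ereal r < fst (h (Suc k))"
        using k(2) elim by (metis less_ereal.simps(1) order.strict_trans2)
      ultimately show ?case
        using path_of_history_eq[OF h, of r k] elim by (simp add: less_imp_le)
    qed
    then show ?thesis
      by (intro exI tendsto_eventually)
  qed
  show ?thesis
    unfolding skorokhod_paths_def cadlag_def using right left by (auto simp: path_of_history_def)
qed

lemma space_skorokhod_borel [simp]:
  "space skorokhod_borel = (skorokhod_paths :: (real \<Rightarrow> 'e::metric_space) set)"
  unfolding skorokhod_borel_def by (rule space_measure_of) (auto simp: skorokhod_open_def)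


section \<open>The signal and its history between two jumps\<close>

locale jump_signal =
  fixes M :: "'w measure" and F :: "real \<Rightarrow> 'w measure"
    and T :: "nat \<Rightarrow> 'w \<Rightarrow> ereal" and \<zeta> :: "nat \<Rightarrow> 'w \<Rightarrow> 'e::polish_space"
  assumes usual: "usual_filtration M F"
    and T_0: "\<omega> \<in> space M \<Longrightarrow> T 0 \<omega> = 0"
    and T_stopping: "1 \<le> k \<Longrightarrow> ext_stopping_time M F (T k)"
    and T_pos: "\<omega> \<in> space M \<Longrightarrow> 1 \<le> k \<Longrightarrow> 0 < T k \<omega> \<and> T k \<omega> \<le> T (Suc k) \<omega>"
    and T_less_Suc: "\<omega> \<in> space M \<Longrightarrow> 1 \<le> k \<Longrightarrow> T k \<omega> < \<infinity> \<Longrightarrow> T k \<omega> < T (Suc k) \<omega>"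
    and mark_measurable: "\<zeta> k \<in> stopped_algebra M F (T k) \<rightarrow>\<^sub>M borel"
begin

abbreviation X :: "real \<Rightarrow> 'w \<Rightarrow> 'e" where
  "X \<equiv> signal T \<zeta>"

text \<open>The intervals are open on the left: at the jump time \<open>T (Suc n)\<close> itself the left limits of the
  signal and of its history are still those of the state after \<open>n\<close> jumps.\<close>

definition between_jumps :: "nat \<Rightarrow> 'w \<Rightarrow> real \<Rightarrow> bool" where
  "between_jumps n \<omega> s \<longleftrightarrow> T n \<omega> < ereal s \<and> ereal s \<le> T (Suc n) \<omega>"

definition jump_marks :: "'w \<Rightarrow> nat \<Rightarrow> real \<times> 'e" where
  "jump_marks \<omega> k = (real_of_ereal (T k \<omega>), \<zeta> k \<omega>)"

lemma T_mono: "\<omega> \<in> space M \<Longrightarrow> mono (\<lambda>k. T k \<omega>)"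
proof (rule monoI, rule lift_Suc_mono_le[where f="\<lambda>k. T k \<omega>"])
  fix k assume "\<omega> \<in> space M"
  then show "T k \<omega> \<le> T (Suc k) \<omega>"
    using T_0 T_pos[of \<omega> 1] T_pos[of \<omega> k] by (cases "k = 0") auto
qed

lemma T_nonneg: "\<omega> \<in> space M \<Longrightarrow> 0 \<le> T k \<omega>"
  using monoD[OF T_mono, of \<omega> 0 k] T_0 by simp

lemma T_real: "\<omega> \<in> space M \<Longrightarrow> T k \<omega> < \<infinity> \<Longrightarrow> ereal (real_of_ereal (T k \<omega>)) = T k \<omega>"
  using T_nonneg[of \<omega> k] by (cases "T k \<omega>") auto

lemma T_strict: "\<omega> \<in> space M \<Longrightarrow> T k \<omega> < \<infinity> \<Longrightarrow> T k \<omega> < T (Suc k) \<omega>"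
  using T_less_Suc[of \<omega> k] T_0 T_pos[of \<omega> 1] by (cases "k = 0") auto

lemma T_finite_le: "\<omega> \<in> space M \<Longrightarrow> T n \<omega> < \<infinity> \<Longrightarrow> k \<le> n \<Longrightarrow> T k \<omega> < \<infinity>"
  using monoD[OF T_mono, of \<omega> k n] by (auto intro: order.strict_trans1)

lemma between_jumps_unique:
  "\<omega> \<in> space M \<Longrightarrow> between_jumps i \<omega> s \<Longrightarrow> between_jumps j \<omega> s \<Longrightarrow> i = j"
  using left_open_interval_unique[OF T_mono] by (auto simp: between_jumps_def)

lemma between_jumps_exists:
  assumes "\<omega> \<in> space M" "0 < s" "ereal s \<le> T k \<omega>"
  obtains n where "n < k" "between_jumps n \<omega> s"
  using left_open_interval_exists[of "\<lambda>k. T k \<omega>" "ereal s" k] assms T_0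
  by (auto simp: between_jumps_def)

lemma between_jumps_finite: "between_jumps n \<omega> s \<Longrightarrow> T n \<omega> < \<infinity>"
  by (auto simp: between_jumps_def)

lemma between_jumps_pos: "\<omega> \<in> space M \<Longrightarrow> between_jumps n \<omega> s \<Longrightarrow> 0 < s"
  using T_nonneg[of \<omega> n] by (auto simp: between_jumps_def dest: order.strict_trans1)

lemma between_jumps_at_jump:
  assumes \<omega>: "\<omega> \<in> space M" and fin: "T (Suc n) \<omega> < \<infinity>"
  shows "between_jumps n \<omega> (real_of_ereal (T (Suc n) \<omega>))"
  using T_real[OF \<omega> fin] T_strict[OF \<omega> T_finite_le[OF \<omega> fin]] by (simp add: between_jumps_def)

lemma signal_eq:
  assumes "\<omega> \<in> space M" and k: "T k \<omega> \<le> ereal s" "ereal s < T (Suc k) \<omega>"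
  shows "X s \<omega> = \<zeta> k \<omega>"
proof -
  have "(THE k. T k \<omega> \<le> ereal s \<and> ereal s < T (Suc k) \<omega>) = k"
    using k interval_unique[OF T_mono[OF assms(1)]] by (intro the_equality) auto
  then show ?thesis
    using k by (auto simp: signal_def)
qed

lemma signal_at_jump: "\<omega> \<in> space M \<Longrightarrow> T k \<omega> < \<infinity> \<Longrightarrow> X (real_of_ereal (T k \<omega>)) \<omega> = \<zeta> k \<omega>"
  using T_real T_strict by (intro signal_eq) auto

lemma jump_marks_increasing:
  assumes \<omega>: "\<omega> \<in> space M" and fin: "T n \<omega> < \<infinity>"
  shows "jump_marks \<omega> \<in> increasing_times n"
proof -
  have "real_of_ereal (T k \<omega>) < real_of_ereal (T (Suc k) \<omega>)" if "k < n" for k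
  proof -
    have "T k \<omega> < \<infinity>" "T (Suc k) \<omega> < \<infinity>"
      using T_finite_le[OF \<omega> fin] that by auto
    then have "ereal (real_of_ereal (T k \<omega>)) < ereal (real_of_ereal (T (Suc k) \<omega>))"
      using T_real[OF \<omega>] T_strict[OF \<omega>] by simp
    then show ?thesis by simp
  qed
  then show ?thesis
    using T_0[OF \<omega>] by (simp add: increasing_times_def jump_marks_def)
qed

lemma partial_history_eq:
  assumes \<omega>: "\<omega> \<in> space M" and fin: "T n \<omega> < \<infinity>"
  shows "partial_history T X n \<omega> = finite_history n (jump_marks \<omega>)"
proof
  fix k
  show "partial_history T X n \<omega> k = finite_history n (jump_marks \<omega>) k"
    using T_real[OF \<omega> T_finite_le[OF \<omega> fin]] signal_at_jump[OF \<omega> T_finite_le[OF \<omega> fin]]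
    by (simp add: partial_history_def finite_history_def jump_marks_def)
qed

lemma partial_history_in_history_set:
  "\<omega> \<in> space M \<Longrightarrow> T n \<omega> < \<infinity> \<Longrightarrow> partial_history T X n \<omega> \<in> history_set"
  by (simp add: partial_history_eq finite_history_in_history_set jump_marks_increasing)

lemma history_process_eq:
  assumes "\<omega> \<in> space M" and k: "T k \<omega> \<le> ereal s" "ereal s < T (Suc k) \<omega>"
  shows "history_process T X s \<omega> = partial_history T X k \<omega>"
proof -
  have "(THE k. T k \<omega> \<le> ereal s \<and> ereal s < T (Suc k) \<omega>) = k"
    using k interval_unique[OF T_mono[OF assms(1)]] by (intro the_equality) auto
  then show ?thesis
    using k by (auto simp: history_process_def)
qed

lemma eventually_left_between_jumps:
  assumes "between_jumps n \<omega> s"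
  shows "\<forall>\<^sub>F r in at_left s. T n \<omega> \<le> ereal r \<and> ereal r < T (Suc n) \<omega>"
proof -
  have n: "T n \<omega> < ereal s" "ereal s \<le> T (Suc n) \<omega>"
    using assms by (auto simp: between_jumps_def)
  show ?thesis
    using eventually_at_left_ereal_greater[OF n(1)]
  proof eventually_elim
    case (elim r)
    then have "ereal r < ereal s"
      by simp
    then have "ereal r < T (Suc n) \<omega>"
      using n(2) by (rule order.strict_trans2)
    with elim show ?case
      by (simp add: less_imp_le)
  qed
qed

lemma history_left_lim_eq:
  assumes \<omega>: "\<omega> \<in> space M" and n: "between_jumps n \<omega> s"
  shows "history_left_lim (history_process T X) s \<omega> = partial_history T X n \<omega>"
  using \<omega> n partial_history_in_history_set between_jumps_finite
    eventually_left_between_jumps[OF n]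
  by (intro history_left_lim_eventually_const) (auto elim!: eventually_mono intro: history_process_eq)

lemma left_lim_signal:
  assumes \<omega>: "\<omega> \<in> space M" and n: "between_jumps n \<omega> s"
  shows "left_lim X s \<omega> = \<zeta> n \<omega>"
  unfolding left_lim_def
  using eventually_left_between_jumps[OF n] \<omega>
  by (intro tendsto_Lim tendsto_eventually) (auto elim!: eventually_mono intro: signal_eq)

text \<open>The signal stopped just before \<open>s\<close> is a function of the history just before \<open>s\<close>. This is why
  the local characteristics of the history process are those of the signal read through the map
  from histories to paths.\<close>

lemma left_stopped_path_eq:
  assumes \<omega>: "\<omega> \<in> space M" and n: "between_jumps n \<omega> s"
  shows "left_stopped_path X s \<omega> = path_of_history (partial_history T X n \<omega>)"
proof
  fix r
  let ?h = "partial_history T X n \<omega>"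
  note fin = between_jumps_finite[OF n]
  have h: "?h \<in> history_set"
    using \<omega> fin by (rule partial_history_in_history_set)
  have s: "T n \<omega> < ereal s" "ereal s \<le> T (Suc n) \<omega>"
    using n by (auto simp: between_jumps_def)
  have mark: "the (snd (?h k)) = \<zeta> k \<omega>" if "k \<le> n" for k
    using that signal_at_jump[OF \<omega> T_finite_le[OF \<omega> fin]] by (simp add: partial_history_def)
  show "left_stopped_path X s \<omega> r = path_of_history ?h r"
  proof (cases "0 \<le> r")
    case r: True
    show ?thesis
    proof (cases "ereal r < T n \<omega>")
      case True
      then obtain k where k: "k < n" "T k \<omega> \<le> ereal r" "ereal r < T (Suc k) \<omega>"
        using interval_exists[of "\<lambda>k. T k \<omega>" "ereal r" n] T_0[OF \<omega>] r by auto
      have "path_of_history ?h r = the (snd (?h k))"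
        using k r by (intro path_of_history_eq[OF h]) (auto simp: partial_history_def)
      moreover have "ereal r < ereal s"
        using True s(1) by (rule less_trans)
      ultimately show ?thesis
        using k r mark[of k] signal_eq[OF \<omega> k(2,3)] by (simp add: left_stopped_path_def)
    next
      case False
      then have "path_of_history ?h r = the (snd (?h n))"
        using r by (intro path_of_history_eq[OF h]) (auto simp: partial_history_def)
      moreover have "X r \<omega> = \<zeta> n \<omega>" if "r < s"
      proof (rule signal_eq[OF \<omega>])
        have "ereal r < ereal s"
          using that by simp
        then show "ereal r < T (Suc n) \<omega>"
          using s(2) by (rule order.strict_trans2)
      qed (use False in simp)
      ultimately show ?thesis
        using r mark[of n] left_lim_signal[OF \<omega> n] by (simp add: left_stopped_path_def)
    qed
  qed (simp add: left_stopped_path_def path_of_history_def)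
qed

lemma left_stopped_path_in_skorokhod_paths:
  "\<omega> \<in> space M \<Longrightarrow> between_jumps n \<omega> s \<Longrightarrow> left_stopped_path X s \<omega> \<in> skorokhod_paths"
  unfolding left_stopped_path_eq
  by (intro path_of_history_in_skorokhod_paths partial_history_in_history_set between_jumps_finite)

lemma update_partial_history:
  assumes \<omega>: "\<omega> \<in> space M" and n: "between_jumps n \<omega> s"
  shows "update_history (partial_history T X n \<omega>) s e = (partial_history T X n \<omega>)(Suc n := (ereal s, Some e))"
proof -
  have less_iff: "fst (partial_history T X n \<omega> k) < ereal s \<longleftrightarrow> k \<le> n" for k
  proof (cases "k \<le> n")
    case True
    have "T k \<omega> < ereal s"
      using order.strict_trans1[OF monoD[OF T_mono[OF \<omega>] True]] n by (simp add: between_jumps_def)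
    with True show ?thesis
      by (simp add: partial_history_def)
  qed (simp add: partial_history_def)
  have "{k. 1 \<le> k \<and> fst (partial_history T X n \<omega> k) < ereal s} = {1..n}"
    by (simp only: less_iff) auto
  moreover have "Sup (enat ` {1..n}) = enat n"
  proof (rule antisym)
    show "Sup (enat ` {1..n}) \<le> enat n"
      by (rule Sup_least) auto
    show "enat n \<le> Sup (enat ` {1..n})"
      by (cases "n = 0") (auto simp: zero_enat_def[symmetric] intro!: Sup_upper)
  qed
  ultimately show ?thesis
    by (simp add: update_history_def jumps_before_def)
qed

lemma update_partial_history_at_jump:
  assumes \<omega>: "\<omega> \<in> space M" and fin: "T (Suc n) \<omega> < \<infinity>"
  shows "update_history (partial_history T X n \<omega>) (real_of_ereal (T (Suc n) \<omega>))
      (X (real_of_ereal (T (Suc n) \<omega>)) \<omega>) = partial_history T X (Suc n) \<omega>"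
  unfolding update_partial_history[OF \<omega> between_jumps_at_jump[OF \<omega> fin]]
  using T_real[OF \<omega> fin] by (auto simp: partial_history_def)


section \<open>The history after one more jump\<close>

text \<open>The history that a jump to \<open>e\<close> at time \<open>s\<close> would produce, as a function of the trajectory,
  \<open>s\<close> and \<open>e\<close>. Beyond the limit of the jump times its value is an arbitrary fixed history.\<close>

definition next_history :: "('w \<times> real) \<times> 'e \<Rightarrow> 'e history" where
  "next_history = (\<lambda>((\<omega>, s), e).
     if \<exists>n. between_jumps n \<omega> s
     then update_history (partial_history T X (THE n. between_jumps n \<omega> s) \<omega>) s e
     else finite_history 0 (\<lambda>_. (0, undefined)))"

lemma next_history_eq:
  assumes \<omega>: "\<omega> \<in> space M" and n: "between_jumps n \<omega> s"
  shows "next_history ((\<omega>, s), e) = update_history (partial_history T X n \<omega>) s e"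
proof -
  have "(THE n. between_jumps n \<omega> s) = n"
    using n between_jumps_unique[OF \<omega>] by (intro the_equality) auto
  with n show ?thesis
    by (auto simp: next_history_def)
qed

text \<open>At the actual jumps of the signal this is the actual next history: the jump measure of the
  history process is the image of that of the signal.\<close>

lemma next_history_at_jump:
  assumes \<omega>: "\<omega> \<in> space M" and "1 \<le> k" and fin: "T k \<omega> < \<infinity>"
  shows "next_history ((\<omega>, real_of_ereal (T k \<omega>)), X (real_of_ereal (T k \<omega>)) \<omega>) = partial_history T X k \<omega>"
  using assms(2) next_history_eq[OF \<omega> between_jumps_at_jump[OF \<omega>]] fin
    update_partial_history_at_jump[OF \<omega>]
  by (cases k) auto

text \<open>The coordinates of the next history, as a sequence to which \<open>finite_history\<close> applies.\<close>

definition appended_marks :: "nat \<Rightarrow> ('w \<times> real) \<times> 'e \<Rightarrow> nat \<Rightarrow> real \<times> 'e" where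
  "appended_marks n x k = (if k \<le> n then jump_marks (fst (fst x)) k else (snd (fst x), snd x))"

lemma next_history_eq_finite_history:
  assumes \<omega>: "\<omega> \<in> space M" and n: "between_jumps n \<omega> s"
  shows "next_history ((\<omega>, s), e) = finite_history (Suc n) (appended_marks n ((\<omega>, s), e))"
proof -
  have "next_history ((\<omega>, s), e) = (finite_history n (jump_marks \<omega>))(Suc n := (ereal s, Some e))"
    by (simp only: next_history_eq[OF assms] update_partial_history[OF assms])
       (simp only: partial_history_eq[OF \<omega> between_jumps_finite[OF n]])
  then show ?thesis
    by (auto simp: finite_history_def appended_marks_def fun_eq_iff)
qed

lemma appended_marks_increasing:
  assumes \<omega>: "\<omega> \<in> space M" and n: "between_jumps n \<omega> s"
  shows "appended_marks n ((\<omega>, s), e) \<in> increasing_times (Suc n)"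
proof -
  have "ereal (real_of_ereal (T n \<omega>)) < ereal s"
    using n T_real[OF \<omega> between_jumps_finite[OF n]] by (simp add: between_jumps_def)
  then have "fst (jump_marks \<omega> n) < s"
    by (simp add: jump_marks_def)
  then show ?thesis
    using jump_marks_increasing[OF \<omega> between_jumps_finite[OF n]]
    by (auto simp: increasing_times_def appended_marks_def less_Suc_eq)
qed

lemma stopping: "ext_stopping_time M F (T k)"
proof (cases "k = 0")
  case True
  have "{\<omega> \<in> space M. T k \<omega> \<le> ereal t} = space M" if "0 \<le> t" for t
    using T_0 True that by auto
  then show ?thesis
    using usual_filtrationD(1)[OF usual] sets.top by (metis ext_stopping_time_def)
qed (simp add: T_stopping)

lemma measurable_jump_marks:
  assumes k: "k \<le> n"
  shows "(\<lambda>x. jump_marks (fst x) k) \<in>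
    borel_measurable (restrict_space (predictable M F) {x \<in> space M \<times> UNIV. between_jumps n (fst x) (snd x)})"
    (is "_ \<in> borel_measurable ?R")
proof -
  have sub: "{x \<in> space M \<times> UNIV. between_jumps n (fst x) (snd x)} \<subseteq> {x. T k (fst x) < ereal (snd x)}"
    using order.strict_trans1[OF monoD[OF T_mono k]] by (auto simp: between_jumps_def)
  have "T k \<in> borel_measurable (stopped_algebra M F (T k))"
    using T_nonneg by (intro ext_stopping_time_measurable[OF usual stopping])
  then have "(\<lambda>\<omega>. real_of_ereal (T k \<omega>)) \<in> borel_measurable (stopped_algebra M F (T k))"
    by measurable
  from measurable_after_stopping[OF usual stopping this sub]
    measurable_after_stopping[OF usual stopping mark_measurable sub]
  show ?thesis
    unfolding jump_marks_def borel_prod[symmetric] by (rule measurable_Pair)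
qed

lemma predictable_between_jumps:
  "{x \<in> space M \<times> UNIV. between_jumps n (fst x) (snd x)} \<in> sets (predictable M F)"
proof -
  have sp: "space M \<in> sets (stopped_algebra M F (T k))" for k
    using sets.top[of "stopped_algebra M F (T k)"] by simp
  have "{x \<in> space M \<times> UNIV. between_jumps n (fst x) (snd x)} =
      {x \<in> space M \<times> {0<..}. T n (fst x) < ereal (snd x)} -
      {x \<in> space M \<times> {0<..}. T (Suc n) (fst x) < ereal (snd x)}"
    using between_jumps_pos[of _ n] by (fastforce simp: between_jumps_def)
  then show ?thesis
    using predictable_after_stopping[OF usual stopping sp] by simp
qed

text \<open>Between \<open>T n\<close> and \<open>T (Suc n)\<close> the next history has \<open>n + 1\<close> jumps: the first \<open>n\<close> belong to the past
  of \<open>T n\<close>, which is predictable there, and the last one is \<open>(s, e)\<close>. The countably many pieces are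
  then put together.\<close>

lemma measurable_next_history:
  "next_history \<in> predictable M F \<Otimes>\<^sub>M borel \<rightarrow>\<^sub>M history_borel"
proof -
  let ?P = "\<lambda>n. {x \<in> space M \<times> UNIV. between_jumps n (fst x) (snd x)}"
  let ?D = "(space M \<times> {0<..}) - (\<Union>n. ?P n)"
  let ?S = "predictable M F \<Otimes>\<^sub>M (borel :: 'e measure)"
  have D: "?D \<in> sets (predictable M F)"
    using predictable_between_jumps sets.compl_sets[of "\<Union>n. ?P n" "predictable M F"]
    by (auto simp: space_predictable[OF usual])
  show ?thesis
  proof (rule measurable_piecewise_restrict)
    show "countable (insert (?D \<times> UNIV) (range (\<lambda>n. ?P n \<times> UNIV)))"
      by simp
    fix \<Omega> assume \<Omega>: "\<Omega> \<in> insert (?D \<times> UNIV) (range (\<lambda>n. ?P n \<times> (UNIV :: 'e set)))"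
    have "\<Omega> \<in> sets ?S"
      using \<Omega> D predictable_between_jumps by auto
    then show "\<Omega> \<inter> space ?S \<in> sets ?S"
      by auto
    show "next_history \<in> restrict_space ?S \<Omega> \<rightarrow>\<^sub>M history_borel"
    proof (cases "\<Omega> = ?D \<times> UNIV")
      case True
      have "next_history x = finite_history 0 (\<lambda>_. (0, undefined))" if "x \<in> \<Omega>" for x
        using that True by (cases x) (auto simp: next_history_def)
      then have "next_history \<in> restrict_space ?S \<Omega> \<rightarrow>\<^sub>M history_borel \<longleftrightarrow>
          (\<lambda>_. finite_history 0 (\<lambda>_. (0, undefined))) \<in> restrict_space ?S \<Omega> \<rightarrow>\<^sub>M (history_borel :: 'e history measure)"
        by (intro measurable_cong) (auto simp: space_restrict_space)
      then show ?thesis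
        by (simp add: finite_history_in_history_set increasing_times_def)
    next
      case False
      then obtain n where n: "\<Omega> = ?P n \<times> UNIV"
        using \<Omega> by auto
      have fst: "fst \<in> restrict_space ?S \<Omega> \<rightarrow>\<^sub>M restrict_space (predictable M F) (?P n)"
        by (intro measurable_restrict_space3 measurable_fst) (auto simp: n)
      have "next_history \<in> restrict_space ?S \<Omega> \<rightarrow>\<^sub>M history_borel \<longleftrightarrow>
          (\<lambda>x. finite_history (Suc n) (appended_marks n x)) \<in> restrict_space ?S \<Omega> \<rightarrow>\<^sub>M history_borel"
        by (intro measurable_cong) (auto simp: space_restrict_space n next_history_eq_finite_history)
      also have "\<dots>"
      proof (rule measurable_finite_history)
        fix x assume "x \<in> space (restrict_space ?S \<Omega>)"
        then show "appended_marks n x \<in> increasing_times (Suc n)"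
          by (cases x) (auto simp: space_restrict_space n intro!: appended_marks_increasing)
      next
        fix k
        show "(\<lambda>x. appended_marks n x k) \<in> borel_measurable (restrict_space ?S \<Omega>)"
        proof (cases "k \<le> n")
          case True
          then show ?thesis
            using measurable_compose[OF fst measurable_jump_marks[OF True]]
            by (simp add: appended_marks_def)
        next
          case False
          have "snd \<in> predictable M F \<rightarrow>\<^sub>M borel"
            using measurable_predictable_time[OF usual] by (simp add: measurable_restrict_space2_iff)
          then have "(\<lambda>x. (snd (fst x), snd x)) \<in> ?S \<rightarrow>\<^sub>M borel \<Otimes>\<^sub>M borel"
            by measurable
          then show ?thesis
            using False by (simp add: appended_marks_def borel_prod measurable_restrict_space1)
        qed
      qed
      finally show ?thesis .
    qed
  next
    show "space ?S \<subseteq> \<Union> (insert (?D \<times> UNIV) (range (\<lambda>n. ?P n \<times> UNIV)))"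
      by (auto simp: space_pair_measure space_predictable[OF usual])
  qed
qed

end


section \<open>Measures on the product of time and a mark space\<close>

lemma space_pos_time [simp]: "space pos_time = {0<..}"
  by (simp add: space_restrict_space)

lemma Ioc_in_pos_time [simp]: "0 \<le> s \<Longrightarrow> {s<..t} \<in> sets pos_time"
  by (auto simp: sets_restrict_space_iff)

lemma sets_pos_time: "sets pos_time = sigma_sets {0<..} {{0<..t} | t. 0 < t}"
proof (rule antisym)
  let ?G = "{{0<..t} | t. (0 :: real) < t}"
  have G: "?G \<subseteq> Pow {0<..}"
    by auto
  have "(\<lambda>x. x) \<in> borel_measurable (sigma {0<..} ?G)"
  proof (rule borel_measurableI_le)
    fix a :: real
    have "{x \<in> space (sigma {0<..} ?G). x \<le> a} = (if 0 < a then {0<..a} else {})"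
      using G by (auto simp: space_measure_of)
    moreover have "{0<..a} \<in> sets (sigma {0<..} ?G)" if "0 < a"
      using that by (auto simp: sets_measure_of[OF G])
    ultimately show "{x \<in> space (sigma {0<..} ?G). x \<le> a} \<in> sets (sigma {0<..} ?G)"
      by simp
  qed
  then have "(\<lambda>x. x) \<in> sigma {0<..} ?G \<rightarrow>\<^sub>M pos_time"
    using G by (intro measurable_restrict_space2) (auto simp: space_measure_of)
  from measurable_sets[OF this] show "sets pos_time \<subseteq> sigma_sets {0<..} ?G"
    using sets.sets_into_space[of _ pos_time]
    by (auto simp: sets_measure_of[OF G] space_measure_of[OF G] Int_absorb2)
  show "sigma_sets {0<..} ?G \<subseteq> sets pos_time"
  proof -
    have "?G \<subseteq> sets pos_time"
      by (clarify, rule Ioc_in_pos_time) simp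
    from sets.sigma_sets_subset[OF this] show ?thesis
      by simp
  qed
qed

lemma sets_pos_time_pair:
  "sets (pos_time \<Otimes>\<^sub>M S) =
    sigma_sets ({0<..} \<times> space S) {{0<..t} \<times> B | t B. 0 < t \<and> B \<in> sets S}"
proof -
  let ?G = "{{0<..t} | t. (0 :: real) < t}"
  have "sets (pos_time \<Otimes>\<^sub>M S) =
      sets (sigma (space pos_time \<times> space S) {a \<times> b | a b. a \<in> ?G \<and> b \<in> sets S})"
  proof (rule sets_pair_eq)
    show "?G \<subseteq> Pow (space pos_time)" "sets pos_time = sigma_sets (space pos_time) ?G"
      by (auto simp: sets_pos_time)
    show "countable (range (\<lambda>n. {0<..real (Suc n)}))" "range (\<lambda>n. {0<..real (Suc n)}) \<subseteq> ?G"
      by (auto simp del: of_nat_Suc)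
    show "\<Union> (range (\<lambda>n. {0<..real (Suc n)})) = space pos_time"
    proof (intro set_eqI iffI)
      fix x :: real assume "x \<in> space pos_time"
      moreover obtain n where "x \<le> real n"
        using real_arch_simple by blast
      ultimately show "x \<in> \<Union> (range (\<lambda>n. {0<..real (Suc n)}))"
        by (auto intro!: exI[of _ n])
    qed auto
    show "sets S \<subseteq> Pow (space S)" "sets S = sigma_sets (space S) (sets S)" "countable {space S}"
      "{space S} \<subseteq> sets S" "\<Union> {space S} = space S"
      by (auto simp: sets.sigma_sets_eq sets.space_closed)
  qed
  also have "{a \<times> b | a b. a \<in> ?G \<and> b \<in> sets S} = {{0<..t} \<times> B | t B. 0 < t \<and> B \<in> sets S}"
    by blast
  also have "sets (sigma (space pos_time \<times> space S) {{0<..t} \<times> B | t B. 0 < t \<and> B \<in> sets S}) =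
      sigma_sets ({0<..} \<times> space S) {{0<..t} \<times> B | t B. 0 < t \<and> B \<in> sets S}"
    unfolding space_pos_time by (rule sets_measure_of) (auto dest: sets.sets_into_space)
  finally show ?thesis .
qed

lemma time_mark_measure_eqI:
  fixes S :: "'s measure"
  assumes sets: "sets N = sets (pos_time \<Otimes>\<^sub>M S)" "sets N' = sets (pos_time \<Otimes>\<^sub>M S)"
    and eq: "\<And>t B. 0 < t \<Longrightarrow> B \<in> sets S \<Longrightarrow> emeasure N ({0<..t} \<times> B) = emeasure N' ({0<..t} \<times> B)"
    and fin: "\<And>t. 0 < t \<Longrightarrow> emeasure N ({0<..t} \<times> space S) < \<infinity>"
  shows "N = N'"
proof (rule measure_eqI_generator_eq)
  let ?E = "{{0<..t} \<times> B | (t :: real) B. 0 < t \<and> B \<in> sets S}"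
  show "Int_stable ?E"
  proof (rule Int_stableI)
    fix a b :: "(real \<times> 's) set" assume "a \<in> ?E" "b \<in> ?E"
    then obtain t t' :: real and B B' where "a = {0<..t} \<times> B" "b = {0<..t'} \<times> B'" "0 < t" "0 < t'"
      "B \<in> sets S" "B' \<in> sets S"
      by blast
    then have "a \<inter> b = {0<..min t t'} \<times> (B \<inter> B') \<and> 0 < min t t' \<and> B \<inter> B' \<in> sets S"
      by auto
    then show "a \<inter> b \<in> ?E"
      by blast
  qed
  show "?E \<subseteq> Pow ({0<..} \<times> space S)"
    by (auto dest: sets.sets_into_space)
  show "sets N = sigma_sets ({0<..} \<times> space S) ?E" "sets N' = sigma_sets ({0<..} \<times> space S) ?E"
    using sets by (simp_all only: sets_pos_time_pair)
  show "emeasure N A = emeasure N' A" if "A \<in> ?E" for A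
    using that eq by blast
  show "range (\<lambda>n. {0<..real (Suc n)} \<times> space S) \<subseteq> ?E"
  proof clarify
    fix n
    have "0 < real (Suc n)"
      by simp
    then show "\<exists>t B. {0<..real (Suc n)} \<times> space S = {0<..t} \<times> B \<and> 0 < t \<and> B \<in> sets S"
      by blast
  qed
  show "(\<Union>n. {0<..real (Suc n)} \<times> space S) = {0<..} \<times> space S"
  proof (intro set_eqI iffI)
    fix x :: "real \<times> 's" assume "x \<in> {0<..} \<times> space S"
    moreover obtain n where "fst x \<le> real n"
      using real_arch_simple by blast
    ultimately show "x \<in> (\<Union>n. {0<..real (Suc n)} \<times> space S)"
      by (auto intro!: exI[of _ n])
  qed auto
  show "emeasure N ({0<..real (Suc n)} \<times> space S) \<noteq> \<infinity>" for n
    using fin[of "real (Suc n)"] by (simp del: of_nat_Suc)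
qed

text \<open>The base measures of interest, Lebesgue measure and \<open>dp\<close>, need not be finite; the Giry bind of
  such a measure with a probability kernel still is the measure that integrates the kernel.\<close>

lemma kernel_measure_exists:
  assumes \<kappa>: "\<kappa> \<in> A \<rightarrow>\<^sub>M prob_algebra S" and \<nu>: "sets \<nu> = sets A" and ne: "space A \<noteq> {}"
  obtains P where "sets P = sets (A \<Otimes>\<^sub>M S)"
    and "\<And>C. C \<in> sets (A \<Otimes>\<^sub>M S) \<Longrightarrow> emeasure P C = (\<integral>\<^sup>+s. emeasure (\<kappa> s) (Pair s -` C) \<partial>\<nu>)"
proof
  let ?k = "\<lambda>s. distr (\<kappa> s) (A \<Otimes>\<^sub>M S) (Pair s)"
  have k: "?k \<in> A \<rightarrow>\<^sub>M subprob_algebra (A \<Otimes>\<^sub>M S)"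
    using measurable_prob_algebraD[OF \<kappa>] by (intro measurable_distr2) simp_all
  then have k': "?k \<in> \<nu> \<rightarrow>\<^sub>M subprob_algebra (A \<Otimes>\<^sub>M S)"
    using measurable_cong_sets[OF \<nu> refl] by blast
  have ne': "space \<nu> \<noteq> {}"
    using ne sets_eq_imp_space_eq[OF \<nu>] by simp
  show "sets (\<nu> \<bind> ?k) = sets (A \<Otimes>\<^sub>M S)"
    using ne' by (intro sets_bind) auto
  fix C assume C: "C \<in> sets (A \<Otimes>\<^sub>M S)"
  have "emeasure (\<nu> \<bind> ?k) C = (\<integral>\<^sup>+s. emeasure (?k s) C \<partial>\<nu>)"
    using ne' k' C by (rule emeasure_bind)
  also have "\<dots> = (\<integral>\<^sup>+s. emeasure (\<kappa> s) (Pair s -` C) \<partial>\<nu>)"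
  proof (rule nn_integral_cong)
    fix s assume "s \<in> space \<nu>"
    then have s: "s \<in> space A"
      using sets_eq_imp_space_eq[OF \<nu>] by simp
    have sets_\<kappa>: "sets (\<kappa> s) = sets S"
      using measurable_space[OF \<kappa> s] by (simp add: space_prob_algebra)
    have "Pair s \<in> \<kappa> s \<rightarrow>\<^sub>M A \<Otimes>\<^sub>M S"
      unfolding measurable_cong_sets[OF sets_\<kappa> refl] using s by (rule measurable_Pair1')
    then have "emeasure (?k s) C = emeasure (\<kappa> s) (Pair s -` C \<inter> space (\<kappa> s))"
      using C by (rule emeasure_distr)
    also have "Pair s -` C \<inter> space (\<kappa> s) = Pair s -` C"
      using sets.sets_into_space[OF C] sets_eq_imp_space_eq[OF sets_\<kappa>] by (auto simp: space_pair_measure)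
    finally show "emeasure (?k s) C = emeasure (\<kappa> s) (Pair s -` C)" .
  qed
  finally show "emeasure (\<nu> \<bind> ?k) C = (\<integral>\<^sup>+s. emeasure (\<kappa> s) (Pair s -` C) \<partial>\<nu>)" .
qed

lemma measure_sum_exists:
  assumes "sets N' = sets N"
  obtains P where "sets P = sets N" "\<And>C. C \<in> sets N \<Longrightarrow> emeasure P C = emeasure N C + emeasure N' C"
proof
  let ?P = "measure_of (space N) (sets N) (\<lambda>C. emeasure N C + emeasure N' C)"
  show "sets ?P = sets N"
    by simp
  show "emeasure ?P C = emeasure N C + emeasure N' C" if "C \<in> sets N" for C
  proof (rule emeasure_measure_of_sigma[OF _ _ _ that])
    show "sigma_algebra (space N) (sets N)" ..
    show "positive (sets N) (\<lambda>C. emeasure N C + emeasure N' C)"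
      by (simp add: positive_def)
    show "countably_additive (sets N) (\<lambda>C. emeasure N C + emeasure N' C)"
    proof (rule countably_additiveI)
      fix A :: "nat \<Rightarrow> 'a set" assume "range A \<subseteq> sets N" "disjoint_family A"
      then show "(\<Sum>i. emeasure N (A i) + emeasure N' (A i)) = emeasure N (\<Union>(range A)) + emeasure N' (\<Union>(range A))"
        using assms by (subst suminf_add[symmetric]) (auto simp: suminf_emeasure)
    qed
  qed
qed

text \<open>A disintegration that is known on the rectangles that start at time \<open>0\<close> holds for all
  measurable sets.\<close>

lemma disintegration_of_rectangles:
  assumes N: "sets N = sets (pos_time \<Otimes>\<^sub>M S)"
    and \<kappa>: "\<kappa> \<in> pos_time \<rightarrow>\<^sub>M prob_algebra S" "\<kappa>' \<in> pos_time \<rightarrow>\<^sub>M prob_algebra S"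
    and \<nu>: "sets \<nu> = sets pos_time" "sets \<nu>' = sets pos_time"
    and rect: "\<And>t B. 0 < t \<Longrightarrow> B \<in> sets S \<Longrightarrow> emeasure N ({0<..t} \<times> B) =
      (\<integral>\<^sup>+s\<in>{0<..t}. emeasure (\<kappa> s) B \<partial>\<nu>) + (\<integral>\<^sup>+s\<in>{0<..t}. emeasure (\<kappa>' s) B \<partial>\<nu>')"
    and fin: "\<And>t. 0 < t \<Longrightarrow> emeasure N ({0<..t} \<times> space S) < \<infinity>"
    and C: "C \<in> sets (pos_time \<Otimes>\<^sub>M S)"
  shows "emeasure N C =
    (\<integral>\<^sup>+s. emeasure (\<kappa> s) (Pair s -` C) \<partial>\<nu>) + (\<integral>\<^sup>+s. emeasure (\<kappa>' s) (Pair s -` C) \<partial>\<nu>')"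
proof -
  have ne: "space pos_time \<noteq> {}"
    by auto
  obtain P where P: "sets P = sets (pos_time \<Otimes>\<^sub>M S)"
    "\<And>C. C \<in> sets (pos_time \<Otimes>\<^sub>M S) \<Longrightarrow> emeasure P C = (\<integral>\<^sup>+s. emeasure (\<kappa> s) (Pair s -` C) \<partial>\<nu>)"
    using kernel_measure_exists[OF \<kappa>(1) \<nu>(1) ne] by blast
  obtain P' where P': "sets P' = sets (pos_time \<Otimes>\<^sub>M S)"
    "\<And>C. C \<in> sets (pos_time \<Otimes>\<^sub>M S) \<Longrightarrow> emeasure P' C = (\<integral>\<^sup>+s. emeasure (\<kappa>' s) (Pair s -` C) \<partial>\<nu>')"
    using kernel_measure_exists[OF \<kappa>(2) \<nu>(2) ne] by blast
  obtain R where R: "sets R = sets P" "\<And>C. C \<in> sets P \<Longrightarrow> emeasure R C = emeasure P C + emeasure P' C"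
  proof (rule measure_sum_exists)
    show "sets P' = sets P"
      using P(1) P'(1) by simp
  qed blast
  have R_eq: "emeasure R C =
      (\<integral>\<^sup>+s. emeasure (\<kappa> s) (Pair s -` C) \<partial>\<nu>) + (\<integral>\<^sup>+s. emeasure (\<kappa>' s) (Pair s -` C) \<partial>\<nu>')"
    if "C \<in> sets (pos_time \<Otimes>\<^sub>M S)" for C
    using that R(2) P P'(2) by simp
  have "N = R"
  proof (rule time_mark_measure_eqI[OF N])
    show "sets R = sets (pos_time \<Otimes>\<^sub>M S)"
      using R(1) P(1) by simp
    fix t :: real and B assume t: "0 < t" and B: "B \<in> sets S"
    then have "{0<..t} \<times> B \<in> sets (pos_time \<Otimes>\<^sub>M S)"
      by (intro pair_measureI) auto
    moreover have "emeasure (k s) (Pair s -` ({0<..t} \<times> B)) = emeasure (k s) B * indicator {0<..t} s"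
      for k :: "real \<Rightarrow> 'a measure" and s
      by (auto simp: indicator_def)
    ultimately show "emeasure N ({0<..t} \<times> B) = emeasure R ({0<..t} \<times> B)"
      using rect[OF t B] R_eq by simp
  qed (rule fin)
  then show ?thesis
    using R_eq[OF C] by simp
qed

lemma nn_integral_marked_counting_measure:
  assumes pos: "\<And>k. 1 \<le> k \<Longrightarrow> 0 < \<tau> k \<omega>"
    and mark: "\<And>k. 1 \<le> k \<Longrightarrow> \<tau> k \<omega> < \<infinity> \<Longrightarrow> x k \<omega> \<in> space S"
    and f: "f \<in> borel_measurable (pos_time \<Otimes>\<^sub>M S)"
  shows "(\<integral>\<^sup>+y. f y \<partial>marked_counting_measure S \<tau> x \<omega>) =
    (\<integral>\<^sup>+k. f (real_of_ereal (\<tau> k \<omega>), x k \<omega>) \<partial>count_space {k. 1 \<le> k \<and> \<tau> k \<omega> < \<infinity>})"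
  unfolding marked_counting_measure_def
proof (subst nn_integral_distr)
  have "0 < real_of_ereal (\<tau> k \<omega>)" if "1 \<le> k" "\<tau> k \<omega> < \<infinity>" for k
    using pos[OF that(1)] that(2) by (cases "\<tau> k \<omega>") auto
  then show "(\<lambda>k. (real_of_ereal (\<tau> k \<omega>), x k \<omega>)) \<in>
      count_space {k. 1 \<le> k \<and> \<tau> k \<omega> < \<infinity>} \<rightarrow>\<^sub>M pos_time \<Otimes>\<^sub>M S"
    using mark by (auto simp: space_pair_measure)
qed (use f in simp_all)


section \<open>Compensators and explosion\<close>

lemma sets_stieltjes [simp]: "sets (stieltjes p \<omega>) = sets borel"
  by (simp add: stieltjes_def)

lemma emeasure_stieltjes_Ioc:
  assumes p: "counting_process M p" and \<omega>: "\<omega> \<in> space M" and t: "0 \<le> t"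
  shows "emeasure (stieltjes p \<omega>) {0<..t} = ennreal (p t \<omega>)"
proof -
  let ?f = "\<lambda>s. p (max 0 s) \<omega>"
  have p0: "p 0 \<omega> = 0" and mono: "mono_on {0..} (\<lambda>t. p t \<omega>)" and cad: "cadlag (\<lambda>t. p t \<omega>)"
    using p \<omega> unfolding counting_process_def by blast+
  have "?f x \<le> ?f y" if "x \<le> y" for x y
    using mono that by (auto simp: mono_on_def)
  moreover have "continuous (at_right a) ?f" for a
  proof (cases "0 \<le> a")
    case True
    then have "((\<lambda>t. p t \<omega>) \<longlongrightarrow> p a \<omega>) (at_right a)"
      using cad by (simp add: cadlag_def)
    moreover have "\<forall>\<^sub>F r in at_right a. p r \<omega> = ?f r"
      using eventually_at_right_less[of a] by eventually_elim (use True in simp)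
    ultimately have "(?f \<longlongrightarrow> p a \<omega>) (at_right a)"
      by (rule Lim_transform_eventually)
    then show ?thesis
      using True by (simp add: continuous_within)
  next
    case False
    then have "\<forall>\<^sub>F r in at_right a. ?f r = p 0 \<omega>"
      using eventually_at_right_real[of a 0] by (auto elim!: eventually_mono)
    then show ?thesis
      using False by (simp add: continuous_within tendsto_eventually)
  qed
  ultimately have "emeasure (interval_measure ?f) {0<..t} = ennreal (?f t - ?f 0)"
    using t by (intro emeasure_interval_measure_Ioc)
  then show ?thesis
    using t p0 by (simp add: stieltjes_def)
qed

locale compensated_signal = jump_signal M F T \<zeta>
  for M :: "'w measure" and F and T and \<zeta> :: "nat \<Rightarrow> 'w \<Rightarrow> 'e::polish_space" +
  fixes \<mu> :: "'w \<Rightarrow> (real \<times> 'e) measure"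
    and Q R :: "real \<times> (real \<Rightarrow> 'e) \<Rightarrow> 'e measure"
    and rate :: "real \<times> (real \<Rightarrow> 'e) \<Rightarrow> real"
    and p :: "real \<Rightarrow> 'w \<Rightarrow> real"
  assumes prob: "prob_space M"
    and projection: "dual_predictable_projection M F borel \<mu> (signal_jump_measure T (signal T \<zeta>))"
    and Q: "Q \<in> pos_time \<Otimes>\<^sub>M skorokhod_borel \<rightarrow>\<^sub>M prob_algebra borel"
    and R: "R \<in> pos_time \<Otimes>\<^sub>M skorokhod_borel \<rightarrow>\<^sub>M prob_algebra borel"
    and rate: "bounded_rate (pos_time \<Otimes>\<^sub>M skorokhod_borel) rate"
    and counting: "counting_process M p"
    and p_integrable: "0 \<le> t \<Longrightarrow> (\<integral>\<^sup>+\<omega>. ennreal (p t \<omega>) \<partial>M) < \<infinity>"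
    and compensator: "AE \<omega> in M. \<forall>t>0. \<forall>A\<in>sets borel.
      emeasure (\<mu> \<omega>) ({0<..t} \<times> A) =
        (\<integral>\<^sup>+s\<in>{0<..t}. emeasure (Q (s, left_stopped_path (signal T \<zeta>) s \<omega>)) A *
           ennreal (rate (s, left_stopped_path (signal T \<zeta>) s \<omega>)) \<partial>lborel) +
        (\<integral>\<^sup>+s\<in>{0<..t}. emeasure (R (s, left_stopped_path (signal T \<zeta>) s \<omega>)) A \<partial>stieltjes p \<omega>)"
begin

abbreviation past :: "'w \<Rightarrow> real \<Rightarrow> real \<Rightarrow> 'e" where
  "past \<omega> s \<equiv> left_stopped_path X s \<omega>"

definition compensated_at :: "'w \<Rightarrow> bool" where
  "compensated_at \<omega> \<longleftrightarrow> (\<forall>t>0. \<forall>A\<in>sets borel. emeasure (\<mu> \<omega>) ({0<..t} \<times> A) =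
     (\<integral>\<^sup>+s\<in>{0<..t}. emeasure (Q (s, past \<omega> s)) A * ennreal (rate (s, past \<omega> s)) \<partial>lborel) +
     (\<integral>\<^sup>+s\<in>{0<..t}. emeasure (R (s, past \<omega> s)) A \<partial>stieltjes p \<omega>))"

lemma AE_compensated: "AE \<omega> in M. compensated_at \<omega>"
  using compensator by (simp add: compensated_at_def)

lemma sets_compensator: "\<omega> \<in> space M \<Longrightarrow> sets (\<mu> \<omega>) = sets (pos_time \<Otimes>\<^sub>M borel)"
  using projection
  by (simp add: dual_predictable_projection_def predictable_random_measure_def random_measure_def)

lemma past_in_space:
  assumes "\<omega> \<in> space M" "0 < s" "ereal s \<le> T k \<omega>"
  shows "(s, past \<omega> s) \<in> space (pos_time \<Otimes>\<^sub>M skorokhod_borel)"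
proof -
  obtain n where "between_jumps n \<omega> s"
    using between_jumps_exists[OF assms] by metis
  then show ?thesis
    using left_stopped_path_in_skorokhod_paths[OF assms(1)] assms(2) by (simp add: space_pair_measure)
qed

definition rate_bound :: real where
  "rate_bound = (SOME c. 0 \<le> c \<and> (\<forall>a\<in>space (pos_time \<Otimes>\<^sub>M skorokhod_borel). 0 \<le> rate a \<and> rate a \<le> c))"

lemma rate_bound:
  "0 \<le> rate_bound" "a \<in> space (pos_time \<Otimes>\<^sub>M skorokhod_borel) \<Longrightarrow> rate a \<le> rate_bound"
proof -
  obtain c where "\<forall>a\<in>space (pos_time \<Otimes>\<^sub>M skorokhod_borel). 0 \<le> rate a \<and> rate a \<le> c"
    using rate unfolding bounded_rate_def by blast
  then have "\<exists>c. 0 \<le> c \<and> (\<forall>a\<in>space (pos_time \<Otimes>\<^sub>M skorokhod_borel). 0 \<le> rate a \<and> rate a \<le> c)"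
    by (intro exI[of _ "max 0 c"]) auto
  from someI_ex[OF this]
  show "0 \<le> rate_bound" "a \<in> space (pos_time \<Otimes>\<^sub>M skorokhod_borel) \<Longrightarrow> rate a \<le> rate_bound"
    unfolding rate_bound_def by blast+
qed

text \<open>Up to an explosion time the past of the signal is a right-continuous path with left limits,
  hence an argument for which the rate is bounded and the kernels are probability measures.\<close>

lemma compensator_bound:
  assumes \<omega>: "\<omega> \<in> space M" and c: "compensated_at \<omega>" and u: "0 < u" "ereal u \<le> T k \<omega>"
  shows "emeasure (\<mu> \<omega>) ({0<..u} \<times> UNIV) \<le> ennreal (rate_bound * u) + ennreal (p u \<omega>)"
proof -
  have sp: "(s, past \<omega> s) \<in> space (pos_time \<Otimes>\<^sub>M skorokhod_borel)" if "s \<in> {0<..u}" for s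
  proof (rule past_in_space[OF \<omega>])
    have "ereal s \<le> ereal u"
      using that by simp
    then show "ereal s \<le> T k \<omega>"
      using u(2) by (rule order.trans)
  qed (use that in simp)
  have le1: "emeasure (K (s, past \<omega> s)) UNIV \<le> 1"
    if "s \<in> {0<..u}" and K: "K \<in> pos_time \<Otimes>\<^sub>M skorokhod_borel \<rightarrow>\<^sub>M prob_algebra borel" for s and K :: "_ \<Rightarrow> 'e measure"
  proof -
    have "prob_space (K (s, past \<omega> s))"
      using measurable_space[OF K sp[OF that(1)]] by (simp add: space_prob_algebra)
    then show ?thesis
      using prob_space.measure_le_1 prob_space.emeasure_le_1 by blast
  qed
  have "(\<integral>\<^sup>+s\<in>{0<..u}. emeasure (Q (s, past \<omega> s)) UNIV * ennreal (rate (s, past \<omega> s)) \<partial>lborel)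
      \<le> (\<integral>\<^sup>+s. ennreal rate_bound * indicator {0<..u} s \<partial>lborel)"
  proof (rule nn_integral_mono)
    fix s
    show "emeasure (Q (s, past \<omega> s)) UNIV * ennreal (rate (s, past \<omega> s)) * indicator {0<..u} s
        \<le> ennreal rate_bound * indicator {0<..u} s"
    proof (cases "s \<in> {0<..u}")
      case True
      have "emeasure (Q (s, past \<omega> s)) UNIV * ennreal (rate (s, past \<omega> s)) \<le> 1 * ennreal rate_bound"
        using le1[OF True Q] rate_bound(2)[OF sp[OF True]] by (intro mult_mono ennreal_leI) auto
      with True show ?thesis by simp
    qed simp
  qed
  also have "\<dots> = ennreal (rate_bound * u)"
    using u rate_bound(1) by (subst nn_integral_cmult_indicator) (auto simp: ennreal_mult)
  finally have 1: "(\<integral>\<^sup>+s\<in>{0<..u}. emeasure (Q (s, past \<omega> s)) UNIV * ennreal (rate (s, past \<omega> s)) \<partial>lborel)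
      \<le> ennreal (rate_bound * u)" .
  have "(\<integral>\<^sup>+s\<in>{0<..u}. emeasure (R (s, past \<omega> s)) UNIV \<partial>stieltjes p \<omega>)
      \<le> (\<integral>\<^sup>+s. 1 * indicator {0<..u} s \<partial>stieltjes p \<omega>)"
  proof (rule nn_integral_mono)
    fix s
    show "emeasure (R (s, past \<omega> s)) UNIV * indicator {0<..u} s \<le> 1 * indicator {0<..u} s"
      using le1[OF _ R, of s] by (cases "s \<in> {0<..u}") auto
  qed
  also have "\<dots> = ennreal (p u \<omega>)"
    using u emeasure_stieltjes_Ioc[OF counting \<omega>, of u] by (subst nn_integral_cmult_indicator) auto
  finally have 2: "(\<integral>\<^sup>+s\<in>{0<..u}. emeasure (R (s, past \<omega> s)) UNIV \<partial>stieltjes p \<omega>) \<le> ennreal (p u \<omega>)" .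
  have "emeasure (\<mu> \<omega>) ({0<..u} \<times> UNIV) =
     (\<integral>\<^sup>+s\<in>{0<..u}. emeasure (Q (s, past \<omega> s)) UNIV * ennreal (rate (s, past \<omega> s)) \<partial>lborel) +
     (\<integral>\<^sup>+s\<in>{0<..u}. emeasure (R (s, past \<omega> s)) UNIV \<partial>stieltjes p \<omega>)"
    using c u(1) by (simp add: compensated_at_def)
  with add_mono[OF 1 2] show ?thesis
    by simp
qed

lemma p_mono: "\<omega> \<in> space M \<Longrightarrow> 0 \<le> s \<Longrightarrow> s \<le> t \<Longrightarrow> p s \<omega> \<le> p t \<omega>"
  using counting by (auto simp: counting_process_def mono_on_def)

definition before_jump :: "nat \<Rightarrow> real \<Rightarrow> ('w \<times> real) set" where
  "before_jump n t = {x \<in> space M \<times> {0<..t}. ereal (snd x) \<le> T n (fst x)}"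

lemma predictable_before_jump:
  assumes "0 < t"
  shows "before_jump n t \<in> sets (predictable M F)"
proof -
  have sp: "space M \<in> sets (stopped_algebra M F (T n))" "space M \<in> sets (F 0)"
    using sets.top[of "stopped_algebra M F (T n)"] sets.top[of "F 0"] usual_filtrationD(1)[OF usual, of 0]
    by simp_all
  have "before_jump n t = space M \<times> {0<..t} - {x \<in> space M \<times> {0<..}. T n (fst x) < ereal (snd x)}"
    by (auto simp: before_jump_def)
  also have "\<dots> \<in> sets (predictable M F)"
    using predictable_rectangle[OF usual _ assms sp(2)] predictable_after_stopping[OF usual stopping sp(1)]
    by (intro sets.Diff) simp_all
  finally show ?thesis .
qed

lemma section_before_jump:
  assumes \<omega>: "\<omega> \<in> space M" and "1 \<le> n" "0 < t"
  obtains u where "0 < u" "u \<le> t" "ereal u \<le> T n \<omega>" "\<And>s. (\<omega>, s) \<in> before_jump n t \<longleftrightarrow> s \<in> {0<..u}"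
proof -
  have "0 < T n \<omega>"
    using T_pos[OF \<omega> assms(2)] by simp
  then show thesis
    using that[of t] that[of "min t (real_of_ereal (T n \<omega>))"] \<omega> \<open>0 < t\<close>
    by (cases "T n \<omega>") (auto simp: before_jump_def)
qed

lemma sets_all_jumps_before:
  assumes "0 \<le> t"
  shows "{\<omega> \<in> space M. \<forall>k. T k \<omega> \<le> ereal t} \<in> sets M"
proof -
  have "{\<omega> \<in> space M. T k \<omega> \<le> ereal t} \<in> sets M" for k
    using stopping[of k] assms usual_filtrationD(2)[OF usual assms]
    unfolding ext_stopping_time_def by blast
  moreover have "{\<omega> \<in> space M. \<forall>k. T k \<omega> \<le> ereal t} = (\<Inter>k. {\<omega> \<in> space M. T k \<omega> \<le> ereal t})"
    by auto
  ultimately show ?thesis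
    by auto
qed

text \<open>Integrating the indicator of \<open>(0, t \<and> T\<^sub>n]\<close>, the expected number of jumps among the first \<open>n\<close> that
  happen by time \<open>t\<close> equals the expected mass of the compensator, which is bounded uniformly in \<open>n\<close>. On
  the event that all jumps happen by time \<open>t\<close> that number is \<open>n\<close>.\<close>

lemma expected_jumps_bound:
  assumes n: "1 \<le> n" and t: "0 < t"
  shows "of_nat n * emeasure M {\<omega> \<in> space M. \<forall>k. T k \<omega> \<le> ereal t}
    \<le> ennreal (rate_bound * t) + (\<integral>\<^sup>+\<omega>. ennreal (p t \<omega>) \<partial>M)"
proof -
  interpret prob_space M by (rule prob)
  let ?B = "{\<omega> \<in> space M. \<forall>k. T k \<omega> \<le> ereal t}"
  let ?C = "\<lambda>x :: ('w \<times> real) \<times> 'e. indicator (before_jump n t) (fst x) :: ennreal"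
  let ?c = "ennreal (rate_bound * t)"
  define v where "v \<omega> = (\<integral>\<^sup>+(s, x). ?C ((\<omega>, s), x) \<partial>\<mu> \<omega>)" for \<omega>
  have C[measurable]: "?C \<in> borel_measurable (predictable M F \<Otimes>\<^sub>M borel)"
    using predictable_before_jump[OF t] by measurable
  have v_eq: "v \<omega> = (\<integral>\<^sup>+(s, x)\<in>{0<..t} \<times> space borel. ?C ((\<omega>, s), x) \<partial>\<mu> \<omega>)" for \<omega>
    unfolding v_def by (intro nn_integral_cong) (auto simp: before_jump_def indicator_def)
  have "(\<lambda>(\<omega>, t). \<integral>\<^sup>+(s, x)\<in>{0<..t} \<times> space borel. ?C ((\<omega>, s), x) \<partial>\<mu> \<omega>) \<in> borel_measurable (predictable M F)"
    using projection C unfolding dual_predictable_projection_def predictable_random_measure_def by blast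
  from measurable_compose[OF measurable_predictable_section_state[OF usual t] this]
  have v[measurable]: "v \<in> borel_measurable M"
    by (simp add: v_eq[abs_def])
  have B: "?B \<in> sets M"
    using t by (intro sets_all_jumps_before) simp
  have "of_nat n * emeasure M ?B = (\<integral>\<^sup>+\<omega>. of_nat n * indicator ?B \<omega> \<partial>M)"
    using B by (simp add: nn_integral_cmult_indicator)
  also have "\<dots> \<le> (\<integral>\<^sup>+\<omega>. (\<integral>\<^sup>+(s, x). ?C ((\<omega>, s), x) \<partial>signal_jump_measure T X \<omega>) \<partial>M)"
  proof (rule nn_integral_mono)
    fix \<omega> assume \<omega>: "\<omega> \<in> space M"
    let ?I = "{k. 1 \<le> k \<and> T k \<omega> < \<infinity>}"
    have "(\<lambda>y. ?C ((\<omega>, fst y), snd y)) \<in> borel_measurable (pos_time \<Otimes>\<^sub>M borel)"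
      using measurable_predictable_section_time[OF usual \<omega>] by measurable
    then have m: "(\<integral>\<^sup>+(s, x). ?C ((\<omega>, s), x) \<partial>signal_jump_measure T X \<omega>) =
        (\<integral>\<^sup>+k. ?C ((\<omega>, real_of_ereal (T k \<omega>)), X (real_of_ereal (T k \<omega>)) \<omega>) \<partial>count_space ?I)"
      unfolding signal_jump_measure_def case_prod_beta
      using T_pos[OF \<omega>] by (subst nn_integral_marked_counting_measure) auto
    show "of_nat n * indicator ?B \<omega> \<le> (\<integral>\<^sup>+(s, x). ?C ((\<omega>, s), x) \<partial>signal_jump_measure T X \<omega>)"
    proof (cases "\<omega> \<in> ?B")
      case True
      have fin: "T k \<omega> < \<infinity>" for k
      proof (rule order.strict_trans1)
        show "T k \<omega> \<le> ereal t"
          using True by simp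
      qed simp
      then have I: "{1..n} \<subseteq> ?I"
        by auto
      have "indicator {1..n} k \<le> ?C ((\<omega>, real_of_ereal (T k \<omega>)), X (real_of_ereal (T k \<omega>)) \<omega>)" for k
      proof (cases "k \<in> {1..n}")
        case k: True
        obtain r where r: "T k \<omega> = ereal r"
          using T_real[OF \<omega> fin] by metis
        have "T k \<omega> \<le> ereal t"
          using True by simp
        moreover have "0 < T k \<omega>" "T k \<omega> \<le> T n \<omega>"
          using k monoD[OF T_mono[OF \<omega>], of k n] T_pos[OF \<omega>, of k] by simp_all
        ultimately have "0 < r" "r \<le> t" "ereal r \<le> T n \<omega>"
          unfolding r by simp_all
        then show ?thesis
          using \<omega> r by (auto simp: before_jump_def indicator_def)
      qed simp
      then have "(\<integral>\<^sup>+k. indicator {1..n} k \<partial>count_space ?I)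
          \<le> (\<integral>\<^sup>+k. ?C ((\<omega>, real_of_ereal (T k \<omega>)), X (real_of_ereal (T k \<omega>)) \<omega>) \<partial>count_space ?I)"
        by (intro nn_integral_mono)
      moreover have "(\<integral>\<^sup>+k. indicator {1..n} k \<partial>count_space ?I) = of_nat n"
        using I by (subst nn_integral_indicator) auto
      ultimately show ?thesis
        using True m by simp
    qed simp
  qed
  also have "\<dots> = (\<integral>\<^sup>+\<omega>. v \<omega> \<partial>M)"
    unfolding v_def
    by (rule mp[OF spec[OF conjunct2[OF projection[unfolded dual_predictable_projection_def]]] C, symmetric])
  \<comment> \<open>The integral of a sum splits for measurable summands. Writing \<open>v\<close> as \<open>?c + (v - ?c)\<close> and only then
    comparing \<open>v - ?c\<close> with \<open>p t\<close> leaves \<open>p t\<close> out of the splitting.\<close>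
  also have "\<dots> \<le> (\<integral>\<^sup>+\<omega>. ?c + (v \<omega> - ?c) \<partial>M)"
    using ennreal_minus_le_iff[THEN iffD1, OF order_refl] by (intro nn_integral_mono) blast
  also have "\<dots> = ?c + (\<integral>\<^sup>+\<omega>. v \<omega> - ?c \<partial>M)"
    by (subst nn_integral_add) (auto simp: emeasure_space_1)
  also have "(\<integral>\<^sup>+\<omega>. v \<omega> - ?c \<partial>M) \<le> (\<integral>\<^sup>+\<omega>. ennreal (p t \<omega>) \<partial>M)"
  proof (rule nn_integral_mono_AE)
    show "AE \<omega> in M. v \<omega> - ?c \<le> ennreal (p t \<omega>)"
      using AE_compensated AE_space
    proof eventually_elim
      case (elim \<omega>)
      obtain u where u: "0 < u" "u \<le> t" "ereal u \<le> T n \<omega>"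
        "\<And>s. (\<omega>, s) \<in> before_jump n t \<longleftrightarrow> s \<in> {0<..u}"
        using section_before_jump[OF elim(2) n t] by blast
      have "{0<..u} \<times> UNIV \<in> sets (\<mu> \<omega>)"
        unfolding sets_compensator[OF elim(2)] by (intro pair_measureI) auto
      moreover have "v \<omega> = (\<integral>\<^sup>+y. indicator ({0<..u} \<times> UNIV) y \<partial>\<mu> \<omega>)"
        unfolding v_def by (intro nn_integral_cong) (auto simp: u(4) indicator_def)
      ultimately have "v \<omega> = emeasure (\<mu> \<omega>) ({0<..u} \<times> UNIV)"
        by simp
      also have "\<dots> \<le> ennreal (rate_bound * u) + ennreal (p u \<omega>)"
        using elim u by (intro compensator_bound)
      also have "\<dots> \<le> ?c + ennreal (p t \<omega>)"
        using u rate_bound(1) p_mono[OF elim(2), of u t]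
        by (intro add_mono ennreal_leI mult_left_mono) auto
      finally show ?case
        by (simp add: ennreal_minus_le_iff)
    qed
  qed
  finally show ?thesis
    by (simp add: add_left_mono)
qed

text \<open>The bound holds for all \<open>n\<close>, so the probability that all jumps happen by a given time is \<open>0\<close>.\<close>

lemma AE_no_explosion: "AE \<omega> in M. \<forall>t. \<exists>k. ereal t < T k \<omega>"
proof -
  interpret prob_space M by (rule prob)
  have "AE \<omega> in M. \<exists>k. ereal (real (Suc j)) < T k \<omega>" for j
  proof -
    let ?t = "real (Suc j)"
    let ?B = "{\<omega> \<in> space M. \<forall>k. T k \<omega> \<le> ereal ?t}"
    let ?K = "ennreal (rate_bound * ?t) + (\<integral>\<^sup>+\<omega>. ennreal (p ?t \<omega>) \<partial>M)"
    have "?K < \<infinity>"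
      using p_integrable[of ?t] by simp
    have B: "?B \<in> sets M"
      by (intro sets_all_jumps_before) simp
    have "measure M ?B \<le> 0"
    proof (rule ccontr)
      assume "\<not> measure M ?B \<le> 0"
      then obtain n where n: "enn2real ?K < real n * measure M ?B"
        using reals_Archimedean3[of "measure M ?B"] by auto
      have "ennreal (real (Suc n) * measure M ?B) = of_nat (Suc n) * emeasure M ?B"
        by (simp only: emeasure_eq_measure ennreal_of_nat_eq_real_of_nat ennreal_mult' of_nat_0_le_iff)
      also have "\<dots> \<le> ?K"
        by (rule expected_jumps_bound) auto
      also have "\<dots> = ennreal (enn2real ?K)"
        using \<open>?K < \<infinity>\<close> by simp
      finally have "real (Suc n) * measure M ?B \<le> enn2real ?K"
        by (simp add: ennreal_le_iff)
      moreover have "real n * measure M ?B \<le> real (Suc n) * measure M ?B"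
        by (intro mult_right_mono) auto
      ultimately show False
        using n by linarith
    qed
    then have "?B \<in> null_sets M"
      using B by (auto simp: null_sets_def emeasure_eq_measure measure_le_0_iff)
    from AE_not_in[OF this] AE_space show ?thesis
      by eventually_elim (auto simp: not_le)
  qed
  then have "AE \<omega> in M. \<forall>j. \<exists>k. ereal (real (Suc j)) < T k \<omega>"
    by (simp add: AE_all_countable)
  then show ?thesis
  proof eventually_elim
    case (elim \<omega>)
    show ?case
    proof
      fix t
      obtain j where "t \<le> real j"
        using real_arch_simple by blast
      then have "ereal t \<le> ereal (real (Suc j))"
        by simp
      with elim show "\<exists>k. ereal t < T k \<omega>"
        by (blast intro: order.strict_trans1)
    qed
  qed
qed


section \<open>The compensator of the history process\<close>

text \<open>On these trajectories, almost all of them, every time lies between two jumps, and the formula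
  for the compensator of the signal determines that measure.\<close>

definition regular :: "'w \<Rightarrow> bool" where
  "regular \<omega> \<longleftrightarrow> \<omega> \<in> space M \<and> compensated_at \<omega> \<and> (\<forall>t. \<exists>k. ereal t < T k \<omega>)"

lemma AE_regular: "AE \<omega> in M. regular \<omega>"
  using AE_compensated AE_no_explosion AE_space by eventually_elim (simp add: regular_def)

lemma regularD:
  assumes "regular \<omega>"
  shows "\<omega> \<in> space M" "compensated_at \<omega>" "\<exists>k. ereal t < T k \<omega>"
  using assms by (auto simp: regular_def)

lemma regular_between_jumps:
  assumes r: "regular \<omega>" and "0 < s"
  obtains n where "between_jumps n \<omega> s"
proof -
  obtain k where "ereal s < T k \<omega>"
    using regularD(3)[OF r] by blast
  then show thesis
    using between_jumps_exists[OF regularD(1)[OF r] \<open>0 < s\<close>, of k] that by (auto intro: less_imp_le)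
qed

text \<open>Between two jumps the past of the signal does not vary with time: as a path-valued function
  of time it takes countably many values, each of them on a Borel set of times.\<close>

lemma measurable_past:
  assumes r: "regular \<omega>"
  shows "(\<lambda>s. (s, past \<omega> s)) \<in> pos_time \<rightarrow>\<^sub>M pos_time \<Otimes>\<^sub>M skorokhod_borel"
proof (rule measurable_Pair)
  note \<omega> = regularD(1)[OF r]
  show "past \<omega> \<in> pos_time \<rightarrow>\<^sub>M skorokhod_borel"
  proof (rule measurable_piecewise_restrict)
    show "countable (range (\<lambda>n. {s. between_jumps n \<omega> s}))"
      by simp
    show "space pos_time \<subseteq> \<Union> (range (\<lambda>n. {s. between_jumps n \<omega> s}))"
      using regular_between_jumps[OF r] by auto metis
    fix \<Omega> assume "\<Omega> \<in> range (\<lambda>n. {s. between_jumps n \<omega> s})"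
    then obtain n where n: "\<Omega> = {s. between_jumps n \<omega> s}"
      by blast
    have "\<Omega> \<in> sets borel"
      unfolding n between_jumps_def by measurable
    then show "\<Omega> \<inter> space pos_time \<in> sets pos_time"
      by (auto simp: sets_restrict_space)
    have eq: "past \<omega> s = path_of_history (partial_history T X n \<omega>)" if "s \<in> \<Omega>" for s
      using that left_stopped_path_eq[OF \<omega>] n by simp
    show "past \<omega> \<in> restrict_space pos_time \<Omega> \<rightarrow>\<^sub>M skorokhod_borel"
    proof (rule measurableI)
      fix s assume "s \<in> space (restrict_space pos_time \<Omega>)"
      then show "past \<omega> s \<in> space skorokhod_borel"
        using left_stopped_path_in_skorokhod_paths[OF \<omega>] n by (auto simp: space_restrict_space)
    next
      fix A :: "(real \<Rightarrow> 'e) set"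
      let ?S = "space (restrict_space pos_time \<Omega>)"
      have "?S \<subseteq> \<Omega>"
        by (auto simp: space_restrict_space)
      then have "past \<omega> -` A \<inter> ?S = (if path_of_history (partial_history T X n \<omega>) \<in> A then ?S else {})"
        using eq by auto
      then show "past \<omega> -` A \<inter> ?S \<in> sets (restrict_space pos_time \<Omega>)"
        by (metis sets.top sets.empty_sets)
    qed
  qed
qed simp

text \<open>The measure \<open>ds\<close> is weighted by the rate and \<open>dp\<close> restricted to positive times, which brings the
  formula into the form of a disintegration.\<close>

lemma emeasure_compensator:
  assumes r: "regular \<omega>" and C: "C \<in> sets (pos_time \<Otimes>\<^sub>M borel)"
  shows "emeasure (\<mu> \<omega>) C =
    (\<integral>\<^sup>+s\<in>{0<..}. ennreal (rate (s, past \<omega> s)) * emeasure (Q (s, past \<omega> s)) (Pair s -` C) \<partial>lborel) +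
    (\<integral>\<^sup>+s\<in>{0<..}. emeasure (R (s, past \<omega> s)) (Pair s -` C) \<partial>stieltjes p \<omega>)"
proof -
  note \<omega> = regularD(1)[OF r] and past = measurable_past[OF r]
  let ?l = "restrict_space lborel {0 :: real<..}"
  let ?r = "\<lambda>s. ennreal (rate (s, past \<omega> s))"
  let ?\<nu> = "density ?l ?r" and ?\<nu>' = "restrict_space (stieltjes p \<omega>) {0<..}"
  have sets_l: "sets ?l = sets pos_time"
    by (intro sets_restrict_space_cong) simp
  have sets_\<nu>: "sets ?\<nu> = sets pos_time" "sets ?\<nu>' = sets pos_time"
    using sets_l by (simp_all only: sets_density sets_restrict_space_cong[OF sets_stieltjes])
  have "rate \<in> borel_measurable (pos_time \<Otimes>\<^sub>M skorokhod_borel)"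
    using rate by (simp add: bounded_rate_def)
  from measurable_compose[OF past this] have "?r \<in> borel_measurable pos_time"
    by measurable
  then have r_meas: "?r \<in> borel_measurable ?l"
    using measurable_cong_sets[OF sets_l refl] by blast
  have \<kappa>: "(\<lambda>s. Q (s, past \<omega> s)) \<in> pos_time \<rightarrow>\<^sub>M prob_algebra borel"
    "(\<lambda>s. R (s, past \<omega> s)) \<in> pos_time \<rightarrow>\<^sub>M prob_algebra borel"
    using measurable_compose[OF past Q] measurable_compose[OF past R] .
  have slice: "(\<lambda>s. emeasure (Q (s, past \<omega> s)) (Pair s -` C)) \<in> borel_measurable ?l"
    if C: "C \<in> sets (pos_time \<Otimes>\<^sub>M borel)" for C
  proof -
    have "(SIGMA s:space pos_time. Pair s -` C) = C"
      using sets.sets_into_space[OF C] by (auto simp: space_pair_measure)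
    then have "(\<lambda>s. emeasure (Q (s, past \<omega> s)) (Pair s -` C)) \<in> borel_measurable pos_time"
      using C \<kappa>(1) by (intro emeasure_measurable_subprob_algebra2 measurable_prob_algebraD) auto
    then show ?thesis
      using measurable_cong_sets[OF sets_l refl] by blast
  qed
  have \<nu>_eq: "(\<integral>\<^sup>+s. emeasure (Q (s, past \<omega> s)) (Pair s -` C) \<partial>?\<nu>) =
      (\<integral>\<^sup>+s\<in>{0<..}. ?r s * emeasure (Q (s, past \<omega> s)) (Pair s -` C) \<partial>lborel)"
    if "C \<in> sets (pos_time \<Otimes>\<^sub>M borel)" for C
    using nn_integral_density[OF r_meas slice[OF that]] by (simp add: nn_integral_restrict_space)
  have rect: "emeasure K (Pair s -` ({0<..t} \<times> B)) = emeasure K B * indicator {0<..t} s"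
    for K :: "'e measure" and s t :: real and B
    by (auto simp: indicator_def)
  have "emeasure (\<mu> \<omega>) C =
    (\<integral>\<^sup>+s. emeasure (Q (s, past \<omega> s)) (Pair s -` C) \<partial>?\<nu>) +
    (\<integral>\<^sup>+s. emeasure (R (s, past \<omega> s)) (Pair s -` C) \<partial>?\<nu>')"
  proof (rule disintegration_of_rectangles[OF sets_compensator[OF \<omega>] \<kappa> sets_\<nu> _ _ C])
    fix t :: real and B :: "'e set" assume t: "0 < t" and B: "B \<in> sets borel"
    have "{0<..t} \<times> B \<in> sets (pos_time \<Otimes>\<^sub>M borel)"
      using B by (intro pair_measureI) auto
    from \<nu>_eq[OF this]
    have "(\<integral>\<^sup>+s\<in>{0<..t}. emeasure (Q (s, past \<omega> s)) B \<partial>?\<nu>) =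
        (\<integral>\<^sup>+s\<in>{0<..t}. emeasure (Q (s, past \<omega> s)) B * ?r s \<partial>lborel)"
      unfolding rect by (simp, intro nn_integral_cong) (auto simp: indicator_def mult.commute)
    moreover have "(\<integral>\<^sup>+s\<in>{0<..t}. emeasure (R (s, past \<omega> s)) B \<partial>?\<nu>') =
        (\<integral>\<^sup>+s\<in>{0<..t}. emeasure (R (s, past \<omega> s)) B \<partial>stieltjes p \<omega>)"
      by (subst nn_integral_restrict_space) (auto simp: indicator_def intro!: nn_integral_cong)
    ultimately show "emeasure (\<mu> \<omega>) ({0<..t} \<times> B) =
        (\<integral>\<^sup>+s\<in>{0<..t}. emeasure (Q (s, past \<omega> s)) B \<partial>?\<nu>) +
        (\<integral>\<^sup>+s\<in>{0<..t}. emeasure (R (s, past \<omega> s)) B \<partial>?\<nu>')"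
      using regularD(2)[OF r] t B by (simp add: compensated_at_def)
  next
    fix t :: real assume t: "0 < t"
    obtain k where "ereal t < T k \<omega>"
      using regularD(3)[OF r] by blast
    then have "emeasure (\<mu> \<omega>) ({0<..t} \<times> UNIV) \<le> ennreal (rate_bound * t) + ennreal (p t \<omega>)"
      using t by (intro compensator_bound[OF \<omega> regularD(2)[OF r], of _ k]) auto
    also have "\<dots> < \<infinity>"
      by simp
    finally show "emeasure (\<mu> \<omega>) ({0<..t} \<times> space borel) < \<infinity>"
      by simp
  qed
  also have "(\<integral>\<^sup>+s. emeasure (R (s, past \<omega> s)) (Pair s -` C) \<partial>?\<nu>') =
      (\<integral>\<^sup>+s\<in>{0<..}. emeasure (R (s, past \<omega> s)) (Pair s -` C) \<partial>stieltjes p \<omega>)"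
    by (rule nn_integral_restrict_space) simp
  finally show ?thesis
    unfolding \<nu>_eq[OF C] .
qed

definition history_measure :: "'w \<Rightarrow> (real \<times> 'e history) measure" where
  "history_measure \<omega> = distr (\<mu> \<omega>) (pos_time \<Otimes>\<^sub>M history_borel)
     (\<lambda>y. (fst y, next_history ((\<omega>, fst y), snd y)))"

lemma sets_history_measure [simp]: "sets (history_measure \<omega>) = sets (pos_time \<Otimes>\<^sub>M history_borel)"
  by (simp add: history_measure_def)

lemma measurable_next_history_section:
  assumes \<omega>: "\<omega> \<in> space M"
  shows "(\<lambda>y. (fst y, next_history ((\<omega>, fst y), snd y))) \<in>
    pos_time \<Otimes>\<^sub>M borel \<rightarrow>\<^sub>M pos_time \<Otimes>\<^sub>M history_borel"
proof (rule measurable_Pair)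
  have "(\<lambda>y. ((\<omega>, fst y), snd y)) \<in> pos_time \<Otimes>\<^sub>M borel \<rightarrow>\<^sub>M predictable M F \<Otimes>\<^sub>M (borel :: 'e measure)"
    using measurable_predictable_section_time[OF usual \<omega>] by measurable
  from measurable_compose[OF this measurable_next_history]
  show "(\<lambda>y. next_history ((\<omega>, fst y), snd y)) \<in> pos_time \<Otimes>\<^sub>M borel \<rightarrow>\<^sub>M history_borel" .
qed simp

lemma measurable_next_history_section':
  "\<omega> \<in> space M \<Longrightarrow> (\<lambda>y. (fst y, next_history ((\<omega>, fst y), snd y))) \<in> \<mu> \<omega> \<rightarrow>\<^sub>M pos_time \<Otimes>\<^sub>M history_borel"
  using measurable_next_history_section measurable_cong_sets[OF sets_compensator refl] by blast

text \<open>The disintegration of the compensator of the signal is evaluated on the preimage \<open>?C\<close> of a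
  rectangle, whose sections carry, under the kernel \<open>Q\<close> or \<open>R\<close>, the mass that the induced kernel on
  histories gives to \<open>B\<close>.\<close>

lemma emeasure_history_measure:
  assumes r: "regular \<omega>" and t: "0 < t" and B: "B \<in> sets history_borel"
  defines "h \<equiv> \<lambda>s. history_left_lim (history_process T X) s \<omega>"
  shows "emeasure (history_measure \<omega>) ({0<..t} \<times> B) =
    (\<integral>\<^sup>+s\<in>{0<..t}. ennreal (history_rate rate s (h s)) * history_kernel Q s (h s) B \<partial>lborel) +
    (\<integral>\<^sup>+s\<in>{0<..t}. history_kernel R s (h s) B \<partial>stieltjes p \<omega>)"
proof -
  note \<omega> = regularD(1)[OF r]
  let ?f = "\<lambda>y. (fst y, next_history ((\<omega>, fst y), snd y))"
  let ?C = "?f -` ({0<..t} \<times> B) \<inter> space (pos_time \<Otimes>\<^sub>M (borel :: 'e measure))"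
  have tB: "{0<..t} \<times> B \<in> sets (pos_time \<Otimes>\<^sub>M history_borel)"
    using B by (intro pair_measureI) auto
  have C: "?C \<in> sets (pos_time \<Otimes>\<^sub>M borel)"
    by (rule measurable_sets[OF measurable_next_history_section[OF \<omega>] tB])
  have kernel: "history_kernel K s (h s) B = emeasure (K (s, past \<omega> s)) (Pair s -` ?C)"
    if s: "s \<in> {0<..t}" and K: "K \<in> pos_time \<Otimes>\<^sub>M skorokhod_borel \<rightarrow>\<^sub>M prob_algebra borel"
    for s and K :: "real \<times> (real \<Rightarrow> 'e) \<Rightarrow> 'e measure"
  proof -
    have "0 < s"
      using s by simp
    then obtain n where n: "between_jumps n \<omega> s"
      using regular_between_jumps[OF r] by blast
    have hs: "h s = partial_history T X n \<omega>"
      unfolding h_def by (rule history_left_lim_eq[OF \<omega> n])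
    have "(s, past \<omega> s) \<in> space (pos_time \<Otimes>\<^sub>M skorokhod_borel)"
      using measurable_space[OF measurable_past[OF r], of s] s by simp
    then have sets_K: "sets (K (s, past \<omega> s)) = sets borel"
      using measurable_space[OF K] by (auto simp: space_prob_algebra)
    have "history_kernel K s (h s) B = (\<integral>\<^sup>+e. indicator B (next_history ((\<omega>, s), e)) \<partial>K (s, past \<omega> s))"
      unfolding history_kernel_def hs by (simp add: left_stopped_path_eq[OF \<omega> n] next_history_eq[OF \<omega> n])
    also have "\<dots> = (\<integral>\<^sup>+e. indicator (Pair s -` ?C) e \<partial>K (s, past \<omega> s))"
      using s by (intro nn_integral_cong) (auto simp: indicator_def space_pair_measure)
    also have "\<dots> = emeasure (K (s, past \<omega> s)) (Pair s -` ?C)"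
      using sets_Pair1[OF C, of s] sets_K by (intro nn_integral_indicator) simp
    finally show ?thesis .
  qed
  have out: "Pair s -` ?C = {}" if "s \<notin> {0<..t}" for s
    using that by auto
  have rate_eq: "history_rate rate s (h s) = rate (s, past \<omega> s)" if s: "s \<in> {0<..t}" for s
  proof -
    have "0 < s"
      using s by simp
    then obtain n where n: "between_jumps n \<omega> s"
      using regular_between_jumps[OF r] by blast
    show ?thesis
      unfolding history_rate_def h_def by (simp add: history_left_lim_eq[OF \<omega> n] left_stopped_path_eq[OF \<omega> n])
  qed
  have "emeasure (history_measure \<omega>) ({0<..t} \<times> B) = emeasure (\<mu> \<omega>) ?C"
    unfolding history_measure_def
    using emeasure_distr[OF measurable_next_history_section'[OF \<omega>] tB]
      sets_eq_imp_space_eq[OF sets_compensator[OF \<omega>]] by simp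
  also have "\<dots> =
    (\<integral>\<^sup>+s\<in>{0<..}. ennreal (rate (s, past \<omega> s)) * emeasure (Q (s, past \<omega> s)) (Pair s -` ?C) \<partial>lborel) +
    (\<integral>\<^sup>+s\<in>{0<..}. emeasure (R (s, past \<omega> s)) (Pair s -` ?C) \<partial>stieltjes p \<omega>)"
    by (rule emeasure_compensator[OF r C])
  also have "(\<integral>\<^sup>+s\<in>{0<..}. ennreal (rate (s, past \<omega> s)) * emeasure (Q (s, past \<omega> s)) (Pair s -` ?C) \<partial>lborel) =
    (\<integral>\<^sup>+s\<in>{0<..t}. ennreal (history_rate rate s (h s)) * history_kernel Q s (h s) B \<partial>lborel)"
  proof (rule nn_integral_cong)
    fix s
    show "ennreal (rate (s, past \<omega> s)) * emeasure (Q (s, past \<omega> s)) (Pair s -` ?C) * indicator {0<..} s =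
        ennreal (history_rate rate s (h s)) * history_kernel Q s (h s) B * indicator {0<..t} s"
    proof (cases "s \<in> {0<..t}")
      case True
      then show ?thesis
        unfolding kernel[OF True Q] rate_eq[OF True] by simp
    next
      case False
      then show ?thesis
        unfolding out[OF False] by simp
    qed
  qed
  also have "(\<integral>\<^sup>+s\<in>{0<..}. emeasure (R (s, past \<omega> s)) (Pair s -` ?C) \<partial>stieltjes p \<omega>) =
    (\<integral>\<^sup>+s\<in>{0<..t}. history_kernel R s (h s) B \<partial>stieltjes p \<omega>)"
  proof (rule nn_integral_cong)
    fix s
    show "emeasure (R (s, past \<omega> s)) (Pair s -` ?C) * indicator {0<..} s =
        history_kernel R s (h s) B * indicator {0<..t} s"
    proof (cases "s \<in> {0<..t}")
      case True
      then show ?thesis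
        unfolding kernel[OF True R] by simp
    next
      case False
      then show ?thesis
        unfolding out[OF False] by simp
    qed
  qed
  finally show ?thesis .
qed

lemma history_compensator_history_measure:
  "history_compensator M Q rate R p (history_process T X) history_measure"
  unfolding history_compensator_def
proof
  show "random_measure M history_borel history_measure"
    by (simp add: random_measure_def)
  show "AE \<omega> in M. \<forall>t>0. \<forall>B\<in>sets history_borel. emeasure (history_measure \<omega>) ({0<..t} \<times> B) =
      (\<integral>\<^sup>+s\<in>{0<..t}. ennreal (history_rate rate s (history_left_lim (history_process T X) s \<omega>)) *
         history_kernel Q s (history_left_lim (history_process T X) s \<omega>) B \<partial>lborel) +
      (\<integral>\<^sup>+s\<in>{0<..t}. history_kernel R s (history_left_lim (history_process T X) s \<omega>) B \<partial>stieltjes p \<omega>)"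
    using AE_regular by eventually_elim (blast intro: emeasure_history_measure)
qed

text \<open>The formula gives the mass of the rectangles that start at time \<open>0\<close>, which is finite, and these
  determine the measure.\<close>

lemma history_compensator_unique:
  assumes "history_compensator M Q rate R p (history_process T X) \<mu>H"
  shows "AE \<omega> in M. \<mu>H \<omega> = history_measure \<omega>"
proof -
  have sets: "sets (\<mu>H \<omega>) = sets (pos_time \<Otimes>\<^sub>M history_borel)" if "\<omega> \<in> space M" for \<omega>
    using assms that by (simp add: history_compensator_def random_measure_def)
  have "AE \<omega> in M. \<forall>t>0. \<forall>B\<in>sets history_borel. emeasure (\<mu>H \<omega>) ({0<..t} \<times> B) =
      (\<integral>\<^sup>+s\<in>{0<..t}. ennreal (history_rate rate s (history_left_lim (history_process T X) s \<omega>)) *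
         history_kernel Q s (history_left_lim (history_process T X) s \<omega>) B \<partial>lborel) +
      (\<integral>\<^sup>+s\<in>{0<..t}. history_kernel R s (history_left_lim (history_process T X) s \<omega>) B \<partial>stieltjes p \<omega>)"
    using assms unfolding history_compensator_def by blast
  with AE_regular show ?thesis
  proof eventually_elim
    case (elim \<omega>)
    note \<omega> = regularD(1)[OF elim(1)]
    have eq: "emeasure (history_measure \<omega>) ({0<..t} \<times> B) = emeasure (\<mu>H \<omega>) ({0<..t} \<times> B)"
      if "0 < t" "B \<in> sets history_borel" for t B
      using elim(2) that emeasure_history_measure[OF elim(1) that] by simp
    have "history_measure \<omega> = \<mu>H \<omega>"
    proof (rule time_mark_measure_eqI[OF sets_history_measure sets[OF \<omega>] eq])
      fix t :: real assume t: "0 < t"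
      have "{0<..t} \<times> space history_borel \<in> sets (pos_time \<Otimes>\<^sub>M (history_borel :: 'e history measure))"
        by (intro pair_measureI sets.top) simp
      note emeasure_distr[OF measurable_next_history_section'[OF \<omega>] this, folded history_measure_def]
      also have "emeasure (\<mu> \<omega>) ((\<lambda>y. (fst y, next_history ((\<omega>, fst y), snd y))) -` ({0<..t} \<times> space history_borel)
          \<inter> space (\<mu> \<omega>)) \<le> emeasure (\<mu> \<omega>) ({0<..t} \<times> UNIV)"
      proof (rule emeasure_mono)
        show "{0<..t} \<times> UNIV \<in> sets (\<mu> \<omega>)"
          unfolding sets_compensator[OF \<omega>] by (intro pair_measureI) auto
      qed auto
      also obtain k where "ereal t < T k \<omega>"
        using regularD(3)[OF elim(1)] by blast
      then have "emeasure (\<mu> \<omega>) ({0<..t} \<times> UNIV) \<le> ennreal (rate_bound * t) + ennreal (p t \<omega>)"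
        using t by (intro compensator_bound[OF \<omega> regularD(2)[OF elim(1)], of _ k]) auto
      also have "\<dots> < \<infinity>"
        by simp
      finally show "emeasure (history_measure \<omega>) ({0<..t} \<times> space history_borel) < \<infinity>" .
    qed
    then show ?case
      by simp
  qed
qed

lemma nn_integral_history_measure:
  assumes \<omega>: "\<omega> \<in> space M" and C: "C \<in> borel_measurable (pos_time \<Otimes>\<^sub>M history_borel)"
  shows "(\<integral>\<^sup>+y. C y \<partial>history_measure \<omega>) = (\<integral>\<^sup>+y. C (fst y, next_history ((\<omega>, fst y), snd y)) \<partial>\<mu> \<omega>)"
  unfolding history_measure_def
  using C by (subst nn_integral_distr[OF measurable_next_history_section'[OF \<omega>]]) auto

lemma nn_integral_history_jump_measure:
  assumes \<omega>: "\<omega> \<in> space M" and C: "C \<in> borel_measurable (pos_time \<Otimes>\<^sub>M history_borel)"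
  shows "(\<integral>\<^sup>+y. C y \<partial>history_jump_measure T X \<omega>) =
    (\<integral>\<^sup>+y. C (fst y, next_history ((\<omega>, fst y), snd y)) \<partial>signal_jump_measure T X \<omega>)"
proof -
  let ?I = "{k. 1 \<le> k \<and> T k \<omega> < \<infinity>}"
  have "(\<integral>\<^sup>+y. C y \<partial>history_jump_measure T X \<omega>) =
      (\<integral>\<^sup>+k. C (real_of_ereal (T k \<omega>), partial_history T X k \<omega>) \<partial>count_space ?I)"
    unfolding history_jump_measure_def
    using T_pos[OF \<omega>] partial_history_in_history_set[OF \<omega>]
    by (intro nn_integral_marked_counting_measure C) auto
  also have "\<dots> = (\<integral>\<^sup>+k. C (fst (real_of_ereal (T k \<omega>), X (real_of_ereal (T k \<omega>)) \<omega>),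
      next_history ((\<omega>, fst (real_of_ereal (T k \<omega>), X (real_of_ereal (T k \<omega>)) \<omega>)),
        snd (real_of_ereal (T k \<omega>), X (real_of_ereal (T k \<omega>)) \<omega>))) \<partial>count_space ?I)"
    using next_history_at_jump[OF \<omega>] by (intro nn_integral_cong) simp
  also have "\<dots> = (\<integral>\<^sup>+y. C (fst y, next_history ((\<omega>, fst y), snd y)) \<partial>signal_jump_measure T X \<omega>)"
    unfolding signal_jump_measure_def
    using T_pos[OF \<omega>] measurable_compose[OF measurable_next_history_section[OF \<omega>] C]
    by (intro nn_integral_marked_counting_measure[symmetric]) auto
  finally show ?thesis .
qed

text \<open>Integrals against a solution of the formula and against the jump measure of the history are
  transported to the signal by the same map, so the defining identity for the signal yields the one
  for the history. On the exceptional null set only the monotonicity in time is available, and it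
  suffices for predictability.\<close>

theorem dual_predictable_projection_history:
  assumes \<mu>H: "history_compensator M Q rate R p (history_process T X) \<mu>H"
  shows "dual_predictable_projection M F history_borel \<mu>H (history_jump_measure T X)"
proof -
  let ?P = "predictable M F"
  obtain N where N: "N \<in> null_sets M" "\<And>\<omega>. \<omega> \<in> space M \<Longrightarrow> \<omega> \<notin> N \<Longrightarrow> \<mu>H \<omega> = history_measure \<omega>"
    using history_compensator_unique[OF \<mu>H] by (auto elim!: AE_E simp: null_sets_def subset_eq)
  have N_M: "N \<subseteq> space M" and N_F: "N \<in> sets (F 0)"
    using N(1) sets.sets_into_space usual_filtrationD(4)[OF usual N(1) subset_refl] by blast+
  {
    fix C :: "('w \<times> real) \<times> 'e history \<Rightarrow> ennreal"
    assume C: "C \<in> borel_measurable (?P \<Otimes>\<^sub>M history_borel)"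
    let ?D = "\<lambda>x. C (fst x, next_history x)"
    have "(\<lambda>x. (fst x, next_history x)) \<in> ?P \<Otimes>\<^sub>M borel \<rightarrow>\<^sub>M ?P \<Otimes>\<^sub>M history_borel"
      using measurable_next_history by (intro measurable_Pair) simp_all
    from measurable_compose[OF this C] have D: "?D \<in> borel_measurable (?P \<Otimes>\<^sub>M borel)" .
    have C_sec: "(\<lambda>y. C ((\<omega>, fst y), snd y)) \<in> borel_measurable (pos_time \<Otimes>\<^sub>M history_borel)"
      if "\<omega> \<in> space M" for \<omega>
    proof (rule measurable_compose[OF _ C])
      show "(\<lambda>y. ((\<omega>, fst y), snd y)) \<in> pos_time \<Otimes>\<^sub>M history_borel \<rightarrow>\<^sub>M ?P \<Otimes>\<^sub>M (history_borel :: 'e history measure)"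
        using measurable_predictable_section_time[OF usual that] by measurable
    qed
    let ?V = "\<lambda>\<omega> t. \<integral>\<^sup>+(s, x)\<in>{0<..t} \<times> space history_borel. C ((\<omega>, s), x) \<partial>\<mu>H \<omega>"
    let ?V' = "\<lambda>\<omega> t. \<integral>\<^sup>+(s, x)\<in>{0<..t} \<times> space borel. ?D ((\<omega>, s), x) \<partial>\<mu> \<omega>"
    have V_eq: "?V \<omega> t = ?V' \<omega> t" if \<omega>: "\<omega> \<in> space M" "\<omega> \<notin> N" for \<omega> t
    proof -
      have "?V \<omega> t = (\<integral>\<^sup>+y. C ((\<omega>, fst y), snd y) * indicator ({0<..t} \<times> space history_borel) y \<partial>history_measure \<omega>)"
        unfolding N(2)[OF \<omega>] by (simp add: case_prod_beta)
      also have "\<dots> = (\<integral>\<^sup>+y. C ((\<omega>, fst y), next_history ((\<omega>, fst y), snd y)) *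
          indicator ({0<..t} \<times> space history_borel) (fst y, next_history ((\<omega>, fst y), snd y)) \<partial>\<mu> \<omega>)"
      proof (subst nn_integral_history_measure[OF \<omega>(1)])
        have "{0<..t} \<times> space history_borel \<in> sets (pos_time \<Otimes>\<^sub>M (history_borel :: 'e history measure))"
          by (intro pair_measureI sets.top) simp
        then show "(\<lambda>y. C ((\<omega>, fst y), snd y) * indicator ({0<..t} \<times> space history_borel) y)
            \<in> borel_measurable (pos_time \<Otimes>\<^sub>M history_borel)"
          using C_sec[OF \<omega>(1)] by (intro borel_measurable_times_ennreal borel_measurable_indicator)
      qed simp
      also have "\<dots> = ?V' \<omega> t"
      proof (rule nn_integral_cong)
        fix y assume "y \<in> space (\<mu> \<omega>)"
        then have "y \<in> space (pos_time \<Otimes>\<^sub>M borel)"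
          using sets_eq_imp_space_eq[OF sets_compensator[OF \<omega>(1)]] by simp
        from measurable_space[OF measurable_next_history_section[OF \<omega>(1)] this]
        have "next_history ((\<omega>, fst y), snd y) \<in> space history_borel"
          by (simp add: space_pair_measure)
        then show "C ((\<omega>, fst y), next_history ((\<omega>, fst y), snd y)) *
            indicator ({0<..t} \<times> space history_borel) (fst y, next_history ((\<omega>, fst y), snd y)) =
            (case y of (s, x) \<Rightarrow> ?D ((\<omega>, s), x)) * indicator ({0<..t} \<times> space borel) y"
          by (cases y) (auto simp: indicator_def)
      qed
      finally show ?thesis .
    qed
    have V': "(\<lambda>(\<omega>, t). ?V' \<omega> t) \<in> borel_measurable ?P"
      using projection D unfolding dual_predictable_projection_def predictable_random_measure_def by blast
    have "(\<lambda>x. ?V (fst x) (snd x)) \<in> borel_measurable ?P"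
    proof (rule measurable_piecewise_restrict)
      show "countable {N \<times> UNIV, (space M - N) \<times> (UNIV :: real set)}"
        by simp
      show "space ?P \<subseteq> \<Union> {N \<times> UNIV, (space M - N) \<times> UNIV}"
        by (auto simp: space_predictable[OF usual])
      fix \<Omega> assume \<Omega>: "\<Omega> \<in> {N \<times> UNIV, (space M - N) \<times> (UNIV :: real set)}"
      have "N \<times> {0<..} \<in> sets ?P" "(space M - N) \<times> {0<..} \<in> sets ?P"
        using predictable_after[OF usual _ N_F] predictable_after[OF usual _ sets.compl_sets[OF N_F]]
          usual_filtrationD(1)[OF usual, of 0] by simp_all
      moreover have "\<Omega> \<inter> space ?P = N \<times> {0<..} \<or> \<Omega> \<inter> space ?P = (space M - N) \<times> {0<..}"
        using \<Omega> N_M by (auto simp: space_predictable[OF usual])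
      ultimately show "\<Omega> \<inter> space ?P \<in> sets ?P"
        by metis
      show "(\<lambda>x. ?V (fst x) (snd x)) \<in> borel_measurable (restrict_space ?P \<Omega>)"
      proof (cases "\<Omega> = N \<times> UNIV")
        case True
        have mono: "?V \<omega> s \<le> ?V \<omega> t" if "s \<le> t" for \<omega> s t
          using that by (intro nn_integral_mono) (auto simp: indicator_def)
        show ?thesis
          unfolding True by (rule predictable_monotone_on_null_set[OF usual N(1) mono])
      next
        case False
        then have "\<Omega> = (space M - N) \<times> UNIV"
          using \<Omega> by simp
        then have "(\<lambda>x. ?V (fst x) (snd x)) \<in> borel_measurable (restrict_space ?P \<Omega>) \<longleftrightarrow>
            (\<lambda>(\<omega>, t). ?V' \<omega> t) \<in> borel_measurable (restrict_space ?P \<Omega>)"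
        proof (intro measurable_cong)
          fix x assume "x \<in> space (restrict_space ?P \<Omega>)"
          then have "fst x \<in> space M" "fst x \<notin> N"
            using \<open>\<Omega> = (space M - N) \<times> UNIV\<close> by (auto simp: space_restrict_space)
          from V_eq[OF this, of "snd x"]
          show "?V (fst x) (snd x) = (case x of (\<omega>, t) \<Rightarrow> ?V' \<omega> t)"
            by (simp only: case_prod_beta)
        qed
        then show ?thesis
          using measurable_restrict_space1[OF V'] by blast
      qed
    qed
    then have "(\<lambda>(\<omega>, t). ?V \<omega> t) \<in> borel_measurable ?P"
      by (simp add: case_prod_beta)
    moreover have "(\<integral>\<^sup>+\<omega>. (\<integral>\<^sup>+(s, x). C ((\<omega>, s), x) \<partial>\<mu>H \<omega>) \<partial>M) =
        (\<integral>\<^sup>+\<omega>. (\<integral>\<^sup>+(s, x). C ((\<omega>, s), x) \<partial>history_jump_measure T X \<omega>) \<partial>M)"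
    proof -
      have "(\<integral>\<^sup>+\<omega>. (\<integral>\<^sup>+(s, x). C ((\<omega>, s), x) \<partial>\<mu>H \<omega>) \<partial>M) =
          (\<integral>\<^sup>+\<omega>. (\<integral>\<^sup>+(s, x). ?D ((\<omega>, s), x) \<partial>\<mu> \<omega>) \<partial>M)"
      proof (rule nn_integral_cong_AE)
        show "AE \<omega> in M. (\<integral>\<^sup>+(s, x). C ((\<omega>, s), x) \<partial>\<mu>H \<omega>) = (\<integral>\<^sup>+(s, x). ?D ((\<omega>, s), x) \<partial>\<mu> \<omega>)"
          using history_compensator_unique[OF \<mu>H] AE_space
        proof eventually_elim
          case (elim \<omega>)
          then show ?case
            using nn_integral_history_measure[OF elim(2) C_sec[OF elim(2)]] by (simp add: case_prod_beta')
        qed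
      qed
      also have "\<dots> = (\<integral>\<^sup>+\<omega>. (\<integral>\<^sup>+(s, x). ?D ((\<omega>, s), x) \<partial>signal_jump_measure T X \<omega>) \<partial>M)"
        using projection D unfolding dual_predictable_projection_def by blast
      also have "\<dots> = (\<integral>\<^sup>+\<omega>. (\<integral>\<^sup>+(s, x). C ((\<omega>, s), x) \<partial>history_jump_measure T X \<omega>) \<partial>M)"
      proof (rule nn_integral_cong)
        fix \<omega> assume "\<omega> \<in> space M"
        from nn_integral_history_jump_measure[OF this C_sec[OF this]]
        show "(\<integral>\<^sup>+(s, x). ?D ((\<omega>, s), x) \<partial>signal_jump_measure T X \<omega>) =
            (\<integral>\<^sup>+(s, x). C ((\<omega>, s), x) \<partial>history_jump_measure T X \<omega>)"
          by (simp add: case_prod_beta')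
      qed
      finally show ?thesis .
    qed
    ultimately have "(\<lambda>(\<omega>, t). ?V \<omega> t) \<in> borel_measurable ?P \<and>
      (\<integral>\<^sup>+\<omega>. (\<integral>\<^sup>+(s, x). C ((\<omega>, s), x) \<partial>\<mu>H \<omega>) \<partial>M) =
        (\<integral>\<^sup>+\<omega>. (\<integral>\<^sup>+(s, x). C ((\<omega>, s), x) \<partial>history_jump_measure T X \<omega>) \<partial>M)" ..
  }
  then show ?thesis
    using \<mu>H
    unfolding dual_predictable_projection_def predictable_random_measure_def history_compensator_def
    by blast
qed

end


section \<open>The history process in the filtering model\<close>

theorem proposition3p3:
  fixes M :: "'w measure" and F :: "real \<Rightarrow> 'w measure" and Z :: "'z measure"
    and T :: "nat \<Rightarrow> 'w \<Rightarrow> ereal" and \<zeta> :: "nat \<Rightarrow> 'w \<Rightarrow> 'e::polish_space"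
    and X :: "real \<Rightarrow> 'w \<Rightarrow> 'e" and Y W :: "real \<Rightarrow> 'w \<Rightarrow> real" and y0 :: real
    and m \<mu> mi mp :: "'w \<Rightarrow> (real \<times> 'e) measure"
    and n \<nu> ni np :: "'w \<Rightarrow> (real \<times> 'z) measure"
    and b :: "real \<times> (real \<Rightarrow> 'e) \<times> real \<Rightarrow> real" and \<sigma> :: "real \<times> real \<Rightarrow> real"
    and Ki Kp :: "real \<times> (real \<Rightarrow> 'e) \<times> real \<times> 'e \<Rightarrow> real"
    and Gi Gp :: "real \<times> (real \<Rightarrow> 'e) \<times> real \<times> 'z \<Rightarrow> real"
    and Qm Rm :: "real \<times> (real \<Rightarrow> 'e) \<Rightarrow> 'e measure"
    and Qn Rn :: "real \<times> (real \<Rightarrow> 'e) \<times> real \<Rightarrow> 'z measure"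
    and lam_m :: "real \<times> (real \<Rightarrow> 'e) \<Rightarrow> real"
    and lam_n :: "real \<times> (real \<Rightarrow> 'e) \<times> real \<Rightarrow> real"
    and pm pn :: "real \<Rightarrow> 'w \<Rightarrow> real"
    and YF :: "real \<Rightarrow> 'w measure"
    and XX :: "real \<Rightarrow> 'w \<Rightarrow> 'e history"
  assumes "prob_space M" and "usual_filtration M F" and "lusin_space Z"
    \<comment> \<open>signal\<close>
    and "\<And>\<omega>. \<omega> \<in> space M \<Longrightarrow> T 0 \<omega> = 0"
    and "\<And>k. 1 \<le> k \<Longrightarrow> ext_stopping_time M F (T k)"
    and "\<And>k \<omega>. \<omega> \<in> space M \<Longrightarrow> 1 \<le> k \<Longrightarrow> 0 < T k \<omega> \<and> T k \<omega> \<le> T (Suc k) \<omega>"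
    and "\<And>k \<omega>. \<omega> \<in> space M \<Longrightarrow> 1 \<le> k \<Longrightarrow> T k \<omega> < \<infinity> \<Longrightarrow> T k \<omega> < T (Suc k) \<omega>"
    and "\<And>k. \<zeta> k \<in> stopped_algebra M F (T k) \<rightarrow>\<^sub>M borel"
    and "X = signal T \<zeta>"
    and "m = signal_jump_measure T X"
    and "dual_predictable_projection M F borel \<mu> m"
    \<comment> \<open>observation\<close>
    and "brownian_motion M F W"
    and "adapted_random_counting_measure M F Z n"
    and "dual_predictable_projection M F Z \<nu> n"
    and "b \<in> borel_measurable (nonneg_time \<Otimes>\<^sub>M skorokhod_borel \<Otimes>\<^sub>M borel)"
    and "\<sigma> \<in> borel_measurable (nonneg_time \<Otimes>\<^sub>M borel)"
    and "\<And>t y. 0 \<le> t \<Longrightarrow> 0 < \<sigma> (t, y)"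
    and "Ki \<in> borel_measurable (nonneg_time \<Otimes>\<^sub>M skorokhod_borel \<Otimes>\<^sub>M borel \<Otimes>\<^sub>M borel)"
    and "Kp \<in> borel_measurable (nonneg_time \<Otimes>\<^sub>M skorokhod_borel \<Otimes>\<^sub>M borel \<Otimes>\<^sub>M borel)"
    and "Gi \<in> borel_measurable (nonneg_time \<Otimes>\<^sub>M skorokhod_borel \<Otimes>\<^sub>M borel \<Otimes>\<^sub>M Z)"
    and "Gp \<in> borel_measurable (nonneg_time \<Otimes>\<^sub>M skorokhod_borel \<Otimes>\<^sub>M borel \<Otimes>\<^sub>M Z)"
    and "mi = restrict_times (jump_times borel m - atom_times borel \<mu>) m"
    and "mp = restrict_times (atom_times borel \<mu>) m"
    and "ni = restrict_times (jump_times Z n - atom_times Z \<nu>) n"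
    and "np = restrict_times (atom_times Z \<nu>) n"
    and "YF = completed_natural_filtration M Y"
    \<comment> \<open>standing assumptions\<close>
    and "observation_solution M F Z y0 b \<sigma> Ki Kp Gi Gp X W mi mp ni np Y"
    and "\<And>Y'. observation_solution M F Z y0 b \<sigma> Ki Kp Gi Gp X W mi mp ni np Y'
           \<Longrightarrow> AE \<omega> in M. \<forall>t\<ge>0. Y' t \<omega> = Y t \<omega>"
    and "AE \<omega> in M. \<forall>t>0. \<not> ((\<omega>, t) \<in> jump_times borel m \<and> (\<omega>, t) \<in> jump_times Z n)"
    and "Qm \<in> pos_time \<Otimes>\<^sub>M skorokhod_borel \<rightarrow>\<^sub>M prob_algebra borel"
    and "Rm \<in> pos_time \<Otimes>\<^sub>M skorokhod_borel \<rightarrow>\<^sub>M prob_algebra borel"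
    and "Qn \<in> pos_time \<Otimes>\<^sub>M skorokhod_borel \<Otimes>\<^sub>M borel \<rightarrow>\<^sub>M prob_algebra Z"
    and "Rn \<in> pos_time \<Otimes>\<^sub>M skorokhod_borel \<Otimes>\<^sub>M borel \<rightarrow>\<^sub>M prob_algebra Z"
    and "bounded_rate (pos_time \<Otimes>\<^sub>M skorokhod_borel) lam_m"
    and "bounded_rate (pos_time \<Otimes>\<^sub>M skorokhod_borel \<Otimes>\<^sub>M borel) lam_n"
    and "predictable_counting_process M YF pm"
    and "predictable_counting_process M YF pn"
    and "\<And>t. 0 \<le> t \<Longrightarrow> (\<integral>\<^sup>+\<omega>. ennreal (pm t \<omega>) \<partial>M) < \<infinity>"
    and "\<And>t. 0 \<le> t \<Longrightarrow> (\<integral>\<^sup>+\<omega>. ennreal (pn t \<omega>) \<partial>M) < \<infinity>"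
    and "AE \<omega> in M. \<forall>t>0. \<forall>A\<in>sets borel.
           emeasure (\<mu> \<omega>) ({0<..t} \<times> A) =
             (\<integral>\<^sup>+s\<in>{0<..t}. emeasure (Qm (s, left_stopped_path X s \<omega>)) A *
                ennreal (lam_m (s, left_stopped_path X s \<omega>)) \<partial>lborel) +
             (\<integral>\<^sup>+s\<in>{0<..t}. emeasure (Rm (s, left_stopped_path X s \<omega>)) A \<partial>stieltjes pm \<omega>)"
    and "AE \<omega> in M. \<forall>t>0. \<forall>B\<in>sets Z.
           emeasure (\<nu> \<omega>) ({0<..t} \<times> B) =
             (\<integral>\<^sup>+s\<in>{0<..t}. emeasure (Qn (s, left_stopped_path X s \<omega>, left_lim Y s \<omega>)) B *
                ennreal (lam_n (s, left_stopped_path X s \<omega>, left_lim Y s \<omega>)) \<partial>lborel) +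
             (\<integral>\<^sup>+s\<in>{0<..t}. emeasure (Rn (s, left_stopped_path X s \<omega>, left_lim Y s \<omega>)) B
                \<partial>stieltjes pn \<omega>)"
    \<comment> \<open>history process\<close>
    and "XX = history_process T X"
  shows "(\<exists>\<mu>H. history_compensator M Qm lam_m Rm pm XX \<mu>H) \<and>
    (\<forall>\<mu>H. history_compensator M Qm lam_m Rm pm XX \<mu>H \<longrightarrow>
       dual_predictable_projection M F history_borel \<mu>H (history_jump_measure T X))"
proof -
  note X = assms(9) and m = assms(10)
  have "dual_predictable_projection M F borel \<mu> (signal_jump_measure T (signal T \<zeta>))"
    using assms(11) unfolding m X .
  moreover have "counting_process M pm"
    using assms(36) unfolding predictable_counting_process_def by blast
  ultimately interpret compensated_signal M F T \<zeta> \<mu> Qm Rm lam_m pm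
    using assms(1,2,4-8,30,31,34,38) assms(40)[unfolded X]
    by (intro compensated_signal.intro jump_signal.intro compensated_signal_axioms.intro)
  show ?thesis
    using history_compensator_history_measure dual_predictable_projection_history
    unfolding assms(42) X by blast
qed

end
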